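(* Let $g:\mathbb{R}\to\mathbb{R}$ be a measurable function such that $g(u)\sim u^2/2$ as $u\to 0$ and $g(u)\le u^2/2$ for all $u\in\mathbb{R}$. Let $\rho$ be a symmetric probability measure on $\mathbb{R}$ with positive variance $\sigma^2$ such that there exists $v_0>0$ with $\int_{\mathbb{R}} e^{v_0 z^2}\,d\rho(z)<+\infty$. For each $n\ge 1$ let $(X_n^1,\dots,X_n^n)$ have the distribution $\widetilde{\mu}_{n,\rho,g}$ on $\mathbb{R}^n$ whose density with respect to $\rho^{\otimes n}$ is \[(x_1,\dots,x_n)\longmapsto \frac{1}{Z_{n,g}}\exp\left(n\,g\left(\frac{x_1+\dots+x_n}{\sqrt{n(x_1^2+\dots+x_n^2)}}\right)\right)\mathbf{1}_{\{x_1^2+\dots+x_n^2>0\}},\] where $Z_{n,g}$ is the normalizing constant, and set $S_n=X_n^1+\dots+X_n^n$, $T_n=(X_n^1)^2+\dots+(X_n^n)^2$. (Law of large numbers) Under $\widetilde{\mu}_{n,\rho,g}$, $(S_n/n,T_n/n)$ converges in probability to $(0,\sigma^2)$ as $n\to\infty$. (Fluctuations) Suppose in addition that $g$ has a fourth derivative at $0$ and that $\rho$ satisfies the Cramér condition \[\forall \alpha>0\qquad \sup_{\|(s,t)\|\ge\alpha}\left|\int_{\mathbb{R}} e^{isz+itz^2}\,d\rho(z)\right|<1.\] Let $\mu_4=\int_{\mathbb{R}} z^4\,d\rho(z)$ and $m_4=-g^{(4)}(0)/2$. Then $m_4\ge 0$ and, under $\widetilde{\mu}_{n,\rho,g}$,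 \[\left(\mu_4+m_4\sigma^4\right)^{1/4}\frac{S_n}{\sigma^2 n^{3/4}}\xrightarrow[n\to\infty]{\mathcal{L}} \left(\frac{4}{3}\right)^{1/4}\Gamma\left(\frac14\right)^{-1}\exp\left(-\frac{s^4}{12}\right)ds.\]
   Context: $\|\cdot\|$ denotes the Euclidean norm on $\mathbb{R}^2$. Convergence in law is denoted $\xrightarrow{\mathcal{L}}$; the limit is the probability measure on $\mathbb{R}$ with the displayed density. *)

theory Defs
  imports "HOL-Probability.Probability" "HOL-Library.Landau_Symbols"
begin

definition Ssum :: "nat \<Rightarrow> (nat \<Rightarrow> real) \<Rightarrow> real" where
  "Ssum n x = (\<Sum>i<n. x i)"

definition Tsum :: "nat \<Rightarrow> (nat \<Rightarrow> real) \<Rightarrow> real" where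
  "Tsum n x = (\<Sum>i<n. (x i)\<^sup>2)"

definition cw_weight :: "(real \<Rightarrow> real) \<Rightarrow> nat \<Rightarrow> (nat \<Rightarrow> real) \<Rightarrow> real" where
  "cw_weight g n x =
     (if Tsum n x > 0 then exp (real n * g (Ssum n x / sqrt (real n * Tsum n x))) else 0)"

definition cw_Z :: "real measure \<Rightarrow> (real \<Rightarrow> real) \<Rightarrow> nat \<Rightarrow> ennreal" where
  "cw_Z \<rho> g n = (\<integral>\<^sup>+ x. ennreal (cw_weight g n x) \<partial>(PiM {..<n} (\<lambda>_. \<rho>)))"

definition mu_tilde :: "real measure \<Rightarrow> (real \<Rightarrow> real) \<Rightarrow> nat \<Rightarrow> (nat \<Rightarrow> real) measure" where
  "mu_tilde \<rho> g n = density (PiM {..<n} (\<lambda>_. \<rho>)) (\<lambda>x. ennreal (cw_weight g n x) / cw_Z \<rho> g n)"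

end

theory Submission
  imports Defs "HOL-Real_Asymp.Real_Asymp"
begin

text \<open>
  Since \<rho> is symmetric, the signs of the coordinates are independent and fair given their moduli.
  Write Y = S / sqrt T. The weight is at most exp (Y^2 / 2), and this Gaussian factor can be
  linearised: multiplied by the normal density at z with mean Y it becomes
  exp (z Y - z^2 / 2) / sqrt (2 \<pi>), whose average over the signs is the product of the
  cosh (z x_i / sqrt T), times exp (- z^2 / 2) / sqrt (2 \<pi>). Put z = n^(1/4) t. Because the squares
  of the x_i / sqrt T sum to 1, a convexity argument bounds the average by a fixed Gaussian in t,
  whatever the moduli are; and by the weak law of large numbers it converges to
  exp (- \<mu>4 t^4 / (12 \<sigma>^4)) / sqrt (2 \<pi>). The uniform bound shows that tilting by exp (Y^2 / 2)
  costs only a factor n^(1/4), against which Chebyshev's inequality is strong enough: this gives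
  the law of large numbers. For the fluctuations, t differs from Y / n^(1/4) by a normal variable
  of standard deviation n^(-1/4), and the remaining factor exp (n (g u - u^2 / 2)) at
  u = Y / sqrt n tends to exp (- m4 t^4 / 12).
\<close>

text \<open>The tilt exp (Y^2 / 2) is critical: for an exactly standard normal Y its mean would be
  infinite. So a central limit theorem for Y cannot simply be inserted into the integral, and the
  sign average has to be computed before any limit is taken. In that average the quadratic terms
  cancel exactly: with a_i = z x_i / sqrt T, log cosh a = a^2 / 2 - a^4 / 12 + ..., and the a_i^2
  sum to z^2, which exp (- z^2 / 2) removes. What survives is - z^4 / 12 times the sum of the x_i^4
  / T^2, typically of order 1 / n; this dictates the scale z = n^(1/4) t. Sign averaging applies
  only to functions of the moduli and of t. Whatever depends on S must therefore be reached through
  t: S = Y sqrt T is close to \<sigma> t n^(3/4), and the two quartic terms add up to (\<mu>4 + m4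
  \<sigma>^4) t^4 / (12 \<sigma>^4), which is s^4 / 12 for s = (\<mu>4 + m4 \<sigma>^4)^(1/4) t /
  \<sigma>, the limit of the variable in the theorem. Factors common to the weight integral and to
  the normalizing constant, n^(1/4) among them, cancel in the end.\<close>

section \<open>Bounds for the hyperbolic cosine\<close>

lemma mono_from_zero:
  fixes f f' :: "real \<Rightarrow> real"
  assumes "\<And>x. x \<ge> 0 \<Longrightarrow> (f has_real_derivative f' x) (at x)" "\<And>x. x \<ge> 0 \<Longrightarrow> f' x \<ge> 0" "x \<ge> 0"
  shows "f 0 \<le> f x"
  by (rule DERIV_nonneg_imp_nondecreasing[OF assms(3)]) (use assms in blast)

lemma sinh_ge_self: "x \<le> sinh (x::real)" if "x \<ge> 0"
proof -
  have "sinh 0 - 0 \<le> sinh x - x"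
    by (rule mono_from_zero[where f = "\<lambda>x. sinh x - x" and f' = "\<lambda>x. cosh x - 1"])
       (auto intro!: derivative_eq_intros simp: cosh_real_ge_1 that)
  then show ?thesis by simp
qed

lemma tanh_le_self: "tanh (x::real) \<le> x" if "x \<ge> 0"
proof -
  have "0 - tanh 0 \<le> x - tanh x"
    by (rule mono_from_zero[where f = "\<lambda>x. x - tanh x" and f' = "\<lambda>x. (tanh x)\<^sup>2"])
       (auto intro!: derivative_eq_intros simp: that less_imp_neq[OF cosh_real_pos, symmetric])
  then show ?thesis by simp
qed

lemma tanh_square_ge: "x\<^sup>2 / (1 + x\<^sup>2) \<le> (tanh (x::real))\<^sup>2" if "x \<ge> 0"
proof -
  have "x\<^sup>2 \<le> (sinh x)\<^sup>2" using sinh_ge_self[OF that] that by (intro power_mono)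
  moreover have "(tanh x)\<^sup>2 = (sinh x)\<^sup>2 / (1 + (sinh x)\<^sup>2)"
    by (simp add: tanh_def power_divide cosh_square_eq add.commute)
  moreover have "x\<^sup>2 / (1 + x\<^sup>2) \<le> s / (1 + s)" if "x\<^sup>2 \<le> s" for s
  proof -
    have "1 + x\<^sup>2 > 0" "1 + s > 0" using that zero_le_power2[of x] by linarith+
    then show ?thesis using that by (simp add: divide_simps) (simp add: algebra_simps)
  qed
  ultimately show ?thesis by simp
qed

text \<open>Compare derivatives: that of x - tanh x is tanh^2 x, at least x^2 / (1 + x^2) by
  \<open>tanh_square_ge\<close>, and this dominates the derivative of the rational
  correction.\<close>

lemma tanh_le_rational: "tanh (x::real) \<le> x - x ^ 3 / (3 * (1 + x\<^sup>2))" if "x \<ge> 0"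
proof -
  have pos: "1 + x\<^sup>2 > 0" for x :: real by (auto intro: add_pos_nonneg)
  have "0 - 0 ^ 3 / (3 * (1 + 0\<^sup>2)) - tanh 0 \<le> x - x ^ 3 / (3 * (1 + x\<^sup>2)) - tanh x"
  proof (rule mono_from_zero[where f = "\<lambda>x. x - x ^ 3 / (3 * (1 + x\<^sup>2)) - tanh x"
        and f' = "\<lambda>x. (tanh x)\<^sup>2 - (3 * x\<^sup>2 + x ^ 4) / (3 * (1 + x\<^sup>2)\<^sup>2)"])
    fix x :: real assume x: "x \<ge> 0"
    have nz: "1 + x\<^sup>2 \<noteq> 0" using pos[of x] by simp
    show "((\<lambda>x. x - x ^ 3 / (3 * (1 + x\<^sup>2)) - tanh x) has_real_derivative
        (tanh x)\<^sup>2 - (3 * x\<^sup>2 + x ^ 4) / (3 * (1 + x\<^sup>2)\<^sup>2)) (at x)"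
      using nz
      by (auto intro!: derivative_eq_intros simp: less_imp_neq[OF cosh_real_pos, symmetric])
         (simp add: divide_simps, simp add: algebra_simps power_numeral_reduce)
    have "(3 * x\<^sup>2 + x ^ 4) / (3 * (1 + x\<^sup>2)\<^sup>2) \<le> x\<^sup>2 / (1 + x\<^sup>2)"
      using pos[of x] x
      by (simp add: divide_simps) (simp add: algebra_simps power_numeral_reduce)
    with tanh_square_ge[OF x] show "(tanh x)\<^sup>2 - (3 * x\<^sup>2 + x ^ 4) / (3 * (1 + x\<^sup>2)\<^sup>2) \<ge> 0"
      by simp
  qed (fact that)
  then show ?thesis by simp
qed

text \<open>Integrates \<open>tanh_le_rational\<close>. The correction must behave like x^4 / 12
  near 0, yet x^4 / 12 itself would be false for large x, where log cosh x grows linearly. Dividing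
  by 1 + x^2 repairs this and, as \<open>prod_cosh_le\<close> exploits, leaves a convex function of
  x^2.\<close>

lemma cosh_le_exp: "cosh (x::real) \<le> exp (x\<^sup>2 / 2 - x ^ 4 / (12 * (1 + x\<^sup>2)))"
proof -
  have pos: "1 + x\<^sup>2 > 0" for x :: real by (auto intro: add_pos_nonneg)
  have *: "cosh x \<le> exp (x\<^sup>2 / 2 - x ^ 4 / (12 * (1 + x\<^sup>2)))" if "x \<ge> 0" for x :: real
  proof -
    let ?f = "\<lambda>x::real. x\<^sup>2 / 2 - x ^ 4 / (12 * (1 + x\<^sup>2)) - ln (cosh x)"
    let ?f' = "\<lambda>x::real. x - x ^ 3 * (2 + x\<^sup>2) / (6 * (1 + x\<^sup>2)\<^sup>2) - tanh x"
    have "?f 0 \<le> ?f x"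
    proof (rule mono_from_zero[where f = ?f and f' = ?f'])
      fix x :: real assume x: "x \<ge> 0"
      have nz: "1 + x\<^sup>2 \<noteq> 0" using pos[of x] by simp
      show "(?f has_real_derivative ?f' x) (at x)"
        using nz
        by (auto intro!: derivative_eq_intros simp: tanh_def)
           (simp add: divide_simps, simp add: algebra_simps power_numeral_reduce)
      \<comment> \<open>The left side is the derivative of the correction; the inequality is 2 + x^2
        \<le> 2 (1 + x^2).\<close>
      have "x ^ 3 * (2 + x\<^sup>2) / (6 * (1 + x\<^sup>2)\<^sup>2) \<le> x ^ 3 / (3 * (1 + x\<^sup>2))"
        using pos[of x] x
        by (simp add: divide_simps) (simp add: algebra_simps power_numeral_reduce)
      with tanh_le_rational[OF x] show "?f' x \<ge> 0" by simp
    qed (fact that)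
    then have "ln (cosh x) \<le> x\<^sup>2 / 2 - x ^ 4 / (12 * (1 + x\<^sup>2))" by simp
    then have "exp (ln (cosh x)) \<le> exp (x\<^sup>2 / 2 - x ^ 4 / (12 * (1 + x\<^sup>2)))" by (simp only: exp_le_cancel_iff)
    then show ?thesis by simp
  qed
  show ?thesis using *[of "\<bar>x\<bar>"] by (simp add: power_even_abs)
qed

text \<open>The matching lower bound needs no damping: tanh x \<le> x is integrated twice.\<close>

lemma cosh_ge_exp: "exp (x\<^sup>2 / 2 - x ^ 4 / 12) \<le> cosh (x::real)"
proof -
  have tanh_ge: "x - x ^ 3 / 3 \<le> tanh x" if "x \<ge> 0" for x :: real
  proof -
    have "tanh 0 - 0 + 0 ^ 3 / 3 \<le> tanh x - x + x ^ 3 / 3"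
    proof (rule mono_from_zero[where f = "\<lambda>x::real. tanh x - x + x ^ 3 / 3" and f' = "\<lambda>x. x\<^sup>2 - (tanh x)\<^sup>2"])
      fix x :: real assume x: "x \<ge> 0"
      show "((\<lambda>x. tanh x - x + x ^ 3 / 3) has_real_derivative x\<^sup>2 - (tanh x)\<^sup>2) (at x)"
        by (auto intro!: derivative_eq_intros simp: less_imp_neq[OF cosh_real_pos, symmetric])
      show "x\<^sup>2 - (tanh x)\<^sup>2 \<ge> 0" using tanh_le_self[OF x] x by (simp add: power_mono)
    qed (fact that)
    then show ?thesis by simp
  qed
  have *: "exp (x\<^sup>2 / 2 - x ^ 4 / 12) \<le> cosh x" if "x \<ge> 0" for x :: real
  proof -
    let ?f = "\<lambda>x::real. ln (cosh x) - (x\<^sup>2 / 2 - x ^ 4 / 12)"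
    have "?f 0 \<le> ?f x"
    proof (rule mono_from_zero[where f = ?f and f' = "\<lambda>x. tanh x - (x - x ^ 3 / 3)"])
      fix x :: real assume x: "x \<ge> 0"
      show "(?f has_real_derivative tanh x - (x - x ^ 3 / 3)) (at x)"
        by (auto intro!: derivative_eq_intros simp: tanh_def)
      show "tanh x - (x - x ^ 3 / 3) \<ge> 0" using tanh_ge[OF x] by simp
    qed (fact that)
    then have "x\<^sup>2 / 2 - x ^ 4 / 12 \<le> ln (cosh x)" by simp
    then have "exp (x\<^sup>2 / 2 - x ^ 4 / 12) \<le> exp (ln (cosh x))" by (simp only: exp_le_cancel_iff)
    then show ?thesis by simp
  qed
  show ?thesis using *[of "\<bar>x\<bar>"] by (simp add: power_even_abs)
qed

text \<open>Jensen's inequality: the correction in \<open>cosh_le_exp\<close> is a convex function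
  of (a i)^2, so for a given sum of squares its total is smallest when all squares are equal. This
  makes the bound independent of the individual moduli.\<close>

lemma prod_cosh_le:
  fixes a :: "nat \<Rightarrow> real"
  assumes n: "n > 0" and a: "(\<Sum>i<n. (a i)\<^sup>2) = s\<^sup>2"
  shows "(\<Prod>i<n. cosh (a i)) \<le> exp (s\<^sup>2 / 2 - s ^ 4 / (12 * (n + s\<^sup>2)))"
proof -
  define m where "m = s\<^sup>2 / n"
  \<comment> \<open>The partial fraction form of w^2 / (1 + w), in which convexity is visible;
    \<open>m\<close> is the mean of the squares.\<close>
  define q where "q = (\<lambda>w::real. w - 1 + 1 / (1 + w))"
  have m0: "1 + m > 0" unfolding m_def by (simp add: add_pos_nonneg)
  have q: "x ^ 4 / (1 + x\<^sup>2) = q (x\<^sup>2)" for x :: real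
  proof -
    have "1 + x\<^sup>2 > 0" by (auto intro: add_pos_nonneg)
    then show ?thesis unfolding q_def by (simp add: divide_simps) (simp add: algebra_simps power_numeral_reduce)
  qed
  \<comment> \<open>The tangent of \<open>q\<close> at \<open>m\<close> has slope 1 - 1 / (1 + m)^2,
    and the gap to it is an explicit nonnegative fraction. The linear parts cancel on summation
    because \<open>m\<close> is the mean.\<close>
  have tangent: "q m + (1 - 1 / (1 + m)\<^sup>2) * (w - m) \<le> q w" if "w \<ge> 0" for w
  proof -
    have "q w - (q m + (1 - 1 / (1 + m)\<^sup>2) * (w - m)) = (w - m)\<^sup>2 / ((1 + w) * (1 + m)\<^sup>2)"
      using that m0 unfolding q_def
      by (simp add: divide_simps) (simp add: algebra_simps power_numeral_reduce)
    also have "\<dots> \<ge> 0" using that by simp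
    finally show ?thesis by simp
  qed
  have "n * q m = (\<Sum>i<n. q m + (1 - 1 / (1 + m)\<^sup>2) * ((a i)\<^sup>2 - m))"
    using n by (simp add: sum.distrib sum_distrib_left[symmetric] sum_subtractf a m_def)
  also have "\<dots> \<le> (\<Sum>i<n. q ((a i)\<^sup>2))" by (intro sum_mono tangent) simp
  finally have le: "n * q m \<le> (\<Sum>i<n. q ((a i)\<^sup>2))" .
  have nq: "n * q m = s ^ 4 / (n + s\<^sup>2)"
  proof -
    have "n + s\<^sup>2 > 0" using n by (simp add: add_pos_nonneg)
    then show ?thesis using n unfolding q_def m_def by (simp add: divide_simps) (simp add: algebra_simps power_numeral_reduce)
  qed
  have "(\<Prod>i<n. cosh (a i)) \<le> (\<Prod>i<n. exp ((a i)\<^sup>2 / 2 - (a i) ^ 4 / (12 * (1 + (a i)\<^sup>2))))"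
    by (intro prod_mono conjI cosh_le_exp cosh_real_nonneg)
  also have "\<dots> = exp (\<Sum>i<n. (a i)\<^sup>2 / 2 - q ((a i)\<^sup>2) / 12)"
    by (simp add: exp_sum q[symmetric] mult.commute)
  also have "(\<Sum>i<n. (a i)\<^sup>2 / 2 - q ((a i)\<^sup>2) / 12) = s\<^sup>2 / 2 - (\<Sum>i<n. q ((a i)\<^sup>2)) / 12"
    by (simp add: sum_subtractf sum_divide_distrib[symmetric] a)
  also have "exp \<dots> \<le> exp (s\<^sup>2 / 2 - n * q m / 12)" using le by simp
  also have "n * q m / 12 = s ^ 4 / (12 * (n + s\<^sup>2))" by (simp add: nq)
  finally show ?thesis .
qed

text \<open>At the scale s = r t with r^4 = n the quartic correction is t^4 / (1 + t^2 / r^2), which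
  for r \<ge> 1 is at least t^4 / (1 + t^2) \<ge> t^2 - 1. The bound is thus the same for all n and
  all moduli.\<close>

lemma prod_cosh_gauss_le:
  fixes a :: "nat \<Rightarrow> real"
  assumes r: "r \<ge> 1" "r ^ 4 = real n" and a: "(\<Sum>i<n. (a i)\<^sup>2) = (r * t)\<^sup>2"
  shows "(\<Prod>i<n. cosh (a i)) * exp (- (r * t)\<^sup>2 / 2) \<le> exp (1 / 12 - t\<^sup>2 / 12)"
proof -
  have n: "n > 0" using r by (cases n) auto
  have pos: "r ^ 4 + (r * t)\<^sup>2 > 0" using n by (simp add: r(2) add_pos_nonneg)
  have r2: "1 \<le> r\<^sup>2" using r by simp
  have "t\<^sup>2 - 1 \<le> t ^ 4 / (1 + t\<^sup>2)"
  proof -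
    have "1 + t\<^sup>2 > 0" by (auto intro: add_pos_nonneg)
    then show ?thesis by (simp add: divide_simps) (simp add: algebra_simps power_numeral_reduce)
  qed
  also have "t ^ 4 / (1 + t\<^sup>2) \<le> (r * t) ^ 4 / (r ^ 4 + (r * t)\<^sup>2)"
  proof -
    have "(r * t) ^ 4 / (r ^ 4 + (r * t)\<^sup>2) = t ^ 4 / (1 + t\<^sup>2 / r\<^sup>2)"
      using r pos by (simp add: divide_simps power_mult_distrib) (simp add: algebra_simps power_numeral_reduce)
    also have "t ^ 4 / (1 + t\<^sup>2) \<le> \<dots>"
    proof (intro divide_left_mono)
      show "1 + t\<^sup>2 / r\<^sup>2 \<le> 1 + t\<^sup>2" using r2 by (simp add: divide_le_eq mult_le_cancel_left1)
      show "0 < (1 + t\<^sup>2) * (1 + t\<^sup>2 / r\<^sup>2)"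
        by (intro mult_pos_pos) (auto intro!: add_pos_nonneg)
    qed simp
    finally show ?thesis .
  qed
  finally have "t\<^sup>2 - 1 \<le> (r * t) ^ 4 / (r ^ 4 + (r * t)\<^sup>2)" .
  from divide_right_mono[OF this, of 12]
  have *: "(t\<^sup>2 - 1) / 12 \<le> (r * t) ^ 4 / (12 * (r ^ 4 + (r * t)\<^sup>2))"
    by (simp only: divide_divide_eq_left mult.commute zero_le_numeral simp_thms)
  have "(\<Prod>i<n. cosh (a i)) * exp (- (r * t)\<^sup>2 / 2) \<le>
      exp ((r * t)\<^sup>2 / 2 - (r * t) ^ 4 / (12 * (n + (r * t)\<^sup>2))) * exp (- (r * t)\<^sup>2 / 2)"
    by (intro mult_right_mono prod_cosh_le n a) simp
  also have "\<dots> = exp (- ((r * t) ^ 4 / (12 * (r ^ 4 + (r * t)\<^sup>2))))"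
    by (simp add: exp_add[symmetric] r(2))
  also have "\<dots> \<le> exp (1 / 12 - t\<^sup>2 / 12)" using * by (simp add: diff_divide_distrib)
  finally show ?thesis .
qed

text \<open>Sharp two-sided bounds for the pointwise limit. The upper one uses x^4 / (1 + x^2) \<ge>
  x^4 - x^6; its sixth powers are negligible when every a i is of order n^(-1/4), since then they
  sum to order n^(-1/2).\<close>

lemma prod_cosh_gauss_bounds:
  fixes a :: "nat \<Rightarrow> real"
  assumes a: "(\<Sum>i<n. (a i)\<^sup>2) = s\<^sup>2"
  shows "exp (- (\<Sum>i<n. (a i) ^ 4) / 12) \<le> (\<Prod>i<n. cosh (a i)) * exp (- s\<^sup>2 / 2)" (is ?lower)
    and "(\<Prod>i<n. cosh (a i)) * exp (- s\<^sup>2 / 2) \<le> exp (- (\<Sum>i<n. (a i) ^ 4) / 12 + (\<Sum>i<n. (a i) ^ 6) / 12)" (is ?upper)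
proof -
  have "exp (\<Sum>i<n. (a i)\<^sup>2 / 2 - (a i) ^ 4 / 12) \<le> (\<Prod>i<n. cosh (a i))"
    unfolding exp_sum[OF finite_lessThan] by (intro prod_mono) (auto simp: cosh_ge_exp)
  also have "(\<Sum>i<n. (a i)\<^sup>2 / 2 - (a i) ^ 4 / 12) = s\<^sup>2 / 2 - (\<Sum>i<n. (a i) ^ 4) / 12"
    by (simp add: sum_subtractf sum_divide_distrib[symmetric] a)
  finally have "exp (s\<^sup>2 / 2 - (\<Sum>i<n. (a i) ^ 4) / 12) * exp (- s\<^sup>2 / 2) \<le> (\<Prod>i<n. cosh (a i)) * exp (- s\<^sup>2 / 2)"
    by (intro mult_right_mono) simp_all
  then show ?lower by (simp add: exp_add[symmetric])
  have up: "cosh x \<le> exp (x\<^sup>2 / 2 - x ^ 4 / 12 + x ^ 6 / 12)" for x :: real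
  proof -
    have pos: "1 + x\<^sup>2 > 0" by (auto intro: add_pos_nonneg)
    then have "x ^ 4 / (1 + x\<^sup>2) - (x ^ 4 - x ^ 6) = x ^ 8 / (1 + x\<^sup>2)"
      by (simp add: divide_simps) (simp add: algebra_simps power_numeral_reduce)
    with pos have "x ^ 4 - x ^ 6 \<le> x ^ 4 / (1 + x\<^sup>2)"
      by (smt (verit) divide_nonneg_pos zero_le_even_power' even_numeral zero_le_even_power)
    from divide_right_mono[OF this, of 12]
    have "(x ^ 4 - x ^ 6) / 12 \<le> x ^ 4 / (12 * (1 + x\<^sup>2))"
      by (simp only: divide_divide_eq_left mult.commute zero_le_numeral simp_thms)
    then have "x\<^sup>2 / 2 - x ^ 4 / (12 * (1 + x\<^sup>2)) \<le> x\<^sup>2 / 2 - x ^ 4 / 12 + x ^ 6 / 12"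
      by argo
    with cosh_le_exp[of x] show ?thesis by (meson exp_le_cancel_iff order_trans)
  qed
  have "(\<Prod>i<n. cosh (a i)) \<le> exp (\<Sum>i<n. (a i)\<^sup>2 / 2 - (a i) ^ 4 / 12 + (a i) ^ 6 / 12)"
    unfolding exp_sum[OF finite_lessThan] by (intro prod_mono) (auto simp: up)
  also have "(\<Sum>i<n. (a i)\<^sup>2 / 2 - (a i) ^ 4 / 12 + (a i) ^ 6 / 12) = s\<^sup>2 / 2 - (\<Sum>i<n. (a i) ^ 4) / 12 + (\<Sum>i<n. (a i) ^ 6) / 12"
    by (simp add: sum.distrib sum_subtractf sum_divide_distrib[symmetric] a)
  finally have "(\<Prod>i<n. cosh (a i)) * exp (- s\<^sup>2 / 2) \<le>
    exp (s\<^sup>2 / 2 - (\<Sum>i<n. (a i) ^ 4) / 12 + (\<Sum>i<n. (a i) ^ 6) / 12) * exp (- s\<^sup>2 / 2)"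
    by (intro mult_right_mono) simp_all
  then show ?upper by (simp add: exp_add[symmetric])
qed

section \<open>The expansion of g at the origin\<close>

text \<open>L'Hopital's rule: integrating once gains one order of smallness at 0.\<close>

lemma smallo_power_antideriv:
  fixes f f' :: "real \<Rightarrow> real"
  assumes "f 0 = 0" "e > 0" "\<And>x. x \<in> ball 0 e \<Longrightarrow> (f has_real_derivative f' x) (at x)"
    and lim: "((\<lambda>x. f' x / x ^ k) \<longlongrightarrow> 0) (at 0)"
  shows "((\<lambda>x. f x / x ^ Suc k) \<longlongrightarrow> 0) (at 0)"
proof (rule lhopital[where f' = f' and g' = "\<lambda>x. real (Suc k) * x ^ k"])
  have ev: "\<forall>\<^sub>F x in at (0::real). x \<in> ball 0 e"
    using assms(2) by (intro eventually_at_in_open') auto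
  have nz: "\<forall>\<^sub>F x in at (0::real). x \<noteq> 0" by (simp add: eventually_at_filter)
  have "isCont f 0" using assms(2,3) by (intro DERIV_isCont[of f "f' 0"]) auto
  then show "(f \<longlongrightarrow> 0) (at 0)" by (simp add: isCont_def assms(1))
  show "((\<lambda>x::real. x ^ Suc k) \<longlongrightarrow> 0) (at 0)" by (auto intro!: tendsto_eq_intros)
  show "\<forall>\<^sub>F x in at (0::real). x ^ Suc k \<noteq> 0" using nz by eventually_elim simp
  show "\<forall>\<^sub>F x in at (0::real). real (Suc k) * x ^ k \<noteq> 0"
    using nz by eventually_elim (simp del: of_nat_Suc)
  show "\<forall>\<^sub>F x in at 0. (f has_real_derivative f' x) (at x)"
    using ev by eventually_elim (fact assms(3))
  show "\<forall>\<^sub>F x in at 0. ((\<lambda>x. x ^ Suc k) has_real_derivative real (Suc k) * x ^ k) (at x)"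
    by (intro always_eventually allI) (use DERIV_pow[of "Suc k"] in simp)
  have "((\<lambda>x. f' x / x ^ k / real (Suc k)) \<longlongrightarrow> 0 / real (Suc k)) (at 0)"
    by (intro tendsto_intros lim) simp
  then show "((\<lambda>x. f' x / (real (Suc k) * x ^ k)) \<longlongrightarrow> 0) (at 0)"
    by (simp add: mult.commute)
qed

lemma taylor_peano_4:
  fixes g :: "real \<Rightarrow> real"
  assumes e: "e > 0"
    and d: "\<forall>k<3. \<forall>x\<in>ball 0 e. ((deriv ^^ k) g has_real_derivative (deriv ^^ Suc k) g x) (at x)"
    and d3: "(deriv ^^ 3) g differentiable (at 0)"
  defines "c \<equiv> \<lambda>k. (deriv ^^ k) g 0"
  shows "((\<lambda>x. (g x - (c 0 + c 1 * x + c 2 * x\<^sup>2 / 2 + c 3 * x ^ 3 / 6 + c 4 * x ^ 4 / 24)) / x ^ 4) \<longlongrightarrow> 0) (at 0)"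
proof -
  define D where "D = (\<lambda>k. (deriv ^^ k) g)"
  have D: "(D k has_real_derivative D (Suc k) x) (at x)" if "k < 3" "x \<in> ball 0 e" for k x
    using d that unfolding D_def by blast
  have Dc: "D k 0 = c k" for k by (simp add: D_def c_def)
  have "(D 3 has_real_derivative c 4) (at 0)"
    using d3 unfolding D_def c_def
    by (simp add: numeral_eq_Suc real_differentiable_def DERIV_deriv_iff_real_differentiable)
  then have "((\<lambda>x. (D 3 x - c 3) / x) \<longlongrightarrow> c 4) (at 0)"
    by (simp add: has_field_derivative_iff Dc)
  then have "((\<lambda>x. (D 3 x - c 3) / x - c 4) \<longlongrightarrow> 0) (at 0)" by (simp add: LIM_zero)
  then have L3: "((\<lambda>x. (D 3 x - (c 3 + c 4 * x)) / x ^ 1) \<longlongrightarrow> 0) (at 0)"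
    by (rule Lim_transform_eventually) (auto simp: eventually_at_filter field_simps)
  have d2: "((\<lambda>x. D 2 x - (c 2 + c 3 * x + c 4 * x\<^sup>2 / 2)) has_real_derivative D 3 x - (c 3 + c 4 * x)) (at x)"
    if "x \<in> ball 0 e" for x
    using D[of 2 x] that by (auto intro!: derivative_eq_intros simp: numeral_3_eq_3)
  have L2: "((\<lambda>x. (D 2 x - (c 2 + c 3 * x + c 4 * x\<^sup>2 / 2)) / x ^ Suc 1) \<longlongrightarrow> 0) (at 0)"
    by (rule smallo_power_antideriv[OF _ e d2 L3]) (simp_all add: Dc)
  have d1: "((\<lambda>x. D 1 x - (c 1 + c 2 * x + c 3 * x\<^sup>2 / 2 + c 4 * x ^ 3 / 6)) has_real_derivative
      D 2 x - (c 2 + c 3 * x + c 4 * x\<^sup>2 / 2)) (at x)"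
    if "x \<in> ball 0 e" for x
    using D[of 1 x] that by (auto intro!: derivative_eq_intros simp: numeral_2_eq_2)
  have L1: "((\<lambda>x. (D 1 x - (c 1 + c 2 * x + c 3 * x\<^sup>2 / 2 + c 4 * x ^ 3 / 6)) / x ^ Suc (Suc 1)) \<longlongrightarrow> 0) (at 0)"
    by (rule smallo_power_antideriv[OF _ e d1 L2]) (simp_all add: Dc)
  have d0: "((\<lambda>x. D 0 x - (c 0 + c 1 * x + c 2 * x\<^sup>2 / 2 + c 3 * x ^ 3 / 6 + c 4 * x ^ 4 / 24)) has_real_derivative
      D 1 x - (c 1 + c 2 * x + c 3 * x\<^sup>2 / 2 + c 4 * x ^ 3 / 6)) (at x)"
    if "x \<in> ball 0 e" for x
    using D[of 0 x] that by (auto intro!: derivative_eq_intros)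
  have L0: "((\<lambda>x. (D 0 x - (c 0 + c 1 * x + c 2 * x\<^sup>2 / 2 + c 3 * x ^ 3 / 6 + c 4 * x ^ 4 / 24)) / x ^ Suc (Suc (Suc 1))) \<longlongrightarrow> 0) (at 0)"
    by (rule smallo_power_antideriv[OF _ e d0 L1]) (simp_all add: Dc)
  from L0 show ?thesis by (simp add: D_def numeral_eq_Suc)
qed

text \<open>The equivalence g u ~ u^2 / 2 fixes the coefficients up to order two. The cubic one
  vanishes because (g x - x^2 / 2) / x^3 is nonpositive on the right of 0 and nonnegative on the
  left; after that, g x \<le> x^2 / 2 gives the sign of \<open>c 4\<close>.\<close>

lemma quartic_coefficients:
  fixes g :: "real \<Rightarrow> real" and c :: "nat \<Rightarrow> real"
  assumes lim2: "((\<lambda>x. g x / x\<^sup>2) \<longlongrightarrow> 1 / 2) (at 0)" and le: "\<And>x. g x \<le> x\<^sup>2 / 2"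
    and lim4: "((\<lambda>x. (g x - (c 0 + c 1 * x + c 2 * x\<^sup>2 / 2 + c 3 * x ^ 3 / 6 + c 4 * x ^ 4 / 24)) / x ^ 4) \<longlongrightarrow> 0) (at 0)"
  shows "c 4 \<le> 0" "((\<lambda>x. (g x - x\<^sup>2 / 2) / x ^ 4) \<longlongrightarrow> c 4 / 24) (at 0)" "c 0 = 0"
proof -
  define e where "e = (\<lambda>x. (g x - (c 0 + c 1 * x + c 2 * x\<^sup>2 / 2 + c 3 * x ^ 3 / 6 + c 4 * x ^ 4 / 24)) / x ^ 4)"
  have e: "(e \<longlongrightarrow> 0) (at 0)" using lim4 by (simp add: e_def)
  have g: "g x = c 0 + c 1 * x + c 2 * x\<^sup>2 / 2 + c 3 * x ^ 3 / 6 + c 4 * x ^ 4 / 24 + e x * x ^ 4" if "x \<noteq> 0" for x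
    using that by (simp add: e_def)
  have nz: "\<forall>\<^sub>F x in at (0::real). x \<noteq> 0" by (simp add: eventually_at_filter)
  have l0: "((\<lambda>x. g x / x\<^sup>2 * x\<^sup>2) \<longlongrightarrow> 1 / 2 * 0\<^sup>2) (at 0)" by (intro tendsto_intros lim2)
  have "((\<lambda>x. c 0 + c 1 * x + c 2 * x\<^sup>2 / 2 + c 3 * x ^ 3 / 6 + c 4 * x ^ 4 / 24 + e x * x ^ 4)
      \<longlongrightarrow> c 0) (at 0)" by (rule tendsto_eq_intros e refl | simp)+
  then have "((\<lambda>x. g x / x\<^sup>2 * x\<^sup>2) \<longlongrightarrow> c 0) (at 0)"
    by (rule Lim_transform_eventually) (use nz in eventually_elim, simp add: g)
  from LIM_unique[OF this l0] show c0: "c 0 = 0" by simp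
  have l1: "((\<lambda>x. g x / x\<^sup>2 * x) \<longlongrightarrow> 1 / 2 * 0) (at 0)" by (intro tendsto_intros lim2)
  have "((\<lambda>x. c 1 + c 2 * x / 2 + c 3 * x\<^sup>2 / 6 + c 4 * x ^ 3 / 24 + e x * x ^ 3)
      \<longlongrightarrow> c 1) (at 0)" by (rule tendsto_eq_intros e refl | simp)+
  then have "((\<lambda>x. g x / x\<^sup>2 * x) \<longlongrightarrow> c 1) (at 0)"
    by (rule Lim_transform_eventually)
       (use nz in eventually_elim, simp add: g c0, simp add: field_simps power_numeral_reduce)
  from LIM_unique[OF this l1] have c1: "c 1 = 0" by simp
  have "((\<lambda>x. c 2 / 2 + c 3 * x / 6 + c 4 * x\<^sup>2 / 24 + e x * x\<^sup>2)
      \<longlongrightarrow> c 2 / 2) (at 0)" by (rule tendsto_eq_intros e refl | simp)+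
  then have "((\<lambda>x. g x / x\<^sup>2) \<longlongrightarrow> c 2 / 2) (at 0)"
    by (rule Lim_transform_eventually)
       (use nz in eventually_elim, simp add: g c0 c1[simplified], simp add: field_simps power_numeral_reduce)
  from LIM_unique[OF this lim2] have c2: "c 2 = 1" by simp
  have "((\<lambda>x. c 3 / 6 + c 4 * x / 24 + e x * x) \<longlongrightarrow> c 3 / 6) (at 0)"
    by (rule tendsto_eq_intros e refl | simp)+
  then have lim3: "((\<lambda>x. (g x - x\<^sup>2 / 2) / x ^ 3) \<longlongrightarrow> c 3 / 6) (at 0)"
    by (rule Lim_transform_eventually)
       (use nz in eventually_elim, simp add: g c0 c1[simplified] c2, simp add: field_simps power_numeral_reduce)
  have "((\<lambda>x. (g x - x\<^sup>2 / 2) / x ^ 3) \<longlongrightarrow> c 3 / 6) (at_right 0)"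
    using lim3 filterlim_at_split by blast
  moreover have "\<forall>\<^sub>F x in at_right 0. (g x - x\<^sup>2 / 2) / x ^ 3 \<le> 0"
    using le by (auto simp: eventually_at_filter divide_nonpos_nonneg)
  ultimately have "c 3 / 6 \<le> 0" by (intro tendsto_upperbound) auto
  moreover have "((\<lambda>x. (g x - x\<^sup>2 / 2) / x ^ 3) \<longlongrightarrow> c 3 / 6) (at_left 0)"
    using lim3 filterlim_at_split by blast
  moreover have "\<forall>\<^sub>F x in at_left 0. 0 \<le> (g x - x\<^sup>2 / 2) / x ^ 3"
    unfolding eventually_at_filter
    by (intro always_eventually allI impI divide_nonpos_nonpos) (use le in \<open>auto simp: power_le_zero_eq\<close>)
  ultimately have c3: "c 3 = 0" using tendsto_lowerbound[of "\<lambda>x. (g x - x\<^sup>2 / 2) / x ^ 3" "c 3 / 6" "at_left 0" 0] by auto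
  have "((\<lambda>x. c 4 / 24 + e x) \<longlongrightarrow> c 4 / 24) (at 0)"
    by (rule tendsto_eq_intros e refl | simp)+
  then show lim: "((\<lambda>x. (g x - x\<^sup>2 / 2) / x ^ 4) \<longlongrightarrow> c 4 / 24) (at 0)"
    by (rule Lim_transform_eventually)
       (use nz in eventually_elim, simp add: g c0 c1[simplified] c2 c3, simp add: field_simps power_numeral_reduce)
  have "c 4 / 24 \<le> 0"
    by (rule tendsto_upperbound[OF lim]) (use le in \<open>auto simp: divide_nonpos_nonneg\<close>)
  then show "c 4 \<le> 0" by simp
qed

section \<open>The mass of the limit law\<close>

text \<open>From (t^2 - 1)^2 \<ge> 0; it reduces integrability to that of a Gaussian.\<close>

lemma exp_quartic_le: "exp (- b * t ^ 4) \<le> exp b * exp (- 2 * b * (t::real)\<^sup>2)" if "b \<ge> 0"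
proof -
  have "0 \<le> (t\<^sup>2 - 1)\<^sup>2" by simp
  then have "2 * t\<^sup>2 - 1 \<le> t ^ 4" by (simp add: power2_eq_square algebra_simps power_numeral_reduce)
  then have "b * (2 * t\<^sup>2 - 1) \<le> b * t ^ 4" using that by (rule mult_left_mono)
  then show ?thesis by (simp add: exp_add[symmetric] algebra_simps)
qed

lemma integrable_exp_quartic: "integrable lborel (\<lambda>t::real. exp (- b * t ^ 4))" if "b > 0"
proof (rule Bochner_Integration.integrable_bound)
  have "integrable lborel (\<lambda>t. exp b * (sqrt (2 * pi * (1 / (4 * b))) * normal_density 0 (sqrt (1 / (4 * b))) t))"
    using that by (intro integrable_mult_right) auto
  then show "integrable lborel (\<lambda>t. exp b * exp (- 2 * b * t\<^sup>2))"
    using that by (simp add: normal_density_def field_simps)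
  show "AE t in lborel. norm (exp (- b * t ^ 4)) \<le> norm (exp b * exp (- 2 * b * t\<^sup>2))"
    using exp_quartic_le[of b] that by simp
qed simp

text \<open>On the positive half-line the substitution u = s^4 / 12 produces Euler's integral for
  Gamma at 1/4; evenness doubles it.\<close>

lemma integral_exp_quartic:
  "(\<integral>s. exp (- ((s::real) ^ 4) / 12) \<partial>lborel) = Gamma (1 / 4) / (4 / 3) powr (1 / 4)"
proof -
  let ?f = "\<lambda>t::real. t powr (1 / 4 - 1) / exp t"
  let ?h = "\<lambda>s::real. exp (- (s ^ 4) / 12)"
  let ?c = "12 powr (3 / 4) / 3 :: real"
  have int: "integrable lborel ?h" using integrable_exp_quartic[of "1 / 12"] by (simp add: field_simps)
  \<comment> \<open>The Jacobian s^3 / 3 cancels the power (s^4 / 12)^(-3/4) up to the constant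
    12^(3/4) / 3.\<close>
  have eq: "?f (s ^ 4 / 12) * (s ^ 3 / 3) = ?c * ?h s" if "s > 0" for s
  proof -
    have "(s ^ 4 / 12) powr (1 / 4 - 1) = (s powr 4 / 12) powr (- (3 / 4))"
      using that by (simp add: powr_numeral)
    also have "\<dots> = (s powr 4) powr (- (3 / 4)) / 12 powr (- (3 / 4))"
      by (rule powr_divide)
    also have "\<dots> = s powr (- 3) * 12 powr (3 / 4)" by (simp add: powr_powr powr_minus_divide)
    also have "s powr (- 3) = 1 / s ^ 3" using that by (simp add: powr_minus_divide powr_numeral)
    finally show ?thesis using that by (simp add: exp_minus field_simps)
  qed
  have ein: "einterval 0 \<infinity> = {0<..}" by (auto simp: einterval_def)
  have int1: "set_integrable lborel {0<..} ?h"
    unfolding set_integrable_def by (intro integrable_mult_indicator int) auto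
  have int2: "set_integrable lborel (einterval 0 \<infinity>) (\<lambda>x. ?f (x ^ 4 / 12) * (x ^ 3 / 3))"
  proof -
    have "set_integrable lborel {0<..} (\<lambda>x. ?c * ?h x)" using int1 by simp
    then show ?thesis unfolding ein by (subst set_integrable_cong[OF refl refl eq]) auto
  qed
  have deriv: "((\<lambda>x. x ^ 4 / 12) has_real_derivative x ^ 3 / 3) (at x)" for x :: real
    by (auto intro!: derivative_eq_intros)
  have cont: "isCont ?f (x ^ 4 / 12)" if "0 < ereal x" for x
    using that by (intro continuous_intros) auto
  have lim0: "((ereal \<circ> (\<lambda>x. x ^ 4 / 12) \<circ> real_of_ereal) \<longlongrightarrow> 0) (at_right 0)"
  proof -
    have "((\<lambda>x::real. ereal (x ^ 4 / 12)) \<longlongrightarrow> ereal (0 ^ 4 / 12)) (at_right 0)"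
      by (intro tendsto_intros) simp
    then show ?thesis
      by (simp add: comp_def zero_ereal_def at_right_ereal filterlim_filtermap)
  qed
  have lim_inf: "((ereal \<circ> (\<lambda>x. x ^ 4 / 12) \<circ> real_of_ereal) \<longlongrightarrow> \<infinity>) (at_left \<infinity>)"
  proof -
    have "filterlim (\<lambda>x::real. x ^ 4 / 12) at_top at_top" by real_asymp
    then show ?thesis
      by (simp add: comp_def at_left_PInf filterlim_filtermap tendsto_PInfty_eq_at_top)
  qed
  note subst_nonneg = interval_integral_substitution_nonneg[where a = 0 and b = \<infinity> and f = ?f
      and g = "\<lambda>x. x ^ 4 / 12" and g' = "\<lambda>x. x ^ 3 / 3", OF _ deriv cont _ _ _ lim0 lim_inf int2]
  have fint: "set_integrable lborel (einterval 0 \<infinity>) ?f"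
    by (rule subst_nonneg(1)) (auto intro!: continuous_intros)
  have changed: "(LBINT x=0..\<infinity>. ?f x) = (LBINT x=0..\<infinity>. ?f (x ^ 4 / 12) * (x ^ 3 / 3))"
    by (rule subst_nonneg(2)) (auto intro!: continuous_intros)
  have "(LBINT x=0..\<infinity>. ?f x) = Gamma (1 / 4)"
  proof -
    have "(LBINT x=0..\<infinity>. ?f x) = (LBINT x:{0<..}. ?f x)"
      by (simp add: interval_lebesgue_integral_def ein)
    also have "\<dots> = integral {0<..} ?f"
      using fint unfolding ein by (rule set_borel_integral_eq_integral)
    also have "\<dots> = integral {0..} ?f"
      by (rule integral_spike_set) (auto intro: negligible_subset[of "{0}"])
    also have "\<dots> = Gamma (1 / 4)" by (rule integral_unique, rule Gamma_integral_real) simp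
    finally show ?thesis .
  qed
  also have "(LBINT x=0..\<infinity>. ?f x) = ?c * (LBINT x:{0<..}. ?h x)"
    unfolding changed
    by (simp add: interval_lebesgue_integral_def ein)
       (subst set_lebesgue_integral_cong[of _ _ _ "\<lambda>s. ?c * ?h s"], use eq in auto)
  finally have half: "Gamma (1 / 4) = ?c * (LBINT x:{0<..}. ?h x)" by simp
  have "has_bochner_integral lborel (\<lambda>x. indicator {0<..} x *\<^sub>R ?h x) (LBINT x:{0<..}. ?h x)"
    using int1 unfolding set_integrable_def set_lebesgue_integral_def by (rule has_bochner_integral_integrable)
  \<comment> \<open>The rule for even functions is stated for the closed half-line; the two
    half-lines differ by a null set.\<close>
  moreover have "AE x in lborel. indicator {0<..} x *\<^sub>R ?h x = indicator {0..} x *\<^sub>R ?h x"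
    using AE_lborel_singleton[of 0] by eventually_elim (auto simp: indicator_def)
  ultimately have "has_bochner_integral lborel (\<lambda>x. indicator {0..} x *\<^sub>R ?h x) (LBINT x:{0<..}. ?h x)"
    by (subst (asm) has_bochner_integral_cong_AE) auto
  then have "has_bochner_integral lborel ?h (2 *\<^sub>R (LBINT x:{0<..}. ?h x))"
    by (rule has_bochner_integral_even_function) simp
  then have "(\<integral>s. ?h s \<partial>lborel) = 2 * (LBINT x:{0<..}. ?h x)"
    using has_bochner_integral_integral_eq by fastforce
  also have "\<dots> = 6 / 12 powr (3 / 4) * Gamma (1 / 4)" by (simp add: half)
  \<comment> \<open>Both sides are compared after multiplication by 12^(1/4), using (4/3 * 12)^(1/4)
    = 16^(1/4) = 2.\<close>
  also have "6 / 12 powr (3 / 4) = 1 / (4 / 3 :: real) powr (1 / 4)"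
  proof -
    have "(12 :: real) powr (3 / 4) * 12 powr (1 / 4) = 12" by (simp add: powr_add[symmetric])
    moreover have "(4 / 3 :: real) powr (1 / 4) * 12 powr (1 / 4) = (2 powr 4) powr (1 / 4)"
      by (subst powr_mult[symmetric]) auto
    then have "(4 / 3 :: real) powr (1 / 4) * 12 powr (1 / 4) = 2" by (simp only: powr_powr) simp
    ultimately have "6 * (4 / 3 :: real) powr (1 / 4) * 12 powr (1 / 4) = 12 powr (3 / 4) * 12 powr (1 / 4)"
      by (simp add: mult.commute)
    then show ?thesis by (simp add: field_simps)
  qed
  finally show ?thesis by simp
qed

section \<open>Tilting and symmetrization\<close>

text \<open>Only single flips are required, since signs are averaged one coordinate at a time. The
  condition ranges over all functions x, not only over the extensional ones in the product space, so
  invariant indicators must be written without reference to that space.\<close>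

definition sign_invariant :: "nat \<Rightarrow> ((nat \<Rightarrow> real) \<Rightarrow> 'b) \<Rightarrow> bool" where
  "sign_invariant n H \<longleftrightarrow> (\<forall>x. \<forall>k<n. H (x(k := - x k)) = H x)"

lemma sign_invariantD: "sign_invariant n H \<Longrightarrow> k < n \<Longrightarrow> H (x(k := - x k)) = H x"
  by (simp add: sign_invariant_def)

lemma sign_invariant_const: "sign_invariant n (\<lambda>_. c)"
  by (simp add: sign_invariant_def)

lemma sign_invariant_Tsum: "sign_invariant n (Tsum n)"
  unfolding sign_invariant_def Tsum_def by (auto intro!: sum.cong)

lemma borel_measurable_cosh[measurable]: "(cosh :: real \<Rightarrow> real) \<in> borel_measurable borel"
  by (intro borel_measurable_continuous_onI continuous_intros)

text \<open>The self-normalized sum, Y in the overview. The argument of \<open>g\<close> in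
  \<open>cw_weight\<close> is Y / sqrt n.\<close>

definition studentized :: "nat \<Rightarrow> (nat \<Rightarrow> real) \<Rightarrow> real" where
  "studentized n x = Ssum n x / sqrt (Tsum n x)"

definition tilt :: "nat \<Rightarrow> (nat \<Rightarrow> real) \<Rightarrow> real" where
  "tilt n x = (if Tsum n x > 0 then exp ((studentized n x)\<^sup>2 / 2) else 0)"

text \<open>
  The first function below is the tilt times the normal density at z with mean Y;
  the second one is its average over the signs of the coordinates.
\<close>

definition smoothed_tilt :: "nat \<Rightarrow> (nat \<Rightarrow> real) \<Rightarrow> real \<Rightarrow> real" where
  "smoothed_tilt n x z = (if Tsum n x > 0 then exp (z * studentized n x - z\<^sup>2 / 2) / sqrt (2 * pi) else 0)"

definition symmetrized_tilt :: "nat \<Rightarrow> (nat \<Rightarrow> real) \<Rightarrow> real \<Rightarrow> real" where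
  "symmetrized_tilt n x z = (if Tsum n x > 0
     then (\<Prod>i<n. cosh (z / sqrt (Tsum n x) * x i)) * exp (- z\<^sup>2 / 2) / sqrt (2 * pi) else 0)"

text \<open>Completing the square: z Y - z^2 / 2 = Y^2 / 2 - (z - Y)^2 / 2. In the variable t = z /
  r the normal law has mean Y / r and deviation 1 / r; the factor 1 / r is the missing
  Jacobian.\<close>

lemma smoothed_tilt_normal:
  assumes "r > 0"
  shows "smoothed_tilt n x (r * t) = tilt n x / r * normal_density (studentized n x / r) (1 / r) t"
proof -
  have "(t - studentized n x / r)\<^sup>2 / (2 * (1 / r)\<^sup>2) = (r * t)\<^sup>2 / 2 - r * t * studentized n x + (studentized n x)\<^sup>2 / 2"
    using assms by (simp add: power2_eq_square field_simps)
  moreover have "sqrt (2 * pi * (1 / r)\<^sup>2) = sqrt (2 * pi) / r"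
    using assms by (simp add: real_sqrt_mult power_divide real_sqrt_divide)
  ultimately show ?thesis
    using assms by (simp add: smoothed_tilt_def tilt_def normal_density_def exp_add[symmetric] algebra_simps)
qed

text \<open>The envelope from \<open>prod_cosh_gauss_le\<close>, divided by sqrt (2 * pi) and
  written as a multiple of a normal density so that its moments can be read off; the variance 6
  comes from t^2 / 12 = t^2 / (2 * 6).\<close>

definition gauss_bound :: "real \<Rightarrow> real" where
  "gauss_bound t = exp (1 / 12) * sqrt 6 * normal_density 0 (sqrt 6) t"

lemma gauss_bound_eq: "gauss_bound t = exp (1 / 12 - t\<^sup>2 / 12) / sqrt (2 * pi)"
proof -
  have eq: "sqrt (2 * pi * (sqrt 6)\<^sup>2) = sqrt 6 * sqrt (2 * pi)"
    by (simp only: real_sqrt_mult[symmetric]) simp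
  have "exp (1 / 12 - t\<^sup>2 / 12) = exp (1 / 12) * exp (- (t - 0)\<^sup>2 / (2 * (sqrt 6)\<^sup>2))"
    unfolding exp_add[symmetric] by simp
  then show ?thesis unfolding gauss_bound_def normal_density_def eq by simp
qed

lemma gauss_bound_nonneg: "gauss_bound t \<ge> 0" by (simp add: gauss_bound_def)

lemma borel_measurable_gauss_bound[measurable]: "gauss_bound \<in> borel_measurable borel"
  unfolding gauss_bound_def[abs_def] by measurable

definition gauss_mass :: real where "gauss_mass = exp (1 / 12) * sqrt 6"

lemma gauss_mass_pos: "gauss_mass > 0" by (simp add: gauss_mass_def)

lemma nn_integral_normal_density: "\<sigma> > 0 \<Longrightarrow> (\<integral>\<^sup>+ t. ennreal (normal_density \<mu> \<sigma> t) \<partial>lborel) = 1"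
  by (subst nn_integral_eq_integral) auto

lemma nn_integral_normal_density_variance:
  assumes "\<sigma> > 0"
  shows "(\<integral>\<^sup>+ t. ennreal ((t - \<mu>)\<^sup>2) * ennreal (normal_density \<mu> \<sigma> t) \<partial>lborel) = ennreal (\<sigma>\<^sup>2)"
proof -
  have "(\<integral>\<^sup>+ t. ennreal ((t - \<mu>)\<^sup>2) * ennreal (normal_density \<mu> \<sigma> t) \<partial>lborel)
    = (\<integral>\<^sup>+ t. ennreal (normal_density \<mu> \<sigma> t * (t - \<mu>) ^ (2 * 1)) \<partial>lborel)"
    by (intro nn_integral_cong) (simp add: ennreal_mult[symmetric] mult.commute)
  also have "\<dots> = ennreal (\<integral>t. normal_density \<mu> \<sigma> t * (t - \<mu>) ^ (2 * 1) \<partial>lborel)"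
    by (intro nn_integral_eq_integral integrable_normal_moment assms) auto
  also have "\<dots> = ennreal (\<sigma>\<^sup>2)"
    using integral_normal_moment_even[OF assms, of \<mu> 1] assms by simp
  finally show ?thesis .
qed

lemma nn_integral_gauss_bound: "(\<integral>\<^sup>+ t. ennreal (gauss_bound t) \<partial>lborel) = ennreal gauss_mass"
  unfolding gauss_bound_def gauss_mass_def
  by (simp add: ennreal_mult nn_integral_cmult nn_integral_normal_density)

lemma nn_integral_gauss_bound_square:
  "(\<integral>\<^sup>+ t. ennreal (t\<^sup>2) * ennreal (gauss_bound t) \<partial>lborel) = ennreal (6 * gauss_mass)"
proof -
  have "(\<integral>\<^sup>+ t. ennreal (t\<^sup>2) * ennreal (gauss_bound t) \<partial>lborel)
    = ennreal gauss_mass * (\<integral>\<^sup>+ t. ennreal ((t - 0)\<^sup>2) * ennreal (normal_density 0 (sqrt 6) t) \<partial>lborel)"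
    unfolding gauss_bound_def gauss_mass_def
    by (subst nn_integral_cmult[symmetric], measurable)
       (intro nn_integral_cong, simp add: ennreal_mult ac_simps)
  also have "\<dots> = ennreal (6 * gauss_mass)"
    using gauss_mass_pos
    by (subst nn_integral_normal_density_variance) (auto simp: ennreal_mult'' mult.commute)
  finally show ?thesis .
qed

lemma symmetrized_tilt_nonneg: "symmetrized_tilt n x z \<ge> 0"
  by (auto simp: symmetrized_tilt_def intro!: divide_nonneg_nonneg mult_nonneg_nonneg prod_nonneg)

lemma sum_scaled_squares:
  assumes "Tsum n x > 0"
  shows "(\<Sum>i<n. (z / sqrt (Tsum n x) * x i)\<^sup>2) = z\<^sup>2"
proof -
  have "(\<Sum>i<n. (z / sqrt (Tsum n x) * x i)\<^sup>2) = z\<^sup>2 / Tsum n x * Tsum n x"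
    using assms unfolding Tsum_def
    by (simp add: power_mult_distrib power_divide sum_distrib_left)
  with assms show ?thesis by simp
qed

lemma symmetrized_tilt_le:
  assumes "r \<ge> 1" "r ^ 4 = real n"
  shows "symmetrized_tilt n x (r * t) \<le> gauss_bound t"
proof (cases "Tsum n x > 0")
  case True
  from prod_cosh_gauss_le[OF assms sum_scaled_squares[OF True, of "r * t"]] True
  show ?thesis by (simp add: symmetrized_tilt_def gauss_bound_eq divide_right_mono)
qed (simp add: symmetrized_tilt_def gauss_bound_nonneg)

definition root4 :: "nat \<Rightarrow> real" where "root4 n = real n powr (1 / 4)"

lemma root4_pow4: "root4 n ^ 4 = real n"
proof (cases "n = 0")
  case False
  then have "root4 n ^ 4 = (real n powr (1 / 4)) powr 4"
    by (simp add: root4_def powr_numeral)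
  also have "\<dots> = real n" using False by (simp add: powr_powr)
  finally show ?thesis .
qed (simp add: root4_def)

lemma root4_ge_1: "n > 0 \<Longrightarrow> root4 n \<ge> 1"
  by (simp add: root4_def ge_one_powr_ge_zero)

lemma root4_pos: "n > 0 \<Longrightarrow> root4 n > 0"
  using root4_ge_1[of n] by linarith

section \<open>Symmetric product laws and averaging over signs\<close>

locale symmetric_law = prob_space \<rho> for \<rho> :: "real measure" +
  assumes sets_law[measurable_cong, simp]: "sets \<rho> = sets borel"
    and symmetric: "distr \<rho> borel uminus = \<rho>"
begin

lemma space_law[simp]: "space \<rho> = UNIV"
  using sets_eq_imp_space_eq[OF sets_law] by simp

sublocale prod: product_prob_space "\<lambda>_::nat. \<rho>" UNIV
  by unfold_locales

abbreviation P :: "nat \<Rightarrow> (nat \<Rightarrow> real) measure" where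
  "P n \<equiv> PiM {..<n} (\<lambda>_. \<rho>)"

lemma prob_space_P: "prob_space (P n)"
  by (intro prob_space_PiM prob_space_axioms)

lemma emeasure_P_space: "emeasure (P n) (space (P n)) = 1"
  by (rule prob_space.emeasure_space_1[OF prob_space_P])

lemma measurable_coord[measurable (raw)]: "i < n \<Longrightarrow> (\<lambda>x. x i) \<in> borel_measurable (P n)"
  using measurable_component_singleton[of i "{..<n}" "\<lambda>_. \<rho>"]
  by (simp add: measurable_cong_sets[OF refl sets_law])

lemma measurable_Ssum[measurable]: "Ssum n \<in> borel_measurable (P n)"
  unfolding Ssum_def[abs_def] by measurable

lemma measurable_Tsum[measurable]: "Tsum n \<in> borel_measurable (P n)"
  unfolding Tsum_def[abs_def] by measurable

lemma measurable_studentized[measurable]: "studentized n \<in> borel_measurable (P n)"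
  unfolding studentized_def[abs_def] by measurable

lemma measurable_tilt[measurable]: "tilt n \<in> borel_measurable (P n)"
  unfolding tilt_def[abs_def] by measurable

lemma measurable_smoothed_tilt[measurable]:
  "(\<lambda>p. smoothed_tilt n (fst p) (r * snd p)) \<in> borel_measurable (P n \<Otimes>\<^sub>M lborel)"
  unfolding smoothed_tilt_def by measurable

lemma measurable_symmetrized_tilt[measurable]:
  "(\<lambda>p. symmetrized_tilt n (fst p) (r * snd p)) \<in> borel_measurable (P n \<Otimes>\<^sub>M lborel)"
  unfolding symmetrized_tilt_def by measurable

lemma measurable_smoothed_tilt1[measurable]: "(\<lambda>x. smoothed_tilt n x z) \<in> borel_measurable (P n)"
  unfolding smoothed_tilt_def by measurable

lemma measurable_symmetrized_tilt1[measurable]: "(\<lambda>x. symmetrized_tilt n x z) \<in> borel_measurable (P n)"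
  unfolding symmetrized_tilt_def by measurable

lemma measurable_flip[measurable]:
  assumes "k < n" shows "(\<lambda>x. x(k := - x k)) \<in> P n \<rightarrow>\<^sub>M P n"
  using assms by (intro measurable_fun_upd[where J = "{..<n}"])
    (auto simp: measurable_cong_sets[OF refl sets_law])

lemma nn_integral_law_uminus:
  assumes [measurable]: "f \<in> borel_measurable borel"
  shows "(\<integral>\<^sup>+ y. f (- y) \<partial>\<rho>) = (\<integral>\<^sup>+ y. f y \<partial>\<rho>)"
proof -
  have "(\<integral>\<^sup>+ y. f y \<partial>distr \<rho> borel uminus) = (\<integral>\<^sup>+ y. f (- y) \<partial>\<rho>)"
    by (rule nn_integral_distr) auto
  then show ?thesis by (simp add: symmetric)
qed

text \<open>Integrating coordinate k innermost reduces this to the symmetry of one factor.\<close>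

lemma nn_integral_flip:
  assumes k: "k < n" and f[measurable]: "f \<in> borel_measurable (P n)"
  shows "(\<integral>\<^sup>+ x. f (x(k := - x k)) \<partial>P n) = (\<integral>\<^sup>+ x. f x \<partial>P n)"
proof -
  define I where "I = {..<n} - {k}"
  have n: "{..<n} = insert k I" "k \<notin> I" "finite I" using k by (auto simp: I_def)
  have [measurable]: "f \<in> borel_measurable (PiM (insert k I) (\<lambda>_. \<rho>))" using f n by simp
  have [measurable]: "(\<lambda>x. f (x(k := - x k))) \<in> borel_measurable (PiM (insert k I) (\<lambda>_. \<rho>))"
    using measurable_compose[OF measurable_flip[OF k] f] n by simp
  have "(\<integral>\<^sup>+ x. f (x(k := - x k)) \<partial>P n) = (\<integral>\<^sup>+ x. (\<integral>\<^sup>+ y. f (x(k := - y)) \<partial>\<rho>) \<partial>PiM I (\<lambda>_. \<rho>))"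
    unfolding n(1) by (subst prod.product_nn_integral_insert) (use n in auto)
  also have "\<dots> = (\<integral>\<^sup>+ x. (\<integral>\<^sup>+ y. f (x(k := y)) \<partial>\<rho>) \<partial>PiM I (\<lambda>_. \<rho>))"
  proof (rule nn_integral_cong)
    fix x assume x: "x \<in> space (PiM I (\<lambda>_. \<rho>))"
    have "(\<lambda>y. f (x(k := y))) \<in> borel_measurable \<rho>"
      using measurable_comp[OF measurable_component_update[OF x n(2)], of f borel] by (simp add: comp_def)
    then show "(\<integral>\<^sup>+ y. f (x(k := - y)) \<partial>\<rho>) = (\<integral>\<^sup>+ y. f (x(k := y)) \<partial>\<rho>)"
      using nn_integral_law_uminus[of "\<lambda>y. f (x(k := y))"] by simp
  qed
  also have "\<dots> = (\<integral>\<^sup>+ x. f x \<partial>P n)"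
    unfolding n(1) by (subst prod.product_nn_integral_insert) (use n in auto)
  finally show ?thesis .
qed

text \<open>The factors are exchanged one by one. Flipping coordinate k preserves the integral and
  leaves \<open>H\<close>, \<open>c\<close> and all other factors unchanged, so exp (c x_k) may be
  replaced by its average with exp (- c x_k), which is cosh (c x_k). Flips replace conditioning on
  the moduli.\<close>

lemma nn_integral_prod_exp_eq_cosh:
  assumes H[measurable]: "H \<in> borel_measurable (P n)" and c[measurable]: "c \<in> borel_measurable (P n)"
    and inv: "sign_invariant n H" "sign_invariant n c"
  shows "(\<integral>\<^sup>+ x. H x * ennreal (\<Prod>i<n. exp (c x * x i)) \<partial>P n)
       = (\<integral>\<^sup>+ x. H x * ennreal (\<Prod>i<n. cosh (c x * x i)) \<partial>P n)"
proof -
  \<comment> \<open>Interpolates between the two integrands: in \<open>G k\<close> the first k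
    factors have been averaged already.\<close>
  define G where "G = (\<lambda>k x. H x * ennreal (\<Prod>i<n. if i < k then cosh (c x * x i) else exp (c x * x i)))"
  have meas[measurable]: "G k \<in> borel_measurable (P n)" for k
    unfolding G_def by measurable auto
  have "(\<integral>\<^sup>+ x. G 0 x \<partial>P n) = (\<integral>\<^sup>+ x. G k x \<partial>P n)" if "k \<le> n" for k
    using that
  proof (induction k)
    case (Suc k)
    then have k: "k < n" by simp
    have G: "G k x + G k (x(k := - x k)) = 2 * G (Suc k) x" for x
    proof -
      define R where "R = (\<Prod>i\<in>{..<n} - {k}. if i < k then cosh (c x * x i) else exp (c x * x i))"
      have R: "R \<ge> 0" unfolding R_def by (intro prod_nonneg) auto
      have "G k x = H x * ennreal (exp (c x * x k) * R)"
        unfolding G_def R_def using k by (subst prod.remove[of _ k]) auto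
      moreover have "G k (x(k := - x k)) = H x * ennreal (exp (- (c x * x k)) * R)"
      proof -
        have "(\<Prod>i\<in>{..<n} - {k}. if i < k then cosh (c x * (x(k := - x k)) i) else exp (c x * (x(k := - x k)) i)) = R"
          unfolding R_def by (rule prod.cong) auto
        then show ?thesis
          unfolding G_def sign_invariantD[OF inv(1) k] sign_invariantD[OF inv(2) k]
          using k by (subst prod.remove[of _ k]) auto
      qed
      moreover have "G (Suc k) x = H x * ennreal (cosh (c x * x k) * R)"
      proof -
        have "(\<Prod>i\<in>{..<n} - {k}. if i < Suc k then cosh (c x * x i) else exp (c x * x i)) = R"
          unfolding R_def by (rule prod.cong) auto
        then show ?thesis
          unfolding G_def using k by (subst prod.remove[of _ k]) auto
      qed
      moreover have "ennreal (exp (c x * x k) * R) + ennreal (exp (- (c x * x k)) * R)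
          = 2 * ennreal (cosh (c x * x k) * R)"
      proof -
        have "exp (c x * x k) * R + exp (- (c x * x k)) * R = 2 * (cosh (c x * x k) * R)"
          by (simp add: cosh_field_def algebra_simps)
        then show ?thesis
          using R by (simp add: ennreal_plus[symmetric] ennreal_mult'[symmetric] del: ennreal_plus flip: ennreal_numeral)
      qed
      ultimately show ?thesis by (simp add: distrib_left[symmetric] mult.left_commute)
    qed
    have "2 * (\<integral>\<^sup>+ x. G k x \<partial>P n) = (\<integral>\<^sup>+ x. G k x \<partial>P n) + (\<integral>\<^sup>+ x. G k (x(k := - x k)) \<partial>P n)"
      using nn_integral_flip[OF k meas] by (simp add: mult_2)
    also have "\<dots> = (\<integral>\<^sup>+ x. G k x + G k (x(k := - x k)) \<partial>P n)"
      using measurable_compose[OF measurable_flip[OF k] meas] by (intro nn_integral_add[symmetric]) auto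
    also have "\<dots> = 2 * (\<integral>\<^sup>+ x. G (Suc k) x \<partial>P n)"
      by (simp add: G nn_integral_cmult)
    \<comment> \<open>The integrals may be infinite; cancelling is sound because the factor 2 is
      finite and nonzero.\<close>
    finally have "(\<integral>\<^sup>+ x. G k x \<partial>P n) = (\<integral>\<^sup>+ x. G (Suc k) x \<partial>P n)"
      by (simp add: ennreal_mult_cancel_left)
    with Suc k show ?case by simp
  qed simp
  from this[OF order_refl] show ?thesis by (simp add: G_def)
qed

text \<open>In the exponent, z Y is linear in x once T is fixed, with slope z / sqrt T. T is
  unchanged by flips, so this slope can serve as the invariant coefficient \<open>c\<close>.\<close>

lemma nn_integral_smoothed_tilt:
  assumes [measurable]: "H \<in> borel_measurable (P n)" and inv: "sign_invariant n H"
  shows "(\<integral>\<^sup>+ x. H x * ennreal (smoothed_tilt n x z) \<partial>P n) = (\<integral>\<^sup>+ x. H x * ennreal (symmetrized_tilt n x z) \<partial>P n)"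
proof -
  define K where "K = (\<lambda>x. H x * ennreal (if Tsum n x > 0 then exp (- z\<^sup>2 / 2) / sqrt (2 * pi) else 0))"
  define c where "c = (\<lambda>x. z / sqrt (Tsum n x))"
  have [measurable]: "K \<in> borel_measurable (P n)" "c \<in> borel_measurable (P n)"
    unfolding K_def c_def by measurable
  have inv': "sign_invariant n K" "sign_invariant n c"
    using inv sign_invariant_Tsum[of n] by (auto simp: sign_invariant_def K_def c_def)
  have "H x * ennreal (smoothed_tilt n x z) = K x * ennreal (\<Prod>i<n. exp (c x * x i))" for x
  proof -
    have "(\<Prod>i<n. exp (c x * x i)) = exp (z * studentized n x)"
      by (simp add: exp_sum[symmetric] c_def studentized_def Ssum_def sum_distrib_left sum_divide_distrib)
    moreover have "exp (z * studentized n x - z\<^sup>2 / 2) = exp (- z\<^sup>2 / 2) * exp (z * studentized n x)"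
      unfolding exp_add[symmetric] by simp
    ultimately show ?thesis
      by (simp add: K_def smoothed_tilt_def mult.assoc ennreal_mult'[symmetric])
  qed
  moreover have "H x * ennreal (symmetrized_tilt n x z) = K x * ennreal (\<Prod>i<n. cosh (c x * x i))" for x
  proof -
    have "(\<Prod>i<n. cosh (c x * x i)) * exp (- z\<^sup>2 / 2) / sqrt (2 * pi) = exp (- z\<^sup>2 / 2) / sqrt (2 * pi) * (\<Prod>i<n. cosh (c x * x i))"
      by simp
    then show ?thesis
      unfolding K_def symmetrized_tilt_def c_def
      by (simp add: mult.assoc ennreal_mult'[symmetric] mult.commute[of "\<Prod>i<n. cosh (z * x i / sqrt (Tsum n x))"])
  qed
  ultimately show ?thesis
    using nn_integral_prod_exp_eq_cosh[OF _ _ inv'] by simp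
qed

section \<open>The joint law of the coordinates and the smoothing variable\<close>

lemma pair_sigma_finite_P: "pair_sigma_finite (P n) lborel"
  by (simp add: pair_sigma_finite_def prob_space_imp_sigma_finite prob_space_P lborel.sigma_finite_measure_axioms)

text \<open>
  The joint law of x and t = z / n^(1/4), up to normalization: x is tilted by exp (Y^2 / 2), and z
  is normal with mean Y given x. The Jacobian n^(1/4) is left out, so that the mass stays bounded.
\<close>

definition Q :: "nat \<Rightarrow> ((nat \<Rightarrow> real) \<times> real) measure" where
  "Q n = density (P n \<Otimes>\<^sub>M lborel) (\<lambda>p. ennreal (smoothed_tilt n (fst p) (root4 n * snd p)))"

lemma sets_Q[measurable_cong, simp]: "sets (Q n) = sets (P n \<Otimes>\<^sub>M borel)"
  by (simp add: Q_def cong: sets_pair_measure_cong)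

lemma nn_integral_Q:
  assumes [measurable]: "f \<in> borel_measurable (P n \<Otimes>\<^sub>M borel)"
  shows "(\<integral>\<^sup>+ p. f p \<partial>Q n)
    = (\<integral>\<^sup>+ p. ennreal (smoothed_tilt n (fst p) (root4 n * snd p)) * f p \<partial>(P n \<Otimes>\<^sub>M lborel))"
  unfolding Q_def by (rule nn_integral_density) auto

text \<open>Integration over t first: given x, t is normal. This order gives access to functions of
  x that are not sign invariant, and to the distance between t and Y / n^(1/4).\<close>

lemma nn_integral_Q_fst:
  assumes n: "n > 0" and f[measurable]: "f \<in> borel_measurable (P n \<Otimes>\<^sub>M borel)"
  shows "(\<integral>\<^sup>+ p. f p \<partial>Q n) = (\<integral>\<^sup>+ x. ennreal (tilt n x / root4 n) *
     (\<integral>\<^sup>+ t. f (x, t) * ennreal (normal_density (studentized n x / root4 n) (1 / root4 n) t) \<partial>lborel) \<partial>P n)"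
proof -
  have "(\<integral>\<^sup>+ p. f p \<partial>Q n) = (\<integral>\<^sup>+ x. (\<integral>\<^sup>+ t. ennreal (smoothed_tilt n x (root4 n * t)) * f (x, t) \<partial>lborel) \<partial>P n)"
    by (subst nn_integral_Q[OF f], subst lborel.nn_integral_fst[symmetric]) auto
  also have "\<dots> = (\<integral>\<^sup>+ x. ennreal (tilt n x / root4 n) *
     (\<integral>\<^sup>+ t. f (x, t) * ennreal (normal_density (studentized n x / root4 n) (1 / root4 n) t) \<partial>lborel) \<partial>P n)"
  proof (intro nn_integral_cong)
    fix x assume [simp, measurable]: "x \<in> space (P n)"
    have [measurable]: "(\<lambda>t. f (x, t)) \<in> borel_measurable borel"
      by (rule measurable_Pair2[OF f]) fact
    show "(\<integral>\<^sup>+ t. ennreal (smoothed_tilt n x (root4 n * t)) * f (x, t) \<partial>lborel) = ennreal (tilt n x / root4 n) *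
     (\<integral>\<^sup>+ t. f (x, t) * ennreal (normal_density (studentized n x / root4 n) (1 / root4 n) t) \<partial>lborel)"
      unfolding smoothed_tilt_normal[OF root4_pos[OF n]]
      by (subst nn_integral_cmult[symmetric], measurable)
         (intro nn_integral_cong, simp only: ennreal_mult''[OF normal_density_nonneg] ac_simps)
  qed
  finally show ?thesis .
qed

lemma nn_integral_Q_coord:
  assumes n: "n > 0" and [measurable]: "H \<in> borel_measurable (P n)"
  shows "(\<integral>\<^sup>+ p. H (fst p) \<partial>Q n) = (\<integral>\<^sup>+ x. H x * ennreal (tilt n x / root4 n) \<partial>P n)"
  using root4_pos[OF n]
  by (subst nn_integral_Q_fst[OF n])
     (auto simp: nn_integral_cmult nn_integral_normal_density ac_simps)

text \<open>Integration over x first: for fixed t the signs can be averaged out. This order gives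
  access to functions of t and of the moduli.\<close>

lemma nn_integral_Q_prod:
  assumes [measurable]: "H \<in> borel_measurable (P n)" "F \<in> borel_measurable borel" and inv: "sign_invariant n H"
  shows "(\<integral>\<^sup>+ p. F (snd p) * H (fst p) \<partial>Q n)
    = (\<integral>\<^sup>+ t. F t * (\<integral>\<^sup>+ x. H x * ennreal (symmetrized_tilt n x (root4 n * t)) \<partial>P n) \<partial>lborel)"
proof -
  interpret pair_sigma_finite "P n" lborel by (rule pair_sigma_finite_P)
  have "(\<integral>\<^sup>+ p. F (snd p) * H (fst p) \<partial>Q n)
    = (\<integral>\<^sup>+ t. (\<integral>\<^sup>+ x. ennreal (smoothed_tilt n x (root4 n * t)) * (F t * H x) \<partial>P n) \<partial>lborel)"
    by (subst nn_integral_Q, measurable, subst nn_integral_snd[symmetric]) auto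
  also have "\<dots> = (\<integral>\<^sup>+ t. F t * (\<integral>\<^sup>+ x. H x * ennreal (smoothed_tilt n x (root4 n * t)) \<partial>P n) \<partial>lborel)"
    by (intro nn_integral_cong, subst nn_integral_cmult[symmetric], measurable) (simp add: ac_simps)
  also have "\<dots> = (\<integral>\<^sup>+ t. F t * (\<integral>\<^sup>+ x. H x * ennreal (symmetrized_tilt n x (root4 n * t)) \<partial>P n) \<partial>lborel)"
    by (simp add: nn_integral_smoothed_tilt inv)
  finally show ?thesis .
qed

lemma nn_integral_Q_prod_le:
  assumes n: "n > 0" and [measurable]: "H \<in> borel_measurable (P n)" "F \<in> borel_measurable borel"
    and inv: "sign_invariant n H"
  shows "(\<integral>\<^sup>+ p. F (snd p) * H (fst p) \<partial>Q n)
    \<le> (\<integral>\<^sup>+ t. F t * ennreal (gauss_bound t) \<partial>lborel) * (\<integral>\<^sup>+ x. H x \<partial>P n)"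
proof -
  have "(\<integral>\<^sup>+ p. F (snd p) * H (fst p) \<partial>Q n)
    = (\<integral>\<^sup>+ t. F t * (\<integral>\<^sup>+ x. H x * ennreal (symmetrized_tilt n x (root4 n * t)) \<partial>P n) \<partial>lborel)"
    by (intro nn_integral_Q_prod inv) auto
  also have "\<dots> \<le> (\<integral>\<^sup>+ t. F t * (\<integral>\<^sup>+ x. H x * ennreal (gauss_bound t) \<partial>P n) \<partial>lborel)"
    by (intro nn_integral_mono mult_left_mono ennreal_leI symmetrized_tilt_le root4_ge_1 n root4_pow4) auto
  also have "\<dots> = (\<integral>\<^sup>+ t. F t * ennreal (gauss_bound t) \<partial>lborel) * (\<integral>\<^sup>+ x. H x \<partial>P n)"
    by (subst nn_integral_multc[symmetric], measurable)
       (intro nn_integral_cong, subst nn_integral_multc, measurable, simp only: ac_simps)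
  finally show ?thesis .
qed

lemma nn_integral_Q_sign_invariant_le:
  assumes "n > 0" "H \<in> borel_measurable (P n)" "sign_invariant n H"
  shows "(\<integral>\<^sup>+ p. H (fst p) \<partial>Q n) \<le> ennreal gauss_mass * (\<integral>\<^sup>+ x. H x \<partial>P n)"
  using nn_integral_Q_prod_le[OF assms(1,2) _ assms(3), of "\<lambda>_. 1"] by (simp add: nn_integral_gauss_bound)

lemma emeasure_Q_le: "n > 0 \<Longrightarrow> emeasure (Q n) (space (Q n)) \<le> ennreal gauss_mass"
  using nn_integral_Q_sign_invariant_le[of n "\<lambda>_. 1"] by (simp add: sign_invariant_const emeasure_P_space)

lemma finite_measure_Q: "n > 0 \<Longrightarrow> finite_measure (Q n)"
  using emeasure_Q_le[of n] by (intro finite_measureI) (auto simp: top_unique)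

lemma nn_integral_Q_square_le:
  assumes n: "n > 0" shows "(\<integral>\<^sup>+ p. ennreal ((snd p)\<^sup>2) \<partial>Q n) \<le> ennreal (6 * gauss_mass)"
  using nn_integral_Q_prod_le[OF n, of "\<lambda>_. 1" "\<lambda>t. ennreal (t\<^sup>2)"]
  by (simp add: sign_invariant_const nn_integral_gauss_bound_square emeasure_P_space)

text \<open>Given x, the integrand averages to the variance of t, 1 / sqrt n; only the total mass
  remains to be bounded.\<close>

lemma nn_integral_Q_deviation_le:
  assumes n: "n > 0"
  shows "(\<integral>\<^sup>+ p. ennreal ((snd p - studentized n (fst p) / root4 n)\<^sup>2) \<partial>Q n) \<le> ennreal (gauss_mass / (root4 n)\<^sup>2)"
proof -
  note pos = root4_pos[OF n]
  have "(\<integral>\<^sup>+ p. ennreal ((snd p - studentized n (fst p) / root4 n)\<^sup>2) \<partial>Q n)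
    = (\<integral>\<^sup>+ x. ennreal (1 / (root4 n)\<^sup>2) * (1 * ennreal (tilt n x / root4 n)) \<partial>P n)"
    using pos
    by (subst nn_integral_Q_fst[OF n], measurable)
       (simp add: nn_integral_normal_density_variance power_divide, simp add: mult.commute)
  also have "\<dots> = ennreal (1 / (root4 n)\<^sup>2) * (\<integral>\<^sup>+ p. 1 \<partial>Q n)"
    by (subst nn_integral_Q_coord[OF n, of "\<lambda>_. 1"], measurable, rule nn_integral_cmult) auto
  also have "\<dots> \<le> ennreal (1 / (root4 n)\<^sup>2) * ennreal gauss_mass"
    using emeasure_Q_le[OF n] by (intro mult_left_mono) auto
  also have "\<dots> = ennreal (gauss_mass / (root4 n)\<^sup>2)"
    using gauss_mass_pos by (simp add: ennreal_mult''[symmetric])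
  finally show ?thesis .
qed

text \<open>Integrating out t undoes the smoothing. The factor n^(1/4) is the Jacobian left out of
  \<open>Q\<close>, and it is the whole price of the tilt.\<close>

lemma nn_integral_tilt_eq:
  assumes n: "n > 0" and [measurable]: "H \<in> borel_measurable (P n)"
  shows "(\<integral>\<^sup>+ x. H x * ennreal (tilt n x) \<partial>P n) = ennreal (root4 n) * (\<integral>\<^sup>+ p. H (fst p) \<partial>Q n)"
proof -
  have "ennreal (root4 n) * (H x * ennreal (tilt n x / root4 n)) = H x * ennreal (tilt n x)" for x
  proof -
    have "ennreal (root4 n) * ennreal (tilt n x / root4 n) = ennreal (tilt n x)"
      using root4_pos[OF n] by (subst ennreal_mult'[symmetric]) auto
    then show ?thesis by (metis mult.left_commute)
  qed
  then show ?thesis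
    by (subst nn_integral_Q_coord[OF n], measurable, subst nn_integral_cmult[symmetric], measurable)
qed

lemma nn_integral_tilt_le:
  assumes n: "n > 0" and H: "H \<in> borel_measurable (P n)" "sign_invariant n H"
  shows "(\<integral>\<^sup>+ x. H x * ennreal (tilt n x) \<partial>P n) \<le> ennreal (root4 n * gauss_mass) * (\<integral>\<^sup>+ x. H x \<partial>P n)"
  using mult_left_mono[OF nn_integral_Q_sign_invariant_le[OF n H], of "ennreal (root4 n)"] root4_pos[OF n] gauss_mass_pos
  by (simp add: nn_integral_tilt_eq[OF n H(1)] ennreal_mult'' mult.assoc)

text \<open>Y^2 is not sign invariant, so the envelope cannot be applied to it. It is recovered from
  t through (Y / n^(1/4))^2 \<le> 2 t^2 + 2 (t - Y / n^(1/4))^2, whose two terms have bounded second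
  moments; 14 is 2 * (6 + 1).\<close>

lemma nn_integral_tilt_studentized_le:
  assumes n: "n > 0"
  shows "(\<integral>\<^sup>+ x. ennreal ((studentized n x)\<^sup>2) * ennreal (tilt n x) \<partial>P n) \<le> ennreal (14 * gauss_mass * root4 n ^ 3)"
proof -
  note pos = root4_pos[OF n]
  have "(\<integral>\<^sup>+ p. ennreal ((studentized n (fst p))\<^sup>2) \<partial>Q n)
      \<le> (\<integral>\<^sup>+ p. ennreal (2 * (root4 n)\<^sup>2) * (ennreal ((snd p)\<^sup>2)
            + ennreal ((snd p - studentized n (fst p) / root4 n)\<^sup>2)) \<partial>Q n)"
  proof (intro nn_integral_mono)
    fix p :: "(nat \<Rightarrow> real) \<times> real"
    let ?u = "studentized n (fst p) / root4 n"
    \<comment> \<open>With t = \<open>snd p\<close>, this square is exactly 2 t^2 + 2 (t - u)^2 -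
      u^2.\<close>
    have "0 \<le> (snd p + (snd p - ?u))\<^sup>2" by simp
    then have "?u\<^sup>2 \<le> 2 * ((snd p)\<^sup>2 + (snd p - ?u)\<^sup>2)" by (simp add: power2_eq_square algebra_simps)
    then have "(root4 n)\<^sup>2 * ?u\<^sup>2 \<le> (root4 n)\<^sup>2 * (2 * ((snd p)\<^sup>2 + (snd p - ?u)\<^sup>2))"
      by (intro mult_left_mono) auto
    moreover have "(root4 n)\<^sup>2 * ?u\<^sup>2 = (studentized n (fst p))\<^sup>2"
      using pos by (simp add: power_divide)
    ultimately show "ennreal ((studentized n (fst p))\<^sup>2) \<le> ennreal (2 * (root4 n)\<^sup>2) * (ennreal ((snd p)\<^sup>2)
            + ennreal ((snd p - ?u)\<^sup>2))"
      by (simp add: ennreal_plus[symmetric] ennreal_mult'[symmetric] algebra_simps del: ennreal_plus)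
  qed
  also have "\<dots> = ennreal (2 * (root4 n)\<^sup>2) * ((\<integral>\<^sup>+ p. ennreal ((snd p)\<^sup>2) \<partial>Q n)
      + (\<integral>\<^sup>+ p. ennreal ((snd p - studentized n (fst p) / root4 n)\<^sup>2) \<partial>Q n))"
    by (subst nn_integral_cmult, measurable, subst nn_integral_add) auto
  also have "\<dots> \<le> ennreal (2 * (root4 n)\<^sup>2) * (ennreal (6 * gauss_mass) + ennreal (gauss_mass / (root4 n)\<^sup>2))"
    by (intro mult_left_mono add_mono nn_integral_Q_square_le nn_integral_Q_deviation_le n) auto
  also have "\<dots> \<le> ennreal (14 * gauss_mass * (root4 n)\<^sup>2)"
  proof -
    have "gauss_mass / (root4 n)\<^sup>2 \<le> gauss_mass / 1"
      using root4_ge_1[OF n] gauss_mass_pos by (intro divide_left_mono) auto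
    then have "2 * (root4 n)\<^sup>2 * (6 * gauss_mass + gauss_mass / (root4 n)\<^sup>2) \<le> 2 * (root4 n)\<^sup>2 * (6 * gauss_mass + gauss_mass)"
      by (intro mult_left_mono add_left_mono) auto
    then show ?thesis
      using gauss_mass_pos
      by (simp add: ennreal_plus[symmetric] ennreal_mult'[symmetric] algebra_simps del: ennreal_plus)
  qed
  finally have "ennreal (root4 n) * (\<integral>\<^sup>+ p. ennreal ((studentized n (fst p))\<^sup>2) \<partial>Q n)
      \<le> ennreal (root4 n) * ennreal (14 * gauss_mass * (root4 n)\<^sup>2)"
    by (intro mult_left_mono) auto
  also have "\<dots> = ennreal (14 * gauss_mass * root4 n ^ 3)"
    using pos gauss_mass_pos by (simp add: ennreal_mult'[symmetric] power2_eq_square power3_eq_cube ac_simps)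
  finally show ?thesis by (subst nn_integral_tilt_eq[OF n]) auto
qed

section \<open>The law of large numbers\<close>

lemma prob_UNIV[simp]: "prob UNIV = 1"
  using prob_space by simp

definition empirical_mean :: "nat \<Rightarrow> (real \<Rightarrow> real) \<Rightarrow> (nat \<Rightarrow> real) \<Rightarrow> real" where
  "empirical_mean n f x = (\<Sum>i<n. f (x i)) / n"

lemma measurable_empirical_mean[measurable]:
  assumes [measurable]: "f \<in> borel_measurable borel"
  shows "empirical_mean n f \<in> borel_measurable (P n)"
  unfolding empirical_mean_def[abs_def] by measurable

lemma sign_invariant_empirical_mean:
  assumes "\<And>z. f (- z) = f z" shows "sign_invariant n (empirical_mean n f)"
  using assms unfolding sign_invariant_def empirical_mean_def by (auto intro!: sum.cong)

text \<open>The product is written as a product over all n coordinates of functions of one variable,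
  most of them constant 1. The same formula covers i = j, where both factors fall on one coordinate,
  and i \<noteq> j, where a centred factor makes the integral vanish.\<close>

lemma has_bochner_integral_coord_mult:
  fixes h :: "real \<Rightarrow> real"
  assumes h: "integrable \<rho> h" "integrable \<rho> (\<lambda>z. (h z)\<^sup>2)" "expectation h = 0" and ij: "i < n" "j < n"
  shows "has_bochner_integral (P n) (\<lambda>x. h (x i) * h (x j)) (if i = j then expectation (\<lambda>z. (h z)\<^sup>2) else 0)"
proof -
  define f where "f = (\<lambda>k z. (if k = i then h z else 1) * (if k = j then h z else 1))"
  have f_eq: "f k = (if k = i \<and> k = j then (\<lambda>z. (h z)\<^sup>2) else if k = i \<or> k = j then h else (\<lambda>_. 1))" for k
    by (auto simp: f_def power2_eq_square fun_eq_iff)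
  have int: "integrable \<rho> (f k)" for k
    unfolding f_eq using h by auto
  have eq: "(\<Prod>k<n. f k (x k)) = h (x i) * h (x j)" for x
    using ij unfolding f_def by (simp add: prod.distrib)
  have "(\<Prod>k<n. expectation (f k)) = (if i = j then expectation (\<lambda>z. (h z)\<^sup>2) else 0)"
  proof (cases "i = j")
    case True
    then have "expectation (f k) = (if k = i then expectation (\<lambda>z. (h z)\<^sup>2) else 1)" for k
      unfolding f_eq by simp
    with True ij show ?thesis by simp
  next
    case False
    then have "expectation (f i) = 0" using h(3) by (simp add: f_eq)
    with False ij show ?thesis by (auto intro!: prod_zero)
  qed
  moreover have "integrable (P n) (\<lambda>x. \<Prod>k<n. f k (x k))"
    by (intro prod.product_integrable_prod int) auto
  moreover have "(\<integral>x. (\<Prod>k<n. f k (x k)) \<partial>P n) = (\<Prod>k<n. expectation (f k))"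
    by (intro prod.product_integral_prod int) auto
  ultimately show ?thesis by (simp add: has_bochner_integral_iff eq)
qed

lemma empirical_mean_Chebyshev:
  assumes [measurable]: "f \<in> borel_measurable borel"
    and f: "integrable \<rho> f" "integrable \<rho> (\<lambda>z. (f z)\<^sup>2)" and n: "n > 0" and d: "\<delta> > 0"
  shows "measure (P n) {x \<in> space (P n). \<bar>empirical_mean n f x - expectation f\<bar> \<ge> \<delta>} \<le> variance f / (n * \<delta>\<^sup>2)"
proof -
  interpret Pn: prob_space "P n" by (rule prob_space_P)
  define h where "h = (\<lambda>z. f z - expectation f)"
  have h: "integrable \<rho> h" "expectation h = 0" unfolding h_def using f by (simp_all)
  have h2: "integrable \<rho> (\<lambda>z. (h z)\<^sup>2)"
    unfolding h_def power2_eq_square ring_distribs using f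
    by (intro Bochner_Integration.integrable_diff) (auto simp: power2_eq_square)
  have eq: "(\<Sum>i<n. h (x i)) / n = empirical_mean n f x - expectation f" for x
    using n unfolding h_def empirical_mean_def by (simp add: sum_subtractf diff_divide_distrib)
  have "has_bochner_integral (P n) (\<lambda>x. \<Sum>i<n. \<Sum>j<n. h (x i) * h (x j))
      (\<Sum>i<n. \<Sum>j<n. if i = j then expectation (\<lambda>z. (h z)\<^sup>2) else 0)"
    by (intro has_bochner_integral_sum has_bochner_integral_coord_mult h h2) auto
  then have "has_bochner_integral (P n) (\<lambda>x. (\<Sum>i<n. h (x i))\<^sup>2) (n * expectation (\<lambda>z. (h z)\<^sup>2))"
    by (simp add: power2_eq_square sum_product)
  from has_bochner_integral_divide_zero[OF this, of "(real n)\<^sup>2"]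
  have sq: "has_bochner_integral (P n) (\<lambda>x. (empirical_mean n f x - expectation f)\<^sup>2) (expectation (\<lambda>z. (h z)\<^sup>2) / n)"
    unfolding power_divide[symmetric] eq using n by (simp add: power2_eq_square)
  have "Pn.prob {x \<in> space (P n). \<bar>empirical_mean n f x - expectation f\<bar> \<ge> \<delta>}
      \<le> Pn.expectation (\<lambda>x. (empirical_mean n f x - expectation f)\<^sup>2) / \<delta>\<^sup>2"
    using sq d by (intro Pn.second_moment_method) (auto simp: has_bochner_integral_iff)
  then show ?thesis using sq by (simp add: has_bochner_integral_iff h_def)
qed

lemma expectation_odd:
  fixes f :: "real \<Rightarrow> real"
  assumes [measurable]: "f \<in> borel_measurable borel" and odd: "\<And>z. f (- z) = - f z"
  shows "expectation f = 0"
proof -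
  have "(\<integral>z. f z \<partial>distr \<rho> borel uminus) = (\<integral>z. f (- z) \<partial>\<rho>)"
    by (rule integral_distr) auto
  then show ?thesis by (simp add: symmetric odd)
qed

text \<open>Flipping the first sign moves a vanishing sum away from 0 unless that coordinate is 0.\<close>

lemma prob_Ssum_nonzero_ge:
  assumes n: "n > 0"
  shows "measure (P n) {x \<in> space (P n). Ssum n x \<noteq> 0} \<ge> measure \<rho> {z. z \<noteq> 0} / 2"
proof -
  interpret Pn: prob_space "P n" by (rule prob_space_P)
  let ?A = "{x \<in> space (P n). Ssum n x \<noteq> 0}"
  have [measurable]: "(\<lambda>x. x 0) \<in> P n \<rightarrow>\<^sub>M borel" using n by measurable
  have flip[measurable]: "(\<lambda>x. x(0 := - x 0)) \<in> P n \<rightarrow>\<^sub>M P n" using n by (rule measurable_flip)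
  have "emeasure \<rho> {z. z \<noteq> 0} = emeasure (distr (P n) \<rho> (\<lambda>x. x 0)) {z. z \<noteq> 0}"
    using n by (subst distr_PiM_component) (auto simp: prob_space_axioms)
  also have "\<dots> = (\<integral>\<^sup>+ x. indicator {x \<in> space (P n). x 0 \<noteq> 0} x \<partial>P n)"
    by (subst emeasure_distr)
       (auto simp: measurable_cong_sets[OF refl sets_law] intro!: arg_cong[where f = "emeasure (P n)"])
  also have "\<dots> \<le> (\<integral>\<^sup>+ x. indicator ?A x + indicator ?A (x(0 := - x 0)) \<partial>P n)"
  proof (intro nn_integral_mono)
    fix x assume x: "x \<in> space (P n)"
    have "Ssum n x - Ssum n (x(0 := - x 0)) = 2 * x 0"
      using n unfolding Ssum_def sum_subtractf[symmetric] by (subst sum.remove[of _ 0]) auto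
    moreover have "x(0 := - x 0) \<in> space (P n)" by (rule measurable_space[OF flip x])
    ultimately show "(indicator {x \<in> space (P n). x 0 \<noteq> 0} x :: ennreal) \<le> indicator ?A x + indicator ?A (x(0 := - x 0))"
      using x by (auto simp: indicator_def)
  qed
  also have "\<dots> = (\<integral>\<^sup>+ x. indicator ?A x \<partial>P n) + (\<integral>\<^sup>+ x. indicator ?A (x(0 := - x 0)) \<partial>P n)"
    by (intro nn_integral_add) auto
  also have "\<dots> = emeasure (P n) ?A + emeasure (P n) ?A"
    by (subst nn_integral_flip[OF n]) auto
  finally have "ennreal (measure \<rho> {z. z \<noteq> 0}) \<le> ennreal (Pn.prob ?A + Pn.prob ?A)"
    unfolding emeasure_eq_measure Pn.emeasure_eq_measure by (simp only: ennreal_plus measure_nonneg)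
  then have "measure \<rho> {z. z \<noteq> 0} \<le> Pn.prob ?A + Pn.prob ?A"
    by (subst (asm) ennreal_le_iff) auto
  then show ?thesis by simp
qed

end

lemma cw_weight_le_tilt:
  assumes "\<And>u. g u \<le> u\<^sup>2 / 2" "n > 0"
  shows "cw_weight g n x \<le> tilt n x"
proof (cases "Tsum n x > 0")
  case True
  have "real n * g (Ssum n x / sqrt (real n * Tsum n x)) \<le> real n * ((Ssum n x / sqrt (real n * Tsum n x))\<^sup>2 / 2)"
    by (intro mult_left_mono assms) simp
  also have "\<dots> = (studentized n x)\<^sup>2 / 2"
    using True assms(2) by (simp add: studentized_def power_divide)
  finally show ?thesis using True by (simp add: cw_weight_def tilt_def)
qed (simp add: cw_weight_def tilt_def)

lemma cw_weight_nonneg: "cw_weight g n x \<ge> 0" by (simp add: cw_weight_def)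

section \<open>Bounds for the normalizing constant and the law of large numbers\<close>

locale cw_law = symmetric_law +
  assumes variance_pos: "variance (\<lambda>z. z) > 0"
    and exp_moment: "\<exists>v>0. integrable \<rho> (\<lambda>z. exp (v * z\<^sup>2))"
begin

text \<open>The elementary bound y \<le> exp y at y = v z^2 / m, raised to the power m, dominates
  the moment by the given exponential moment.\<close>

lemma integrable_even_moment: "integrable \<rho> (\<lambda>z. (z\<^sup>2) ^ m)"
proof -
  obtain v where v: "v > 0" "integrable \<rho> (\<lambda>z. exp (v * z\<^sup>2))" using exp_moment by blast
  show ?thesis
  proof (cases "m = 0")
    case False
    have "(z\<^sup>2) ^ m \<le> (m / v) ^ m * exp (v * z\<^sup>2)" for z :: real
    proof -
      have "v * z\<^sup>2 / m \<le> exp (v * z\<^sup>2 / m)" using exp_ge_add_one_self[of "v * z\<^sup>2 / m"] by linarith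
      then have "z\<^sup>2 \<le> m / v * exp (v * z\<^sup>2 / m)" using v False by (simp add: field_simps)
      then have "(z\<^sup>2) ^ m \<le> (m / v * exp (v * z\<^sup>2 / m)) ^ m" by (intro power_mono) auto
      also have "\<dots> = (m / v) ^ m * exp (v * z\<^sup>2)"
        unfolding power_mult_distrib exp_of_nat_mult[symmetric] using False by simp
      finally show ?thesis .
    qed
    then show ?thesis
      by (intro Bochner_Integration.integrable_bound[OF integrable_mult_right[OF v(2), of "(m / v) ^ m"]])
         (use v(1) in \<open>auto simp: abs_mult power_abs\<close>)
  qed simp
qed

lemma integrable_moments:
  "integrable \<rho> (\<lambda>z. z)" "integrable \<rho> (\<lambda>z. z\<^sup>2)" "integrable \<rho> (\<lambda>z. z ^ 4)" "integrable \<rho> (\<lambda>z. z ^ 6)"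
  "integrable \<rho> (\<lambda>z. (z\<^sup>2)\<^sup>2)" "integrable \<rho> (\<lambda>z. (z ^ 4)\<^sup>2)" "integrable \<rho> (\<lambda>z. (z ^ 6)\<^sup>2)"
proof -
  show "integrable \<rho> (\<lambda>z. z\<^sup>2)" "integrable \<rho> (\<lambda>z. z ^ 4)" "integrable \<rho> (\<lambda>z. z ^ 6)"
    "integrable \<rho> (\<lambda>z. (z\<^sup>2)\<^sup>2)" "integrable \<rho> (\<lambda>z. (z ^ 4)\<^sup>2)" "integrable \<rho> (\<lambda>z. (z ^ 6)\<^sup>2)"
    using integrable_even_moment[of 1] integrable_even_moment[of 2] integrable_even_moment[of 3]
      integrable_even_moment[of 4] integrable_even_moment[of 6]
    by (simp_all add: power_mult[symmetric])
  from square_integrable_imp_integrable[OF _ this(1)] show "integrable \<rho> (\<lambda>z. z)" by simp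
qed

definition \<sigma>2 :: real where "\<sigma>2 = expectation (\<lambda>z. z\<^sup>2)"

lemma expectation_id: "expectation (\<lambda>z. z) = 0"
  by (rule expectation_odd) auto

lemma variance_id: "variance (\<lambda>z. z) = \<sigma>2"
  by (simp add: expectation_id \<sigma>2_def)

lemma \<sigma>2_pos: "\<sigma>2 > 0" using variance_pos by (simp add: variance_id)

lemma prob_nonzero_pos: "measure \<rho> {z. z \<noteq> 0} > 0"
proof (rule ccontr)
  assume "\<not> measure \<rho> {z. z \<noteq> 0} > 0"
  then have "emeasure \<rho> {z. z \<noteq> 0} = 0" by (simp add: emeasure_eq_measure zero_less_measure_iff)
  then have "AE z in \<rho>. z = 0" by (intro AE_I[where N = "{z. z \<noteq> 0}"]) simp_all
  then have "AE z in \<rho>. z\<^sup>2 = 0" by eventually_elim simp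
  then have "\<sigma>2 = expectation (\<lambda>_. 0)" unfolding \<sigma>2_def by (intro integral_cong_AE) simp_all
  with \<sigma>2_pos show False by simp
qed

lemma empirical_mean_id: "empirical_mean n (\<lambda>z. z) x = Ssum n x / n"
  by (simp add: empirical_mean_def Ssum_def)

lemma empirical_mean_square: "empirical_mean n (\<lambda>z. z\<^sup>2) x = Tsum n x / n"
  by (simp add: empirical_mean_def Tsum_def)

lemma measurable_cw_weight[measurable]:
  assumes [measurable]: "g \<in> borel_measurable borel"
  shows "cw_weight g n \<in> borel_measurable (P n)"
  unfolding cw_weight_def[abs_def] by measurable

text \<open>
  The value of g at 0 itself is only bounded above: if it is negative, the event S = 0 carries
  almost no weight, so the bound has to come from the event that S is small but nonzero.
\<close>

lemma cw_Z_lower_bound: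
  assumes [measurable]: "g \<in> borel_measurable borel"
    and g0: "\<forall>\<^sub>F u in at 0. g u \<ge> 0"
  shows "\<exists>c>0. \<forall>\<^sub>F n in sequentially. cw_Z \<rho> g n \<ge> ennreal c"
proof -
  obtain e where e: "e > 0" "\<And>u. u \<noteq> 0 \<Longrightarrow> \<bar>u\<bar> < e \<Longrightarrow> g u \<ge> 0"
    using g0 unfolding eventually_at by (auto simp: dist_real_def)
  define p where "p = measure \<rho> {z. z \<noteq> 0}"
  \<comment> \<open>Chosen so that T / n > \<sigma>^2 / 2 and |S / n| < e sqrt (\<sigma>^2 / 2)
    together force |S / sqrt (n T)| < e, where \<open>g\<close> is nonnegative and the weight is at
    least 1.\<close>
  define d1 where "d1 = \<sigma>2 / 2"
  define d2 where "d2 = e * sqrt (\<sigma>2 / 2)"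
  have d: "d1 > 0" "d2 > 0" using \<sigma>2_pos e by (auto simp: d1_def d2_def)
  define V1 where "V1 = variance (\<lambda>z. z\<^sup>2)"
  define V2 where "V2 = variance (\<lambda>z. z)"
  have p: "p > 0" using prob_nonzero_pos by (simp add: p_def)
  have bound: "cw_Z \<rho> g n \<ge> ennreal (p / 2 - V1 / (n * d1\<^sup>2) - V2 / (n * d2\<^sup>2))" if n: "n > 0" for n
  proof -
    interpret Pn: prob_space "P n" by (rule prob_space_P)
    define A where "A = {x \<in> space (P n). Ssum n x \<noteq> 0}"
    define B1 where "B1 = {x \<in> space (P n). \<bar>empirical_mean n (\<lambda>z. z\<^sup>2) x - expectation (\<lambda>z. z\<^sup>2)\<bar> \<ge> d1}"
    define B2 where "B2 = {x \<in> space (P n). \<bar>empirical_mean n (\<lambda>z. z) x - expectation (\<lambda>z. z)\<bar> \<ge> d2}"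
    have [measurable]: "A \<in> sets (P n)" "B1 \<in> sets (P n)" "B2 \<in> sets (P n)"
      unfolding A_def B1_def B2_def by measurable
    have PA: "Pn.prob A \<ge> p / 2" unfolding A_def p_def by (rule prob_Ssum_nonzero_ge[OF n])
    have PB: "Pn.prob B1 \<le> V1 / (n * d1\<^sup>2)" "Pn.prob B2 \<le> V2 / (n * d2\<^sup>2)"
      unfolding B1_def B2_def V1_def V2_def
      by (intro empirical_mean_Chebyshev integrable_moments n d; simp)+
    have "Pn.prob A \<le> Pn.prob (A - B1 - B2) + Pn.prob B1 + Pn.prob B2"
    proof -
      have "Pn.prob A \<le> Pn.prob ((A - B1 - B2) \<union> B1 \<union> B2)" by (intro Pn.finite_measure_mono) auto
      also have "\<dots> \<le> Pn.prob ((A - B1 - B2) \<union> B1) + Pn.prob B2" by (intro measure_Un_le) auto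
      also have "\<dots> \<le> Pn.prob (A - B1 - B2) + Pn.prob B1 + Pn.prob B2" by (intro add_right_mono measure_Un_le) auto
      finally show ?thesis .
    qed
    with PA PB have "p / 2 - V1 / (n * d1\<^sup>2) - V2 / (n * d2\<^sup>2) \<le> Pn.prob (A - B1 - B2)" by linarith
    then have "ennreal (p / 2 - V1 / (n * d1\<^sup>2) - V2 / (n * d2\<^sup>2)) \<le> emeasure (P n) (A - B1 - B2)"
      unfolding Pn.emeasure_eq_measure by (rule ennreal_leI)
    also have "\<dots> = (\<integral>\<^sup>+ x. indicator (A - B1 - B2) x \<partial>P n)" by simp
    also have "\<dots> \<le> cw_Z \<rho> g n"
      unfolding cw_Z_def
    proof (intro nn_integral_mono)
      fix x assume x: "x \<in> space (P n)"
      have "cw_weight g n x \<ge> 1" if "x \<in> A - B1 - B2"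
      proof -
        have S: "Ssum n x \<noteq> 0" using that by (simp add: A_def)
        have "\<bar>Tsum n x / n - \<sigma>2\<bar> < \<sigma>2 / 2"
          using that x by (auto simp: B1_def d1_def empirical_mean_square \<sigma>2_def)
        then have T: "Tsum n x / n > \<sigma>2 / 2" by linarith
        then have T0: "Tsum n x > 0" using \<sigma>2_pos n
          by (smt (verit) divide_nonpos_nonneg half_gt_zero of_nat_0_le_iff)
        have Sn: "\<bar>Ssum n x / n\<bar> < e * sqrt (\<sigma>2 / 2)"
          using that x by (auto simp: B2_def d2_def empirical_mean_id expectation_id)
        let ?u = "Ssum n x / sqrt (n * Tsum n x)"
        have "sqrt (n * Tsum n x) = n * sqrt (Tsum n x / n)"
          using T0 n by (intro real_sqrt_unique) (simp_all add: power_mult_distrib, simp add: power2_eq_square)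
        then have "\<bar>?u\<bar> = \<bar>Ssum n x / n\<bar> / sqrt (Tsum n x / n)"
          using T0 n by (simp add: abs_mult)
        also have "\<dots> < e * sqrt (\<sigma>2 / 2) / sqrt (\<sigma>2 / 2)"
          using T \<sigma>2_pos e Sn by (intro frac_less) auto
        also have "\<dots> = e" using \<sigma>2_pos by simp
        finally have "g ?u \<ge> 0" using S T0 n by (intro e) auto
        then show ?thesis using T0 by (simp add: cw_weight_def)
      qed
      then show "indicator (A - B1 - B2) x \<le> ennreal (cw_weight g n x)"
        using ennreal_leI[of 1 "cw_weight g n x"] by (auto simp: indicator_def)
    qed
    finally show ?thesis .
  qed
  have "(\<lambda>n. p / 2 - V1 / (real n * d1\<^sup>2) - V2 / (real n * d2\<^sup>2)) \<longlonglongrightarrow> p / 2"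
    using d by real_asymp
  then have "\<forall>\<^sub>F n in sequentially. p / 2 - V1 / (real n * d1\<^sup>2) - V2 / (real n * d2\<^sup>2) > p / 4"
    by (rule order_tendstoD) (use p in simp)
  then have "\<forall>\<^sub>F n in sequentially. cw_Z \<rho> g n \<ge> ennreal (p / 4)"
    using eventually_gt_at_top[of 0]
  proof eventually_elim
    case (elim n)
    then show ?case using bound[of n] by (meson ennreal_leI less_imp_le order_trans)
  qed
  with p show ?thesis by (intro exI[of _ "p / 4"]) auto
qed

text \<open>Later proofs take from this that the normalizing constant is finite, so that dividing by
  it is ordinary division of reals.\<close>

lemma cw_Z_le:
  assumes "\<And>u. g u \<le> u\<^sup>2 / 2" "n > 0"
  shows "cw_Z \<rho> g n \<le> ennreal (root4 n * gauss_mass)"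
proof -
  have "cw_Z \<rho> g n \<le> (\<integral>\<^sup>+ x. 1 * ennreal (tilt n x) \<partial>P n)"
    unfolding cw_Z_def by (auto intro!: nn_integral_mono ennreal_leI cw_weight_le_tilt assms)
  also have "\<dots> \<le> ennreal (root4 n * gauss_mass) * (\<integral>\<^sup>+ x. 1 \<partial>P n)"
    by (intro nn_integral_tilt_le assms) (auto simp: sign_invariant_const)
  finally show ?thesis by (simp add: emeasure_P_space)
qed

text \<open>If the pair is far from its limit, then either T / n deviates, which is a sign invariant
  event of probability O(1 / n), or T is at most 2 \<sigma>^2 n while |S| \<ge> n d, so that Y^2 is
  at least of order n. Under the tilt the two cases have mass O(n^(1/4 - 1)) and O(n^(3/4 - 1)), and
  the normalizing constant stays away from 0.\<close>

lemma law_of_large_numbers: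
  assumes [measurable]: "g \<in> borel_measurable borel"
    and g0: "\<forall>\<^sub>F u in at 0. g u \<ge> 0" and g_le: "\<And>u. g u \<le> u\<^sup>2 / 2" and eps: "\<epsilon> > 0"
  shows "(\<lambda>n. measure (mu_tilde \<rho> g n) {x \<in> space (mu_tilde \<rho> g n).
             dist (Ssum n x / real n, Tsum n x / real n) (0, \<sigma>2) > \<epsilon>}) \<longlonglongrightarrow> 0"
proof -
  obtain c where c: "c > 0" "\<forall>\<^sub>F n in sequentially. cw_Z \<rho> g n \<ge> ennreal c"
    using cw_Z_lower_bound[OF _ g0] by auto
  define A where "A = (\<lambda>n. {x \<in> space (P n). dist (Ssum n x / real n, Tsum n x / real n) (0, \<sigma>2) > \<epsilon>})"
  define d where "d = min (\<epsilon> / 2) (\<sigma>2 / 2)"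
  have d: "d > 0" "d \<le> \<epsilon> / 2" "d \<le> \<sigma>2 / 2" using eps \<sigma>2_pos by (auto simp: d_def)
  define V where "V = variance (\<lambda>z. z\<^sup>2)"
  have V: "V \<ge> 0" unfolding V_def by simp
  define b where "b = (\<lambda>n. root4 n * gauss_mass * (V / (n * d\<^sup>2)) + 2 * \<sigma>2 / (n * d\<^sup>2) * (14 * gauss_mass * root4 n ^ 3))"
  have bound: "(\<integral>\<^sup>+ x. ennreal (cw_weight g n x) * indicator (A n) x \<partial>P n) \<le> ennreal (b n)" if n: "n > 0" for n
  proof -
    interpret Pn: prob_space "P n" by (rule prob_space_P)
    define B where "B = {x \<in> space (P n). \<bar>empirical_mean n (\<lambda>z. z\<^sup>2) x - expectation (\<lambda>z. z\<^sup>2)\<bar> \<ge> d}"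
    have [measurable]: "B \<in> sets (P n)" unfolding B_def by measurable
    have PB: "Pn.prob B \<le> V / (n * d\<^sup>2)"
      unfolding B_def V_def by (intro empirical_mean_Chebyshev integrable_moments n d; simp)
    have inv: "sign_invariant n (\<lambda>x. indicator {x. \<bar>empirical_mean n (\<lambda>z. z\<^sup>2) x - expectation (\<lambda>z. z\<^sup>2)\<bar> \<ge> d} x :: ennreal)"
      using sign_invariant_empirical_mean[of "\<lambda>z. z\<^sup>2" n] by (auto simp: sign_invariant_def indicator_def)
    have "(\<integral>\<^sup>+ x. ennreal (cw_weight g n x) * indicator (A n) x \<partial>P n)
      \<le> (\<integral>\<^sup>+ x. indicator B x * ennreal (tilt n x)
           + ennreal (2 * \<sigma>2 / (n * d\<^sup>2)) * (ennreal ((studentized n x)\<^sup>2) * ennreal (tilt n x)) \<partial>P n)"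
    proof (intro nn_integral_mono)
      fix x assume x: "x \<in> space (P n)"
      have w: "ennreal (cw_weight g n x) \<le> ennreal (tilt n x)"
        by (intro ennreal_leI cw_weight_le_tilt g_le n)
      show "ennreal (cw_weight g n x) * indicator (A n) x \<le> indicator B x * ennreal (tilt n x)
           + ennreal (2 * \<sigma>2 / (n * d\<^sup>2)) * (ennreal ((studentized n x)\<^sup>2) * ennreal (tilt n x))"
      proof (cases "x \<in> A n \<and> x \<notin> B")
        case True
        have "dist (Ssum n x / n, Tsum n x / n) (0, \<sigma>2) \<le> \<bar>Ssum n x / n\<bar> + \<bar>Tsum n x / n - \<sigma>2\<bar>"
          unfolding dist_Pair_Pair dist_real_def power2_abs diff_0_right by (rule sqrt_sum_squares_le_sum_abs)
        moreover have dT: "\<bar>Tsum n x / n - \<sigma>2\<bar> < d"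
          using True x by (auto simp: B_def empirical_mean_square \<sigma>2_def)
        ultimately have S: "\<bar>Ssum n x / n\<bar> \<ge> d" using True d by (simp add: A_def)
        have T: "0 < Tsum n x" "Tsum n x \<le> 2 * \<sigma>2 * n"
        proof -
          have "0 < Tsum n x / n" "Tsum n x / n \<le> 2 * \<sigma>2" using dT d \<sigma>2_pos by linarith+
          then show "0 < Tsum n x" "Tsum n x \<le> 2 * \<sigma>2 * n" using n by (auto simp: field_simps zero_less_divide_iff)
        qed
        have "n\<^sup>2 * d\<^sup>2 \<le> (Ssum n x)\<^sup>2"
        proof -
          have "n * d \<le> \<bar>Ssum n x\<bar>" using S n by (simp add: field_simps)
          then have "(n * d)\<^sup>2 \<le> \<bar>Ssum n x\<bar>\<^sup>2" using d by (intro power_mono) auto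
          then show ?thesis by (simp add: power_mult_distrib)
        qed
        then have "n\<^sup>2 * d\<^sup>2 * Tsum n x \<le> (Ssum n x)\<^sup>2 * (2 * \<sigma>2 * n)"
          using T \<sigma>2_pos by (intro mult_mono) auto
        then have "1 \<le> 2 * \<sigma>2 / (n * d\<^sup>2) * (studentized n x)\<^sup>2"
          using T n d by (simp add: studentized_def power_divide field_simps power2_eq_square)
        then have "tilt n x \<le> (2 * \<sigma>2 / (n * d\<^sup>2) * (studentized n x)\<^sup>2) * tilt n x"
          by (intro mult_le_cancel_right1[THEN iffD2]) (auto simp: tilt_def)
        then have "ennreal (tilt n x) \<le> ennreal (2 * \<sigma>2 / (n * d\<^sup>2)) * (ennreal ((studentized n x)\<^sup>2) * ennreal (tilt n x))"
          using \<sigma>2_pos by (simp add: ennreal_mult'[symmetric] ennreal_leI mult.assoc)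
        with w True show ?thesis by (auto intro: order_trans)
      next
        case False
        then have "ennreal (cw_weight g n x) * indicator (A n) x \<le> indicator B x * ennreal (tilt n x)"
          using w by (auto simp: indicator_def)
        then show ?thesis by (rule order_trans) simp
      qed
    qed
    also have "\<dots> = (\<integral>\<^sup>+ x. indicator B x * ennreal (tilt n x) \<partial>P n)
           + ennreal (2 * \<sigma>2 / (n * d\<^sup>2)) * (\<integral>\<^sup>+ x. ennreal ((studentized n x)\<^sup>2) * ennreal (tilt n x) \<partial>P n)"
      by (subst nn_integral_add) (auto simp: nn_integral_cmult)
    also have "\<dots> \<le> ennreal (root4 n * gauss_mass) * ennreal (V / (n * d\<^sup>2))
           + ennreal (2 * \<sigma>2 / (n * d\<^sup>2)) * ennreal (14 * gauss_mass * root4 n ^ 3)"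
    proof (intro add_mono mult_left_mono nn_integral_tilt_studentized_le n)
      \<comment> \<open>The same event as \<open>B\<close>, stripped of
        \<open>x \<in> space (P n)\<close>, because sign invariance is required at every
        function.\<close>
      let ?H = "\<lambda>x. indicator {x. \<bar>empirical_mean n (\<lambda>z. z\<^sup>2) x - expectation (\<lambda>z. z\<^sup>2)\<bar> \<ge> d} x :: ennreal"
      have [measurable]: "?H \<in> borel_measurable (P n)" by measurable
      have H: "indicator B x = ?H x" if "x \<in> space (P n)" for x
        using that by (auto simp: B_def indicator_def)
      have "(\<integral>\<^sup>+ x. indicator B x * ennreal (tilt n x) \<partial>P n) = (\<integral>\<^sup>+ x. ?H x * ennreal (tilt n x) \<partial>P n)"
        by (intro nn_integral_cong) (simp add: H)
      also have "\<dots> \<le> ennreal (root4 n * gauss_mass) * (\<integral>\<^sup>+ x. ?H x \<partial>P n)"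
        by (intro nn_integral_tilt_le n inv) measurable
      also have "(\<integral>\<^sup>+ x. ?H x \<partial>P n) = (\<integral>\<^sup>+ x. indicator B x \<partial>P n)"
        by (intro nn_integral_cong) (simp add: H)
      also have "\<dots> = ennreal (Pn.prob B)" by (simp add: Pn.emeasure_eq_measure)
      also have "ennreal (root4 n * gauss_mass) * ennreal (Pn.prob B) \<le> ennreal (root4 n * gauss_mass) * ennreal (V / (n * d\<^sup>2))"
        using PB by (intro mult_left_mono ennreal_leI) auto
      finally show "(\<integral>\<^sup>+ x. indicator B x * ennreal (tilt n x) \<partial>P n) \<le> \<dots>" .
    qed auto
    also have "\<dots> = ennreal (b n)"
    proof -
      have "0 \<le> root4 n * gauss_mass * (V / (n * d\<^sup>2))" "0 \<le> root4 n * gauss_mass" "0 \<le> V / (n * d\<^sup>2)"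
        "0 \<le> 2 * \<sigma>2 / (n * d\<^sup>2)" "0 \<le> 14 * gauss_mass * root4 n ^ 3"
        "0 \<le> 2 * \<sigma>2 / (n * d\<^sup>2) * (14 * gauss_mass * root4 n ^ 3)"
        using root4_pos[OF n] gauss_mass_pos V \<sigma>2_pos by simp_all
      then show ?thesis unfolding b_def by (simp only: ennreal_plus ennreal_mult)
    qed
    finally show ?thesis .
  qed
  have ev: "\<forall>\<^sub>F n in sequentially. norm (measure (mu_tilde \<rho> g n) (A n)) \<le> b n / c"
    using c(2) eventually_gt_at_top[of 0]
  proof eventually_elim
    case (elim n)
    have [measurable]: "A n \<in> sets (P n)" unfolding A_def dist_Pair_Pair dist_real_def by measurable
    have b0: "b n \<ge> 0" using root4_pos[of n] gauss_mass_pos V \<sigma>2_pos elim by (simp add: b_def)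
    have "emeasure (mu_tilde \<rho> g n) (A n) = (\<integral>\<^sup>+ x. ennreal (cw_weight g n x) / cw_Z \<rho> g n * indicator (A n) x \<partial>P n)"
      unfolding mu_tilde_def by (rule emeasure_density) auto
    also have "\<dots> \<le> (\<integral>\<^sup>+ x. ennreal (1 / c) * (ennreal (cw_weight g n x) * indicator (A n) x) \<partial>P n)"
    proof (intro nn_integral_mono)
      fix x
      have "cw_Z \<rho> g n < top"
        using cw_Z_le[of g n] g_le elim by (auto simp: less_top[symmetric] top_unique)
      then obtain z where z: "cw_Z \<rho> g n = ennreal z" "z \<ge> 0" by (cases "cw_Z \<rho> g n") auto
      with elim c(1) have zc: "c \<le> z" by simp
      then have "ennreal (cw_weight g n x) / cw_Z \<rho> g n = ennreal (cw_weight g n x / z)"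
        using c(1) z by (simp add: divide_ennreal cw_weight_nonneg)
      also have "\<dots> \<le> ennreal (1 / c * cw_weight g n x)"
        using c(1) zc frac_le[of "cw_weight g n x" "cw_weight g n x" c z] by (intro ennreal_leI) (simp add: cw_weight_nonneg)
      also have "\<dots> = ennreal (1 / c) * ennreal (cw_weight g n x)"
        using c(1) by (intro ennreal_mult') simp
      finally show "ennreal (cw_weight g n x) / cw_Z \<rho> g n * indicator (A n) x
        \<le> ennreal (1 / c) * (ennreal (cw_weight g n x) * indicator (A n) x)"
        by (simp add: mult.assoc[symmetric] mult_right_mono)
    qed
    also have "\<dots> = ennreal (1 / c) * (\<integral>\<^sup>+ x. ennreal (cw_weight g n x) * indicator (A n) x \<partial>P n)"
      by (rule nn_integral_cmult) measurable
    also have "\<dots> \<le> ennreal (1 / c) * ennreal (b n)"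
      using elim by (intro mult_left_mono bound) auto
    also have "\<dots> = ennreal (b n / c)" using c(1) by (simp add: ennreal_mult'[symmetric])
    finally show ?case using b0 c(1)
      by (simp add: measure_def enn2real_leI)
  qed
  have "(\<lambda>n. b n / c) \<longlonglongrightarrow> 0"
    unfolding b_def root4_def using d c(1) by real_asymp
  then have "(\<lambda>n. measure (mu_tilde \<rho> g n) (A n)) \<longlonglongrightarrow> 0"
    by (rule Lim_null_comparison[OF ev])
  then show ?thesis by (simp add: A_def mu_tilde_def)
qed

end

section \<open>Fluctuations\<close>

text \<open>Limits along this filter are limits as n tends to infinity, uniform over the n-th set.\<close>

definition along :: "(nat \<Rightarrow> 'a set) \<Rightarrow> (nat \<times> 'a) filter" where
  "along G = inf (filtercomap fst sequentially) (principal {p. snd p \<in> G (fst p)})"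

lemma eventually_along: "eventually R (along G) \<longleftrightarrow> (\<exists>N. \<forall>n\<ge>N. \<forall>x\<in>G n. R (n, x))"
proof
  assume "eventually R (along G)"
  then obtain Q N where Q: "\<forall>n\<ge>N. Q n" "\<And>p. Q (fst p) \<Longrightarrow> snd p \<in> G (fst p) \<Longrightarrow> R p"
    unfolding along_def eventually_inf_principal eventually_filtercomap eventually_sequentially by blast
  then show "\<exists>N. \<forall>n\<ge>N. \<forall>x\<in>G n. R (n, x)" by (intro exI[of _ N]) auto
next
  assume "\<exists>N. \<forall>n\<ge>N. \<forall>x\<in>G n. R (n, x)"
  then obtain N where N: "\<forall>n\<ge>N. \<forall>x\<in>G n. R (n, x)" ..
  show "eventually R (along G)"
    unfolding along_def eventually_inf_principal eventually_filtercomap eventually_sequentially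
  proof (intro exI[of _ "\<lambda>n. n \<ge> N"] conjI exI[of _ N] allI impI)
    fix p assume "N \<le> fst p" "p \<in> {p. snd p \<in> G (fst p)}"
    then show "R p" using N by (cases p) auto
  qed
qed

lemma eventually_alongI: "(\<And>n x. x \<in> G n \<Longrightarrow> R (n, x)) \<Longrightarrow> eventually R (along G)"
  by (auto simp: eventually_along)

lemma filterlim_fst_along: "filterlim fst sequentially (along G)"
  unfolding filterlim_iff eventually_along eventually_sequentially by auto

lemma tendsto_fst_along: "(f \<longlongrightarrow> l) sequentially \<Longrightarrow> ((\<lambda>p. f (fst p)) \<longlongrightarrow> l) (along G)"
  by (rule filterlim_compose[OF _ filterlim_fst_along])

lemma tendsto_along_close:
  fixes f :: "nat \<Rightarrow> 'a \<Rightarrow> real"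
  assumes "\<And>n x. x \<in> G n \<Longrightarrow> \<bar>f n x - l\<bar> \<le> d n" "d \<longlonglongrightarrow> 0"
  shows "((\<lambda>p. f (fst p) (snd p)) \<longlongrightarrow> l) (along G)"
proof (rule LIM_zero_cancel, rule Lim_null_comparison)
  show "\<forall>\<^sub>F p in along G. norm (f (fst p) (snd p) - l) \<le> d (fst p)"
    by (rule eventually_alongI) (simp add: assms)
  show "((\<lambda>p. d (fst p)) \<longlongrightarrow> 0) (along G)" by (rule tendsto_fst_along) fact
qed

lemma exp_Lipschitz_nonpos: "\<bar>exp a - exp b\<bar> \<le> \<bar>a - b\<bar>" if "a \<le> 0" "b \<le> 0" for a b :: real
proof -
  have *: "exp y - exp x \<le> y - x" if "x \<le> y" "y \<le> 0" for x y :: real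
  proof -
    have "exp y - exp x = exp y * (1 - exp (x - y))" by (simp add: algebra_simps exp_diff)
    also have "\<dots> \<le> 1 * (1 - exp (x - y))" using that by (intro mult_right_mono) auto
    also have "\<dots> \<le> y - x" unfolding mult_1_left using exp_ge_add_one_self[of "x - y"] by linarith
    finally show ?thesis .
  qed
  show ?thesis using *[of a b] *[of b a] that by (cases "a \<le> b") (auto simp: abs_if)
qed

text \<open>Three requirements fix the range of the exponent: \<open>tol\<close> must tend to 0, n *
  tol^2 to infinity (Chebyshev for the empirical moments) and sqrt n * tol^2 to infinity (Chebyshev
  for t - Y / n^(1/4)). Any n^(-c) with 0 < c < 1/4 would do; 1/8 is the midpoint.\<close>

definition tol :: "nat \<Rightarrow> real" where "tol n = real n powr (- 1 / 8)"

lemma tol_pos: "n > 0 \<Longrightarrow> tol n > 0" by (simp add: tol_def)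

lemma tol_tendsto: "tol \<longlonglongrightarrow> 0" unfolding tol_def by real_asymp

section \<open>The pointwise limit of the symmetrized tilt\<close>

context cw_law
begin

definition \<mu>4 :: real where "\<mu>4 = expectation (\<lambda>z. z ^ 4)"

text \<open>Nonnegativity of the variance of z^2; it makes the scaling factor of the theorem
  strictly positive.\<close>

lemma \<mu>4_ge: "\<sigma>2\<^sup>2 \<le> \<mu>4"
proof -
  have "0 \<le> variance (\<lambda>z. z\<^sup>2)" by simp
  also have "\<dots> = expectation (\<lambda>z. (z\<^sup>2)\<^sup>2) - \<sigma>2\<^sup>2"
    unfolding \<sigma>2_def by (intro variance_eq integrable_moments)
  finally show ?thesis by (simp add: \<mu>4_def power_mult[symmetric])
qed

text \<open>Second and fourth moments determine the limiting exponent; the sixth controls the error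
  term of \<open>prod_cosh_gauss_bounds\<close>.\<close>

definition typical :: "nat \<Rightarrow> (nat \<Rightarrow> real) set" where
  "typical n = {x \<in> space (P n). \<forall>f\<in>{\<lambda>z. z\<^sup>2, \<lambda>z. z ^ 4, \<lambda>z. z ^ 6}. \<bar>empirical_mean n f x - expectation f\<bar> < tol n}"

lemma sets_typical[measurable]: "typical n \<in> sets (P n)"
proof -
  have "typical n = (\<Inter>f\<in>{\<lambda>z. z\<^sup>2, \<lambda>z. z ^ 4, \<lambda>z. z ^ 6}. {x \<in> space (P n). \<bar>empirical_mean n f x - expectation f\<bar> < tol n})"
    by (auto simp: typical_def)
  then show ?thesis by simp
qed

lemma prob_atypical:
  "\<exists>V\<ge>0. \<forall>n>0. measure (P n) (space (P n) - typical n) \<le> V / (n * (tol n)\<^sup>2)"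
proof -
  define V where "V = variance (\<lambda>z. z\<^sup>2) + variance (\<lambda>z. z ^ 4) + variance (\<lambda>z. z ^ 6)"
  have "measure (P n) (space (P n) - typical n) \<le> V / (n * (tol n)\<^sup>2)" if n: "n > 0" for n
  proof -
    interpret Pn: prob_space "P n" by (rule prob_space_P)
    define B where "B = (\<lambda>f. {x \<in> space (P n). \<bar>empirical_mean n f x - expectation f\<bar> \<ge> tol n})"
    have [measurable]: "B f \<in> sets (P n)" if [measurable]: "f \<in> borel_measurable borel" for f
      unfolding B_def by measurable
    have "Pn.prob (space (P n) - typical n) \<le> Pn.prob (B (\<lambda>z. z\<^sup>2) \<union> B (\<lambda>z. z ^ 4) \<union> B (\<lambda>z. z ^ 6))"
      by (intro Pn.finite_measure_mono) (auto simp: typical_def B_def not_less)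
    also have "\<dots> \<le> Pn.prob (B (\<lambda>z. z\<^sup>2) \<union> B (\<lambda>z. z ^ 4)) + Pn.prob (B (\<lambda>z. z ^ 6))"
      by (intro measure_Un_le) auto
    also have "\<dots> \<le> Pn.prob (B (\<lambda>z. z\<^sup>2)) + Pn.prob (B (\<lambda>z. z ^ 4)) + Pn.prob (B (\<lambda>z. z ^ 6))"
      by (intro add_right_mono measure_Un_le) auto
    also have "\<dots> \<le> variance (\<lambda>z. z\<^sup>2) / (n * (tol n)\<^sup>2) + variance (\<lambda>z. z ^ 4) / (n * (tol n)\<^sup>2)
        + variance (\<lambda>z. z ^ 6) / (n * (tol n)\<^sup>2)"
      unfolding B_def
      by (intro add_mono empirical_mean_Chebyshev integrable_moments n tol_pos; simp)
    finally show ?thesis by (simp add: V_def add_divide_distrib)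
  qed
  moreover have "V \<ge> 0" by (simp add: V_def)
  ultimately show ?thesis by blast
qed

lemma prob_atypical_tendsto: "(\<lambda>n. measure (P n) (space (P n) - typical n)) \<longlonglongrightarrow> 0"
proof -
  obtain V where V: "\<forall>n>0. measure (P n) (space (P n) - typical n) \<le> V / (n * (tol n)\<^sup>2)"
    using prob_atypical by blast
  show ?thesis
  proof (rule Lim_null_comparison)
    show "\<forall>\<^sub>F n in sequentially. norm (measure (P n) (space (P n) - typical n)) \<le> V / (n * (tol n)\<^sup>2)"
      using eventually_gt_at_top[of 0] by eventually_elim (use V in simp)
    show "(\<lambda>n. V / (real n * (tol n)\<^sup>2)) \<longlonglongrightarrow> 0"
      unfolding tol_def by real_asymp
  qed
qed

lemma tendsto_empirical_mean_along:
  assumes "f \<in> {\<lambda>z. z\<^sup>2, \<lambda>z. z ^ 4, \<lambda>z. z ^ 6}"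
  shows "((\<lambda>p. empirical_mean (fst p) f (snd p)) \<longlongrightarrow> expectation f) (along typical)"
proof (rule tendsto_along_close[OF _ tol_tendsto])
  show "\<bar>empirical_mean n f x - expectation f\<bar> \<le> tol n" if "x \<in> typical n" for n x
    using that assms by (force simp: typical_def)
qed

text \<open>A bounded convergence theorem for functions living on different spaces
  \<open>P n\<close>: the integrand is uniformly close to d on \<open>typical n\<close>, and the
  uniform bound handles the rest, whose probability vanishes.\<close>

lemma expectation_tendsto_along:
  fixes F :: "nat \<Rightarrow> (nat \<Rightarrow> real) \<Rightarrow> real"
  assumes [measurable]: "\<And>n. F n \<in> borel_measurable (P n)"
    and K: "\<And>n x. n > 0 \<Longrightarrow> \<bar>F n x\<bar> \<le> K"
    and lim: "((\<lambda>p. F (fst p) (snd p)) \<longlongrightarrow> d) (along typical)"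
  shows "(\<lambda>n. \<integral>x. F n x \<partial>P n) \<longlonglongrightarrow> d"
proof (rule LIMSEQ_I)
  fix e :: real assume e: "e > 0"
  define C where "C = K + \<bar>d\<bar>"
  have "\<forall>\<^sub>F p in along typical. dist (F (fst p) (snd p)) d < e / 2"
    using lim e by (intro tendstoD) auto
  then obtain N where N: "\<And>n x. n \<ge> N \<Longrightarrow> x \<in> typical n \<Longrightarrow> \<bar>F n x - d\<bar> < e / 2"
    by (auto simp: eventually_along dist_real_def)
  have "((\<lambda>n. C * measure (P n) (space (P n) - typical n)) \<longlonglongrightarrow> C * 0)"
    by (intro tendsto_intros prob_atypical_tendsto)
  then have "\<forall>\<^sub>F n in sequentially. C * measure (P n) (space (P n) - typical n) < e / 2"
    using e by (intro order_tendstoD) auto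
  then obtain N' where N': "\<And>n. n \<ge> N' \<Longrightarrow> C * measure (P n) (space (P n) - typical n) < e / 2"
    by (auto simp: eventually_sequentially)
  show "\<exists>no. \<forall>n\<ge>no. norm ((\<integral>x. F n x \<partial>P n) - d) < e"
  proof (intro exI allI impI)
    fix n assume n: "n \<ge> max 1 (max N N')"
    then have n0: "n > 0" by simp
    interpret Pn: prob_space "P n" by (rule prob_space_P)
    have int: "integrable (P n) (F n)"
      by (rule Pn.integrable_const_bound[of _ K]) (auto simp: K n0)
    have "(\<integral>x. F n x \<partial>P n) - d = (\<integral>x. F n x - d \<partial>P n)"
      using int by (simp add: Pn.prob_space)
    also have "norm \<dots> \<le> (\<integral>x. norm (F n x - d) \<partial>P n)" by (rule integral_norm_bound)
    also have "\<dots> \<le> (\<integral>x. e / 2 + C * indicator (space (P n) - typical n) x \<partial>P n)"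
    proof (rule integral_mono)
      show "integrable (P n) (\<lambda>x. norm (F n x - d))" using int by auto
      show "integrable (P n) (\<lambda>x. e / 2 + C * indicator (space (P n) - typical n) x)"
        by (intro Bochner_Integration.integrable_add integrable_mult_right integrable_real_indicator)
           (auto simp: Pn.emeasure_eq_measure)
      fix x assume x: "x \<in> space (P n)"
      show "norm (F n x - d) \<le> e / 2 + C * indicator (space (P n) - typical n) x"
      proof (cases "x \<in> typical n")
        case True
        then show ?thesis using N[of n x] n by simp
      next
        case False
        then show ?thesis using K[OF n0, of x] x e by (simp add: C_def)
      qed
    qed
    also have "\<dots> = e / 2 + C * Pn.prob (space (P n) - typical n)"
      by (subst Bochner_Integration.integral_add) (auto simp: Pn.prob_space Pn.emeasure_eq_measure)
    also have "\<dots> < e" using N'[of n] n by simp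
    finally show "norm ((\<integral>x. F n x \<partial>P n) - d) < e" .
  qed
qed

text \<open>Write T = q n. For a_i = r t x_i / sqrt T, r^4 = n makes the sum of the a_i^4 free of n,
  whereas the sum of the a_i^6 keeps a factor 1 / r^2 and disappears in the limit.\<close>

lemma symmetrized_tilt_bounds:
  fixes n x t
  defines "q \<equiv> empirical_mean n (\<lambda>z. z\<^sup>2) x" and "m \<equiv> empirical_mean n (\<lambda>z. z ^ 4) x"
    and "k \<equiv> empirical_mean n (\<lambda>z. z ^ 6) x"
  assumes n: "n > 0" and q: "q > 0"
  shows "exp (- (t ^ 4) * m / q\<^sup>2 / 12) / sqrt (2 * pi) \<le> symmetrized_tilt n x (root4 n * t)"
    and "symmetrized_tilt n x (root4 n * t)
      \<le> exp (- (t ^ 4) * m / q\<^sup>2 / 12 + t ^ 6 * k / (q ^ 3 * (root4 n)\<^sup>2) / 12) / sqrt (2 * pi)"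
proof -
  define r where "r = root4 n"
  have r: "r > 0" "r ^ 4 = n" using root4_pos[OF n] root4_pow4[of n] by (simp_all add: r_def)
  define T where "T = Tsum n x"
  have Tq: "T = q * n" using n by (simp add: q_def T_def empirical_mean_square)
  then have T: "T > 0" using q n by simp
  define a where "a = (\<lambda>i. r * t / sqrt T * x i)"
  have sq: "(\<Sum>i<n. (a i)\<^sup>2) = (r * t)\<^sup>2"
    using sum_scaled_squares[of n x "r * t"] T by (simp add: a_def T_def)
  have D: "symmetrized_tilt n x (root4 n * t) = (\<Prod>i<n. cosh (a i)) * exp (- (r * t)\<^sup>2 / 2) / sqrt (2 * pi)"
    using T by (simp add: symmetrized_tilt_def a_def r_def T_def)
  have s4: "sqrt T ^ 4 = T\<^sup>2" "sqrt T ^ 6 = T ^ 3"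
    using T power_mult[of "sqrt T" 2 2] power_mult[of "sqrt T" 2 3] by simp_all
  have sum4: "(\<Sum>i<n. (a i) ^ 4) = t ^ 4 * m / q\<^sup>2"
  proof -
    have "(\<Sum>i<n. (a i) ^ 4) = r ^ 4 * t ^ 4 / T\<^sup>2 * (m * n)"
      using n by (simp add: a_def power_mult_distrib power_divide s4 sum_distrib_left[symmetric]
          sum_divide_distrib[symmetric] m_def empirical_mean_def)
    also have "\<dots> = t ^ 4 * m / q\<^sup>2" using n q by (simp add: r(2) Tq field_simps power2_eq_square)
    finally show ?thesis .
  qed
  have sum6: "(\<Sum>i<n. (a i) ^ 6) = t ^ 6 * k / (q ^ 3 * r\<^sup>2)"
  proof -
    have "(\<Sum>i<n. (a i) ^ 6) = r ^ 6 * t ^ 6 / T ^ 3 * (k * n)"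
      using n by (simp add: a_def power_mult_distrib power_divide s4 sum_distrib_left[symmetric]
          sum_divide_distrib[symmetric] k_def empirical_mean_def)
    also have "\<dots> = t ^ 6 * k / (q ^ 3 * r\<^sup>2)"
      unfolding Tq r(2)[symmetric] using q r(1) by (simp add: field_simps power_numeral_reduce)
    finally show ?thesis .
  qed
  from prod_cosh_gauss_bounds[OF sq] show
    "exp (- (t ^ 4) * m / q\<^sup>2 / 12) / sqrt (2 * pi) \<le> symmetrized_tilt n x (root4 n * t)"
    "symmetrized_tilt n x (root4 n * t)
      \<le> exp (- (t ^ 4) * m / q\<^sup>2 / 12 + t ^ 6 * k / (q ^ 3 * (root4 n)\<^sup>2) / 12) / sqrt (2 * pi)"
    unfolding D sum4 sum6 by (simp_all add: divide_right_mono r_def)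
qed

text \<open>Not normalized: its mass is that of the limit of \<open>Q\<close>, and it drops out of
  the final quotient.\<close>

definition limit_density :: "real \<Rightarrow> real" where
  "limit_density t = exp (- (t ^ 4) * \<mu>4 / \<sigma>2\<^sup>2 / 12) / sqrt (2 * pi)"

lemma gauss_bound_le: "gauss_bound t \<le> exp (1 / 12)"
proof -
  have "exp (1 / 12 - t\<^sup>2 / 12) / sqrt (2 * pi) \<le> exp (1 / 12) / 1"
    using pi_ge_two by (intro frac_le) (auto intro!: real_le_rsqrt)
  then show ?thesis by (simp add: gauss_bound_eq)
qed

lemma expectation_symmetrized_tilt:
  "(\<lambda>n. \<integral>x. symmetrized_tilt n x (root4 n * t) \<partial>P n) \<longlonglongrightarrow> limit_density t"
proof (rule expectation_tendsto_along)
  show "\<bar>symmetrized_tilt n x (root4 n * t)\<bar> \<le> exp (1 / 12)" if "n > 0" for n x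
    using symmetrized_tilt_le[OF root4_ge_1[OF that] root4_pow4, of x t] symmetrized_tilt_nonneg[of n x "root4 n * t"]
      gauss_bound_le[of t] by simp
  define q where "q = (\<lambda>p::nat \<times> (nat \<Rightarrow> real). empirical_mean (fst p) (\<lambda>z. z\<^sup>2) (snd p))"
  define m where "m = (\<lambda>p::nat \<times> (nat \<Rightarrow> real). empirical_mean (fst p) (\<lambda>z. z ^ 4) (snd p))"
  define k where "k = (\<lambda>p::nat \<times> (nat \<Rightarrow> real). empirical_mean (fst p) (\<lambda>z. z ^ 6) (snd p))"
  have lim: "(q \<longlongrightarrow> \<sigma>2) (along typical)" "(m \<longlongrightarrow> \<mu>4) (along typical)"
    "(k \<longlongrightarrow> expectation (\<lambda>z. z ^ 6)) (along typical)"
    unfolding q_def m_def k_def \<sigma>2_def \<mu>4_def by (intro tendsto_empirical_mean_along; simp)+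
  have "(\<lambda>n. 1 / (root4 n)\<^sup>2) \<longlonglongrightarrow> 0" unfolding root4_def by real_asymp
  then have r: "((\<lambda>p. 1 / (root4 (fst p))\<^sup>2) \<longlongrightarrow> 0) (along typical)" by (rule tendsto_fst_along)
  have s0: "\<sigma>2 \<noteq> 0" using \<sigma>2_pos by simp
  have low: "((\<lambda>p. exp (- (t ^ 4) * m p / (q p)\<^sup>2 / 12) / sqrt (2 * pi)) \<longlongrightarrow> limit_density t) (along typical)"
    unfolding limit_density_def by (intro tendsto_intros lim) (use s0 in auto)
  have "((\<lambda>p. exp (- (t ^ 4) * m p / (q p)\<^sup>2 / 12 + t ^ 6 * k p / (q p) ^ 3 * (1 / (root4 (fst p))\<^sup>2) / 12) / sqrt (2 * pi))
      \<longlongrightarrow> exp (- (t ^ 4) * \<mu>4 / \<sigma>2\<^sup>2 / 12 + t ^ 6 * expectation (\<lambda>z. z ^ 6) / \<sigma>2 ^ 3 * 0 / 12) / sqrt (2 * pi)) (along typical)"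
    by (intro tendsto_intros lim r) (use s0 in auto)
  then have up: "((\<lambda>p. exp (- (t ^ 4) * m p / (q p)\<^sup>2 / 12 + t ^ 6 * k p / ((q p) ^ 3 * (root4 (fst p))\<^sup>2) / 12) / sqrt (2 * pi))
      \<longlongrightarrow> limit_density t) (along typical)"
    by (simp add: limit_density_def)
  have "\<forall>\<^sub>F p in along typical. fst p > 0"
    using eventually_gt_at_top[of 0] filterlim_fst_along by (rule eventually_compose_filterlim)
  moreover have "\<forall>\<^sub>F p in along typical. q p > 0" using lim(1) \<sigma>2_pos by (rule order_tendstoD)
  ultimately have ev: "\<forall>\<^sub>F p in along typical. fst p > 0 \<and> q p > 0" by eventually_elim simp
  show "((\<lambda>p. symmetrized_tilt (fst p) (snd p) (root4 (fst p) * t)) \<longlongrightarrow> limit_density t) (along typical)"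
  proof (rule tendsto_sandwich[OF _ _ low up])
    show "\<forall>\<^sub>F p in along typical. exp (- (t ^ 4) * m p / (q p)\<^sup>2 / 12) / sqrt (2 * pi)
        \<le> symmetrized_tilt (fst p) (snd p) (root4 (fst p) * t)"
      using ev by eventually_elim (unfold q_def m_def, intro symmetrized_tilt_bounds(1), auto)
    show "\<forall>\<^sub>F p in along typical. symmetrized_tilt (fst p) (snd p) (root4 (fst p) * t)
      \<le> exp (- (t ^ 4) * m p / (q p)\<^sup>2 / 12 + t ^ 6 * k p / ((q p) ^ 3 * (root4 (fst p))\<^sup>2) / 12) / sqrt (2 * pi)"
      using ev by eventually_elim (unfold q_def m_def k_def, intro symmetrized_tilt_bounds(2), auto)
  qed
qed measurable

text \<open>The t-marginal of \<open>Q n\<close> has a density, the averaged symmetrized tilt. It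
  converges pointwise and lies below \<open>gauss_bound\<close> for every positive n, so dominated
  convergence on the real line applies.\<close>

lemma integral_Q_tendsto:
  fixes \<psi> :: "real \<Rightarrow> real"
  assumes [measurable]: "\<psi> \<in> borel_measurable borel" and psi: "\<And>t. 0 \<le> \<psi> t" "\<And>t. \<psi> t \<le> 1"
  shows "(\<lambda>n. \<integral>p. \<psi> (snd p) \<partial>Q n) \<longlonglongrightarrow> (\<integral>t. \<psi> t * limit_density t \<partial>lborel)"
proof -
  define E where "E = (\<lambda>n t. \<integral>x. symmetrized_tilt n x (root4 n * t) \<partial>P n)"
  have [measurable]: "E n \<in> borel_measurable borel" for n
  proof -
    interpret Pn: prob_space "P n" by (rule prob_space_P)
    have [measurable]: "(\<lambda>p. symmetrized_tilt n (snd p) (root4 n * fst p)) \<in> borel_measurable (borel \<Otimes>\<^sub>M P n)"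
      unfolding symmetrized_tilt_def by measurable
    show ?thesis unfolding E_def
      by (rule Pn.borel_measurable_lebesgue_integral) (simp add: case_prod_beta')
  qed
  have intg: "integrable (P n) (\<lambda>x. symmetrized_tilt n x (root4 n * t))" if "n > 0" for n t
  proof -
    interpret Pn: prob_space "P n" by (rule prob_space_P)
    show ?thesis
      using symmetrized_tilt_le[OF root4_ge_1[OF that] root4_pow4] symmetrized_tilt_nonneg
      by (intro Pn.integrable_const_bound[of _ "gauss_bound t"]) (auto simp: abs_of_nonneg)
  qed
  have E: "0 \<le> E n t" "E n t \<le> gauss_bound t" if "n > 0" for n t
  proof -
    interpret Pn: prob_space "P n" by (rule prob_space_P)
    show "0 \<le> E n t" unfolding E_def by (intro Bochner_Integration.integral_nonneg symmetrized_tilt_nonneg)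
    show "E n t \<le> gauss_bound t" unfolding E_def
      using integral_mono[OF intg[OF that, of t], of "\<lambda>_. gauss_bound t"]
        symmetrized_tilt_le[OF root4_ge_1[OF that] root4_pow4]
      by (simp add: Pn.prob_space)
  qed
  have eq: "(\<integral>p. \<psi> (snd p) \<partial>Q n) = (\<integral>t. \<psi> t * E n t \<partial>lborel)" if n: "n > 0" for n
  proof -
    have "(\<integral>\<^sup>+ p. ennreal (\<psi> (snd p)) * 1 \<partial>Q n)
        = (\<integral>\<^sup>+ t. ennreal (\<psi> t) * (\<integral>\<^sup>+ x. 1 * ennreal (symmetrized_tilt n x (root4 n * t)) \<partial>P n) \<partial>lborel)"
      by (rule nn_integral_Q_prod) (auto simp: sign_invariant_const)
    also have "\<dots> = (\<integral>\<^sup>+ t. ennreal (\<psi> t * E n t) \<partial>lborel)"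
      unfolding E_def using psi
      by (intro nn_integral_cong)
         (simp add: nn_integral_eq_integral[OF intg[OF n]] symmetrized_tilt_nonneg ennreal_mult')
    finally have "(\<integral>\<^sup>+ p. ennreal (\<psi> (snd p)) \<partial>Q n) = (\<integral>\<^sup>+ t. ennreal (\<psi> t * E n t) \<partial>lborel)" by simp
    then show ?thesis
      using psi E[OF n] by (subst (1 2) integral_eq_nn_integral) auto
  qed
  \<comment> \<open>The index is shifted because the bounds on \<open>E\<close> are stated for n >
    0.\<close>
  have "(\<lambda>n. \<integral>t. \<psi> t * E (Suc n) t \<partial>lborel) \<longlonglongrightarrow> (\<integral>t. \<psi> t * limit_density t \<partial>lborel)"
  proof (rule integral_dominated_convergence)
    show "integrable lborel gauss_bound"
      unfolding gauss_bound_def[abs_def] by auto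
    show "AE t in lborel. (\<lambda>n. \<psi> t * E (Suc n) t) \<longlonglongrightarrow> \<psi> t * limit_density t"
      unfolding E_def using expectation_symmetrized_tilt[THEN LIMSEQ_Suc] by (intro AE_I2 tendsto_intros)
    show "AE t in lborel. norm (\<psi> t * E (Suc n) t) \<le> gauss_bound t" for n
    proof (rule AE_I2)
      fix t
      have "\<psi> t * E (Suc n) t \<le> 1 * gauss_bound t" using psi E[of "Suc n" t] by (intro mult_mono) auto
      then show "norm (\<psi> t * E (Suc n) t) \<le> gauss_bound t" using psi E[of "Suc n" t] by simp
    qed
  qed (auto simp: limit_density_def)
  then have "(\<lambda>n. \<integral>p. \<psi> (snd p) \<partial>Q (Suc n)) \<longlonglongrightarrow> (\<integral>t. \<psi> t * limit_density t \<partial>lborel)"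
    by (simp add: eq)
  then show ?thesis by (rule LIMSEQ_imp_Suc)
qed

end

text \<open>Neither \<open>A\<close> nor \<open>B\<close> need converge, hence uniform rather than
  pointwise continuity.\<close>

lemma uniformly_continuous_tendsto_diff:
  fixes \<phi> :: "real \<Rightarrow> real"
  assumes "uniformly_continuous_on UNIV \<phi>" "((\<lambda>x. A x - B x) \<longlongrightarrow> 0) F"
  shows "((\<lambda>x. \<phi> (A x) - \<phi> (B x)) \<longlongrightarrow> 0) F"
proof (rule tendstoI)
  fix e :: real assume "e > 0"
  then obtain d where d: "d > 0" "\<And>x y. dist x y < d \<Longrightarrow> dist (\<phi> x) (\<phi> y) < e"
    using assms(1) unfolding uniformly_continuous_on_def by (metis UNIV_I)
  have "\<forall>\<^sub>F x in F. dist (A x - B x) 0 < d" using assms(2) d(1) by (rule tendstoD)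
  then show "\<forall>\<^sub>F x in F. dist (\<phi> (A x) - \<phi> (B x)) 0 < e"
    by eventually_elim (use d(2) in \<open>auto simp: dist_real_def\<close>)
qed

lemma quartic_diff_le:
  fixes s t K :: real
  assumes "\<bar>s\<bar> \<le> K" "\<bar>t\<bar> \<le> K"
  shows "\<bar>s ^ 4 - t ^ 4\<bar> \<le> 4 * K ^ 3 * \<bar>s - t\<bar>"
proof -
  have K: "0 \<le> K" using assms by linarith
  have sq: "s\<^sup>2 \<le> K\<^sup>2" "t\<^sup>2 \<le> K\<^sup>2" using assms by (auto simp: abs_le_square_iff[symmetric])
  have "\<bar>s ^ 4 - t ^ 4\<bar> = \<bar>s - t\<bar> * (\<bar>s + t\<bar> * (s\<^sup>2 + t\<^sup>2))"
  proof -
    have "s ^ 4 - t ^ 4 = (s - t) * ((s + t) * (s\<^sup>2 + t\<^sup>2))"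
      by (simp add: algebra_simps power_numeral_reduce)
    then show ?thesis by (simp add: abs_mult abs_of_nonneg)
  qed
  also have "\<dots> \<le> \<bar>s - t\<bar> * ((2 * K) * (2 * K\<^sup>2))"
    using assms sq K by (intro mult_left_mono mult_mono) auto
  also have "\<dots> = 4 * K ^ 3 * \<bar>s - t\<bar>" by (simp add: power_numeral_reduce)
  finally show ?thesis .
qed

section \<open>From the smoothing variable to the rescaled sum\<close>

context cw_law
begin

text \<open>The exponential is the quotient of \<open>cw_weight\<close> by \<open>tilt\<close> (see
  \<open>tilted_test_tilt\<close>). It is at most 1 when g u \<le> u^2 / 2, so the unbounded part of
  the weight stays inside \<open>Q\<close>.\<close>

definition tilted_test :: "(real \<Rightarrow> real) \<Rightarrow> real \<Rightarrow> (real \<Rightarrow> real) \<Rightarrow> nat \<Rightarrow> (nat \<Rightarrow> real) \<Rightarrow> real" where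
  "tilted_test g a \<phi> n x = \<phi> (a * Ssum n x / root4 n ^ 3)
     * exp (real n * (g (Ssum n x / sqrt (real n * Tsum n x)) - (Ssum n x / sqrt (real n * Tsum n x))\<^sup>2 / 2))"

text \<open>What \<open>tilted_test\<close> becomes when Y / n^(1/4) is replaced by t and T / n by
  \<open>\<sigma>2\<close>; in the application \<kappa> is m4 / 12.\<close>

definition limit_test :: "real \<Rightarrow> real \<Rightarrow> (real \<Rightarrow> real) \<Rightarrow> real \<Rightarrow> real" where
  "limit_test \<kappa> a \<phi> t = \<phi> (a * sqrt \<sigma>2 * t) * exp (- (\<kappa> * t ^ 4))"

lemma measurable_tilted_test[measurable]:
  assumes [measurable]: "g \<in> borel_measurable borel" "\<phi> \<in> borel_measurable borel"
  shows "tilted_test g a \<phi> n \<in> borel_measurable (P n)"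
  unfolding tilted_test_def[abs_def] by measurable

lemma measurable_limit_test[measurable]:
  assumes [measurable]: "\<phi> \<in> borel_measurable borel"
  shows "limit_test \<kappa> a \<phi> \<in> borel_measurable borel"
  unfolding limit_test_def[abs_def] by measurable

lemma tilted_test_tilt:
  assumes "n > 0"
  shows "tilted_test g a \<phi> n x * tilt n x = \<phi> (a * Ssum n x / root4 n ^ 3) * cw_weight g n x"
proof (cases "Tsum n x > 0")
  case True
  then have "real n * (Ssum n x / sqrt (real n * Tsum n x))\<^sup>2 = (studentized n x)\<^sup>2"
    using assms by (simp add: studentized_def power_divide)
  then have "exp (real n * (g (Ssum n x / sqrt (real n * Tsum n x)) - (Ssum n x / sqrt (real n * Tsum n x))\<^sup>2 / 2))
    * exp ((studentized n x)\<^sup>2 / 2) = exp (real n * g (Ssum n x / sqrt (real n * Tsum n x)))"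
    unfolding exp_add[symmetric] by (simp add: algebra_simps)
  then show ?thesis using True by (simp add: tilted_test_def tilt_def cw_weight_def)
qed (simp add: tilt_def cw_weight_def)

context
  fixes g \<phi> :: "real \<Rightarrow> real" and \<kappa> a :: real
  assumes g_meas[measurable]: "g \<in> borel_measurable borel"
    and g_le: "\<And>u. g u \<le> u\<^sup>2 / 2"
    and g0: "g 0 = 0"
    and g4: "((\<lambda>u. (g u - u\<^sup>2 / 2) / u ^ 4) \<longlongrightarrow> - \<kappa>) (at 0)"
    and kappa: "\<kappa> \<ge> 0"
    and phi_cont: "uniformly_continuous_on UNIV \<phi>"
    and phi_bound: "\<And>y. 0 \<le> \<phi> y" "\<And>y. \<phi> y \<le> 1"
begin

lemma phi_meas: "\<phi> \<in> borel_measurable borel"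
  by (intro borel_measurable_continuous_onI uniformly_continuous_imp_continuous phi_cont)

lemma tilted_test_bounds: "0 \<le> tilted_test g a \<phi> n x" "tilted_test g a \<phi> n x \<le> 1"
proof -
  have "real n * (g (Ssum n x / sqrt (real n * Tsum n x)) - (Ssum n x / sqrt (real n * Tsum n x))\<^sup>2 / 2) \<le> 0"
    using g_le by (intro mult_nonneg_nonpos) auto
  then show "0 \<le> tilted_test g a \<phi> n x" "tilted_test g a \<phi> n x \<le> 1"
    unfolding tilted_test_def using phi_bound by (auto intro!: mult_le_one)
qed

lemma limit_test_bounds: "0 \<le> limit_test \<kappa> a \<phi> t" "limit_test \<kappa> a \<phi> t \<le> 1"
  unfolding limit_test_def using phi_bound kappa by (auto intro!: mult_le_one)

text \<open>Bounding t by \<open>K\<close> is essential: the quartic term and the product of Y /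
  n^(1/4) with sqrt (T / n) are controlled only for bounded t.\<close>

definition close :: "real \<Rightarrow> nat \<Rightarrow> ((nat \<Rightarrow> real) \<times> real) set" where
  "close K n = {p. \<bar>empirical_mean n (\<lambda>z. z\<^sup>2) (fst p) - \<sigma>2\<bar> \<le> tol n
     \<and> \<bar>studentized n (fst p) / root4 n - snd p\<bar> \<le> tol n \<and> \<bar>snd p\<bar> \<le> K}"

text \<open>On \<open>close K\<close> the variable t is bounded but has no limit, so differences are
  shown to vanish: of the arguments of \<phi> (\<open>AB\<close>) and of the exponents
  (\<open>CD\<close>). Uniform continuity and the Lipschitz bound for exp on nonpositive reals then
  combine them.\<close>

lemma tilted_test_close:
  "((\<lambda>w. tilted_test g a \<phi> (fst w) (fst (snd w)) - limit_test \<kappa> a \<phi> (snd (snd w))) \<longlongrightarrow> 0) (along (close K))"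
proof -
  let ?F = "along (close K)"
  define q where "q = (\<lambda>w::nat \<times> (nat \<Rightarrow> real) \<times> real. empirical_mean (fst w) (\<lambda>z. z\<^sup>2) (fst (snd w)))"
  define \<tau> where "\<tau> = (\<lambda>w::nat \<times> (nat \<Rightarrow> real) \<times> real. studentized (fst w) (fst (snd w)) / root4 (fst w))"
  define t where "t = (\<lambda>w::nat \<times> (nat \<Rightarrow> real) \<times> real. snd (snd w))"
  define u where "u = (\<lambda>w. \<tau> w / root4 (fst w))"
  have q: "(q \<longlongrightarrow> \<sigma>2) ?F"
    unfolding q_def by (rule tendsto_along_close[OF _ tol_tendsto]) (simp add: close_def)
  have \<tau>t: "((\<lambda>w. \<tau> w - t w) \<longlongrightarrow> 0) ?F"
    unfolding \<tau>_def t_def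
    by (rule tendsto_along_close[where f = "\<lambda>n p. studentized n (fst p) / root4 n - snd p", OF _ tol_tendsto])
       (simp add: close_def)
  have pos: "\<forall>\<^sub>F w in ?F. fst w > 0"
    using eventually_gt_at_top[of 0] filterlim_fst_along by (rule eventually_compose_filterlim)
  have qpos: "\<forall>\<^sub>F w in ?F. q w > 0" using q \<sigma>2_pos by (rule order_tendstoD)
  have t_le: "\<forall>\<^sub>F w in ?F. \<bar>t w\<bar> \<le> K" by (rule eventually_alongI) (simp add: t_def close_def)
  have "\<forall>\<^sub>F w in ?F. dist (\<tau> w - t w) 0 < 1" by (rule tendstoD[OF \<tau>t]) simp
  with t_le have bounded: "\<forall>\<^sub>F w in ?F. \<bar>t w\<bar> \<le> K + 1 \<and> \<bar>\<tau> w\<bar> \<le> K + 1"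
    by eventually_elim (auto simp: dist_real_def)
  define A where "A = (\<lambda>w::nat \<times> (nat \<Rightarrow> real) \<times> real. a * Ssum (fst w) (fst (snd w)) / root4 (fst w) ^ 3)"
  define B where "B = (\<lambda>w. a * sqrt \<sigma>2 * t w)"
  define C where "C = (\<lambda>w. real (fst w) * (g (u w) - (u w)\<^sup>2 / 2))"
  \<comment> \<open>Since S = Y sqrt T and \<tau> = Y / n^(1/4), the argument of \<open>g\<close> is
    Y / sqrt n = \<tau> / n^(1/4), and S / n^(3/4) = \<tau> sqrt (T / n).\<close>
  have scaling: "\<forall>\<^sub>F w in ?F. Ssum (fst w) (fst (snd w)) / sqrt (real (fst w) * Tsum (fst w) (fst (snd w))) = u w
      \<and> A w = a * \<tau> w * sqrt (q w)"
    using pos qpos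
  proof eventually_elim
    case (elim w)
    define r where "r = root4 (fst w)"
    have r: "r > 0" "r ^ 4 = real (fst w)" using root4_pos elim root4_pow4 by (auto simp: r_def)
    have T: "Tsum (fst w) (fst (snd w)) = q w * real (fst w)"
      using elim by (simp add: q_def empirical_mean_square)
    have sn: "sqrt (real (fst w)) = r\<^sup>2"
      using r by (intro real_sqrt_unique) auto
    have sq: "sqrt (q w) > 0" using elim by simp
    show ?case
      using r(1) sq unfolding u_def \<tau>_def A_def studentized_def T real_sqrt_mult sn r_def[symmetric]
      by (auto simp: divide_simps power_numeral_reduce)
  qed
  have AB: "((\<lambda>w. A w - B w) \<longlongrightarrow> 0) ?F"
  proof (rule Lim_null_comparison)
    show "\<forall>\<^sub>F w in ?F. norm (A w - B w) \<le> \<bar>a\<bar> * ((K + 1) * \<bar>sqrt (q w) - sqrt \<sigma>2\<bar>) + \<bar>a\<bar> * sqrt \<sigma>2 * \<bar>\<tau> w - t w\<bar>"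
      using scaling bounded
    proof eventually_elim
      case (elim w)
      have "A w - B w = a * (\<tau> w * (sqrt (q w) - sqrt \<sigma>2)) + a * sqrt \<sigma>2 * (\<tau> w - t w)"
        using elim by (simp add: B_def algebra_simps)
      also have "norm \<dots> \<le> \<bar>a\<bar> * (\<bar>\<tau> w\<bar> * \<bar>sqrt (q w) - sqrt \<sigma>2\<bar>) + \<bar>a\<bar> * sqrt \<sigma>2 * \<bar>\<tau> w - t w\<bar>"
        using \<sigma>2_pos by (intro norm_triangle_le) (simp add: abs_mult)
      also have "\<dots> \<le> \<bar>a\<bar> * ((K + 1) * \<bar>sqrt (q w) - sqrt \<sigma>2\<bar>) + \<bar>a\<bar> * sqrt \<sigma>2 * \<bar>\<tau> w - t w\<bar>"
        using elim by (intro add_right_mono mult_left_mono mult_right_mono) auto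
      finally show ?case .
    qed
    have "((\<lambda>w. \<bar>a\<bar> * ((K + 1) * \<bar>sqrt (q w) - sqrt \<sigma>2\<bar>) + \<bar>a\<bar> * sqrt \<sigma>2 * \<bar>\<tau> w - t w\<bar>)
        \<longlongrightarrow> \<bar>a\<bar> * ((K + 1) * \<bar>sqrt \<sigma>2 - sqrt \<sigma>2\<bar>) + \<bar>a\<bar> * sqrt \<sigma>2 * \<bar>0\<bar>) ?F"
      by (intro tendsto_intros q \<tau>t)
    then show "((\<lambda>w. \<bar>a\<bar> * ((K + 1) * \<bar>sqrt (q w) - sqrt \<sigma>2\<bar>) + \<bar>a\<bar> * sqrt \<sigma>2 * \<bar>\<tau> w - t w\<bar>) \<longlongrightarrow> 0) ?F"
      by simp
  qed
  \<comment> \<open>The relative remainder of \<open>g\<close>, extended by 0 at the origin so as to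
    be continuous there: u may take the value 0, where \<open>g_e\<close> rests on g 0 = 0.\<close>
  define e where "e = (\<lambda>v. if v = 0 then 0 else (g v - v\<^sup>2 / 2) / v ^ 4 + \<kappa>)"
  have g_e: "g v - v\<^sup>2 / 2 = v ^ 4 * (e v - \<kappa>)" for v
    by (cases "v = 0") (simp_all add: e_def g0)
  have "((\<lambda>v. (g v - v\<^sup>2 / 2) / v ^ 4 + \<kappa>) \<longlongrightarrow> - \<kappa> + \<kappa>) (at 0)" by (intro tendsto_intros g4)
  then have "((\<lambda>v. (g v - v\<^sup>2 / 2) / v ^ 4 + \<kappa>) \<longlongrightarrow> 0) (at 0)" by simp
  then have "(e \<longlongrightarrow> 0) (at 0)"
    by (rule Lim_transform_eventually) (auto simp: e_def eventually_at_filter)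
  then have "isCont e 0" by (simp add: isCont_def e_def)
  moreover have "(u \<longlongrightarrow> 0) ?F"
  proof (rule Lim_null_comparison)
    show "\<forall>\<^sub>F w in ?F. norm (u w) \<le> (K + 1) * (1 / root4 (fst w))"
      using bounded pos
      by eventually_elim (auto simp: u_def abs_mult abs_divide root4_pos less_imp_le divide_right_mono)
    have "(\<lambda>n. 1 / root4 n) \<longlonglongrightarrow> 0" unfolding root4_def by real_asymp
    then have "((\<lambda>w. (K + 1) * (1 / root4 (fst w))) \<longlongrightarrow> (K + 1) * 0) ?F"
      by (intro tendsto_intros tendsto_fst_along)
    then show "((\<lambda>w. (K + 1) * (1 / root4 (fst w))) \<longlongrightarrow> 0) ?F" by simp
  qed
  ultimately have eu: "((\<lambda>w. e (u w)) \<longlongrightarrow> 0) ?F"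
    using isCont_tendsto_compose[of 0 e u ?F] by (simp add: e_def)
  have CD: "((\<lambda>w. C w - (- (\<kappa> * t w ^ 4))) \<longlongrightarrow> 0) ?F"
  proof (rule Lim_null_comparison)
    show "\<forall>\<^sub>F w in ?F. norm (C w - (- (\<kappa> * t w ^ 4)))
        \<le> (K + 1) ^ 4 * \<bar>e (u w)\<bar> + \<kappa> * (4 * (K + 1) ^ 3 * \<bar>\<tau> w - t w\<bar>)"
      using bounded pos
    proof eventually_elim
      case (elim w)
      have "real (fst w) * u w ^ 4 = \<tau> w ^ 4"
        using root4_pow4[of "fst w"] elim by (simp add: u_def power_divide)
      then have "C w = \<tau> w ^ 4 * (e (u w) - \<kappa>)" unfolding C_def g_e by (simp flip: mult.assoc)
      then have "C w - (- (\<kappa> * t w ^ 4)) = \<tau> w ^ 4 * e (u w) + - \<kappa> * (\<tau> w ^ 4 - t w ^ 4)"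
        by (simp add: algebra_simps)
      also have "norm \<dots> \<le> \<bar>\<tau> w\<bar> ^ 4 * \<bar>e (u w)\<bar> + \<kappa> * \<bar>\<tau> w ^ 4 - t w ^ 4\<bar>"
        using kappa by (intro norm_triangle_le) (simp add: abs_mult power_abs)
      also have "\<dots> \<le> (K + 1) ^ 4 * \<bar>e (u w)\<bar> + \<kappa> * (4 * (K + 1) ^ 3 * \<bar>\<tau> w - t w\<bar>)"
        using elim kappa by (intro add_mono mult_right_mono mult_left_mono power_mono quartic_diff_le) auto
      finally show ?case .
    qed
    have "((\<lambda>w. (K + 1) ^ 4 * \<bar>e (u w)\<bar> + \<kappa> * (4 * (K + 1) ^ 3 * \<bar>\<tau> w - t w\<bar>))
        \<longlongrightarrow> (K + 1) ^ 4 * \<bar>0\<bar> + \<kappa> * (4 * (K + 1) ^ 3 * \<bar>0\<bar>)) ?F"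
      by (intro tendsto_intros eu \<tau>t)
    then show "((\<lambda>w. (K + 1) ^ 4 * \<bar>e (u w)\<bar> + \<kappa> * (4 * (K + 1) ^ 3 * \<bar>\<tau> w - t w\<bar>)) \<longlongrightarrow> 0) ?F" by simp
  qed
  show ?thesis
  proof (rule Lim_null_comparison)
    show "\<forall>\<^sub>F w in ?F. norm (tilted_test g a \<phi> (fst w) (fst (snd w)) - limit_test \<kappa> a \<phi> (snd (snd w)))
        \<le> \<bar>\<phi> (A w) - \<phi> (B w)\<bar> + \<bar>C w - (- (\<kappa> * t w ^ 4))\<bar>"
      using scaling
    proof eventually_elim
      case (elim w)
      have C0: "C w \<le> 0" unfolding C_def using g_le by (intro mult_nonneg_nonpos) auto
      have t0: "- (\<kappa> * t w ^ 4) \<le> 0" using kappa by simp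
      have "tilted_test g a \<phi> (fst w) (fst (snd w)) - limit_test \<kappa> a \<phi> (snd (snd w))
          = (\<phi> (A w) - \<phi> (B w)) * exp (C w) + \<phi> (B w) * (exp (C w) - exp (- (\<kappa> * t w ^ 4)))"
        using elim by (simp add: tilted_test_def limit_test_def A_def B_def C_def t_def algebra_simps)
      also have "norm \<dots> \<le> \<bar>\<phi> (A w) - \<phi> (B w)\<bar> * exp (C w) + \<phi> (B w) * \<bar>exp (C w) - exp (- (\<kappa> * t w ^ 4))\<bar>"
        using phi_bound by (intro norm_triangle_le) (simp add: abs_mult)
      also have "\<dots> \<le> \<bar>\<phi> (A w) - \<phi> (B w)\<bar> * 1 + 1 * \<bar>C w - (- (\<kappa> * t w ^ 4))\<bar>"
        using C0 phi_bound by (intro add_mono mult_mono exp_Lipschitz_nonpos C0 t0) auto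
      finally show ?case by simp
    qed
    have "((\<lambda>w. \<bar>\<phi> (A w) - \<phi> (B w)\<bar> + \<bar>C w - (- (\<kappa> * t w ^ 4))\<bar>) \<longlongrightarrow> \<bar>0\<bar> + \<bar>0\<bar>) ?F"
      by (intro tendsto_intros uniformly_continuous_tendsto_diff[OF phi_cont AB] CD)
    then show "((\<lambda>w. \<bar>\<phi> (A w) - \<phi> (B w)\<bar> + \<bar>C w - (- (\<kappa> * t w ^ 4))\<bar>) \<longlongrightarrow> 0) ?F" by simp
  qed
qed

text \<open>The difference is at most 1 in modulus and small on \<open>close K n\<close>. Off that
  set T / n deviates, or t is far from Y / n^(1/4), or |t| exceeds K; each alternative has small
  mass under \<open>Q n\<close> by a second moment bound.\<close>

lemma integral_difference_tendsto:
  "(\<lambda>n. \<integral>p. tilted_test g a \<phi> n (fst p) - limit_test \<kappa> a \<phi> (snd p) \<partial>Q n) \<longlonglongrightarrow> 0"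
proof (rule LIMSEQ_I)
  note phi_meas[measurable]
  fix \<epsilon> :: real assume eps: "\<epsilon> > 0"
  \<comment> \<open>\<open>\<eta>\<close>, \<open>K\<close> and \<open>b\<close> are tuned so that
    closeness, large t and the two remaining alternatives each cost at most \<epsilon> / 4.\<close>
  define \<eta> where "\<eta> = \<epsilon> / (4 * (gauss_mass + 1))"
  have eta: "\<eta> > 0" using eps gauss_mass_pos by (simp add: \<eta>_def)
  define K where "K = sqrt (24 * gauss_mass / \<epsilon>)"
  have K2: "K > 0" "6 * gauss_mass / K\<^sup>2 = \<epsilon> / 4" using eps gauss_mass_pos by (simp_all add: K_def)
  define D where "D = (\<lambda>n p. tilted_test g a \<phi> n (fst p) - limit_test \<kappa> a \<phi> (snd p))"
  have D1: "\<bar>D n p\<bar> \<le> 1" for n p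
    using tilted_test_bounds[of n "fst p"] limit_test_bounds[of "snd p"] unfolding D_def by linarith
  have "\<forall>\<^sub>F w in along (close K). dist (D (fst w) (snd w)) 0 < \<eta>"
    unfolding D_def by (rule tendstoD[OF tilted_test_close eta])
  then obtain N where N: "\<And>n p. n \<ge> N \<Longrightarrow> p \<in> close K n \<Longrightarrow> \<bar>D n p\<bar> < \<eta>"
    by (auto simp: eventually_along)
  define V where "V = variance (\<lambda>z. z\<^sup>2)"
  have V0: "V \<ge> 0" by (simp add: V_def)
  define b where "b = (\<lambda>n. gauss_mass * (V / (n * (tol n)\<^sup>2)) + gauss_mass / (root4 n)\<^sup>2 / (tol n)\<^sup>2)"
  have "b \<longlonglongrightarrow> 0" unfolding b_def tol_def root4_def by real_asymp
  then have "\<forall>\<^sub>F n in sequentially. b n < \<epsilon> / 4" using eps by (intro order_tendstoD) auto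
  then obtain N' where N': "\<And>n. n \<ge> N' \<Longrightarrow> b n < \<epsilon> / 4" by (auto simp: eventually_sequentially)
  show "\<exists>no. \<forall>n\<ge>no. norm ((\<integral>p. tilted_test g a \<phi> n (fst p) - limit_test \<kappa> a \<phi> (snd p) \<partial>Q n) - 0) < \<epsilon>"
  proof (intro exI allI impI)
    fix n assume n': "n \<ge> max 1 (max N N')"
    then have n: "n > 0" by simp
    interpret Pn: prob_space "P n" by (rule prob_space_P)
    define B where "B = {x. \<bar>empirical_mean n (\<lambda>z. z\<^sup>2) x - expectation (\<lambda>z. z\<^sup>2)\<bar> \<ge> tol n}"
    have [measurable]: "(indicator B :: _ \<Rightarrow> ennreal) \<in> borel_measurable (P n)"
      unfolding B_def by measurable
    have inv: "sign_invariant n (\<lambda>x. indicator B x :: ennreal)"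
      using sign_invariant_empirical_mean[of "\<lambda>z. z\<^sup>2" n] by (auto simp: B_def sign_invariant_def indicator_def)
    have [measurable]: "D n \<in> borel_measurable (Q n)" unfolding D_def by measurable
    \<comment> \<open>Markov's inequality in pointwise form: off \<open>close K n\<close> at least
      one of the last three terms is at least 1.\<close>
    have le: "ennreal \<bar>D n p\<bar> \<le> ennreal \<eta> + indicator B (fst p)
       + ennreal (1 / (tol n)\<^sup>2) * ennreal ((snd p - studentized n (fst p) / root4 n)\<^sup>2)
       + ennreal (1 / K\<^sup>2) * ennreal ((snd p)\<^sup>2)" for p
    proof -
      define v where "v = (snd p - studentized n (fst p) / root4 n)\<^sup>2 / (tol n)\<^sup>2"
      define y where "y = (snd p)\<^sup>2 / K\<^sup>2"
      have vy: "v \<ge> 0" "y \<ge> 0" by (simp_all add: v_def y_def)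
      have "\<bar>D n p\<bar> \<le> \<eta> + indicator B (fst p) + v + y"
      proof (cases "p \<in> close K n")
        case True
        then have "\<bar>D n p\<bar> < \<eta>" using N n' by auto
        then show ?thesis using vy by (simp add: indicator_def)
      next
        case False
        then consider "fst p \<in> B" | "tol n < \<bar>snd p - studentized n (fst p) / root4 n\<bar>" | "K < \<bar>snd p\<bar>"
          by (auto simp: close_def B_def \<sigma>2_def not_le abs_minus_commute)
        then have "1 \<le> indicator B (fst p) + v + y"
        proof cases
          case 2
          then have "(tol n)\<^sup>2 \<le> (snd p - studentized n (fst p) / root4 n)\<^sup>2"
            using tol_pos[OF n] by (simp add: abs_le_square_iff[symmetric])
          then have "1 \<le> v" using tol_pos[OF n] by (simp add: v_def)
          then show ?thesis using vy by (simp add: indicator_def)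
        next
          case 3
          then have "K\<^sup>2 \<le> (snd p)\<^sup>2" using K2(1) by (simp add: abs_le_square_iff[symmetric])
          then have "1 \<le> y" using K2(1) by (simp add: y_def)
          then show ?thesis using vy by (simp add: indicator_def)
        qed (use vy in simp)
        then show ?thesis using D1[of n p] eta by linarith
      qed
      then have "ennreal \<bar>D n p\<bar> \<le> ennreal (\<eta> + indicator B (fst p) + v + y)" by (rule ennreal_leI)
      also have "\<dots> = ennreal \<eta> + indicator B (fst p) + ennreal v + ennreal y"
        using eta vy by (simp add: ennreal_indicator)
      also have "ennreal v = ennreal (1 / (tol n)\<^sup>2) * ennreal ((snd p - studentized n (fst p) / root4 n)\<^sup>2)"
        by (simp add: v_def ennreal_mult'[symmetric])
      also have "ennreal y = ennreal (1 / K\<^sup>2) * ennreal ((snd p)\<^sup>2)"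
        by (simp add: y_def ennreal_mult'[symmetric])
      finally show ?thesis .
    qed
    have "(\<integral>\<^sup>+ p. ennreal \<bar>D n p\<bar> \<partial>Q n) \<le> (\<integral>\<^sup>+ p. ennreal \<eta> + indicator B (fst p)
       + ennreal (1 / (tol n)\<^sup>2) * ennreal ((snd p - studentized n (fst p) / root4 n)\<^sup>2)
       + ennreal (1 / K\<^sup>2) * ennreal ((snd p)\<^sup>2) \<partial>Q n)"
      by (intro nn_integral_mono le)
    also have "\<dots> = ennreal \<eta> * emeasure (Q n) (space (Q n)) + (\<integral>\<^sup>+ p. indicator B (fst p) \<partial>Q n)
       + ennreal (1 / (tol n)\<^sup>2) * (\<integral>\<^sup>+ p. ennreal ((snd p - studentized n (fst p) / root4 n)\<^sup>2) \<partial>Q n)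
       + ennreal (1 / K\<^sup>2) * (\<integral>\<^sup>+ p. ennreal ((snd p)\<^sup>2) \<partial>Q n)"
      by (simp add: nn_integral_add nn_integral_cmult)
    also have "\<dots> \<le> ennreal \<eta> * ennreal gauss_mass + ennreal gauss_mass * ennreal (V / (n * (tol n)\<^sup>2))
       + ennreal (1 / (tol n)\<^sup>2) * ennreal (gauss_mass / (root4 n)\<^sup>2)
       + ennreal (1 / K\<^sup>2) * ennreal (6 * gauss_mass)"
    proof (intro add_mono mult_left_mono emeasure_Q_le nn_integral_Q_deviation_le nn_integral_Q_square_le n)
      have "(\<integral>\<^sup>+ p. indicator B (fst p) \<partial>Q n) \<le> ennreal gauss_mass * (\<integral>\<^sup>+ x. indicator B x \<partial>P n)"
        by (intro nn_integral_Q_sign_invariant_le n inv) measurable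
      also have "(\<integral>\<^sup>+ x. indicator B x \<partial>P n) = (\<integral>\<^sup>+ x. indicator (B \<inter> space (P n)) x \<partial>P n)"
        by (intro nn_integral_cong) (auto simp: indicator_def)
      also have "B \<inter> space (P n) = {x \<in> space (P n). \<bar>empirical_mean n (\<lambda>z. z\<^sup>2) x - expectation (\<lambda>z. z\<^sup>2)\<bar> \<ge> tol n}"
        by (auto simp: B_def)
      also have "(\<integral>\<^sup>+ x. indicator \<dots> x \<partial>P n) = ennreal (Pn.prob \<dots>)"
        by (simp add: Pn.emeasure_eq_measure)
      also have "\<dots> \<le> ennreal (V / (n * (tol n)\<^sup>2))"
        unfolding V_def by (intro ennreal_leI empirical_mean_Chebyshev integrable_moments n tol_pos) simp
      finally show "(\<integral>\<^sup>+ p. indicator B (fst p) \<partial>Q n) \<le> ennreal gauss_mass * ennreal (V / (n * (tol n)\<^sup>2))"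
        by (simp add: mult_left_mono)
    qed auto
    also have "\<dots> = ennreal (\<eta> * gauss_mass + gauss_mass * (V / (n * (tol n)\<^sup>2))
       + 1 / (tol n)\<^sup>2 * (gauss_mass / (root4 n)\<^sup>2) + 1 / K\<^sup>2 * (6 * gauss_mass))"
    proof -
      have "0 \<le> \<eta>" "0 \<le> gauss_mass" "0 \<le> V / (n * (tol n)\<^sup>2)" "0 \<le> 1 / (tol n)\<^sup>2" "0 \<le> gauss_mass / (root4 n)\<^sup>2"
        "0 \<le> 1 / K\<^sup>2" "0 \<le> 6 * gauss_mass"
        using eta gauss_mass_pos V0 by simp_all
      then show ?thesis by (simp only: ennreal_plus ennreal_mult mult_nonneg_nonneg add_nonneg_nonneg)
    qed
    also have "\<eta> * gauss_mass + gauss_mass * (V / (n * (tol n)\<^sup>2))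
       + 1 / (tol n)\<^sup>2 * (gauss_mass / (root4 n)\<^sup>2) + 1 / K\<^sup>2 * (6 * gauss_mass) = \<eta> * gauss_mass + b n + \<epsilon> / 4"
    proof -
      have "1 / (tol n)\<^sup>2 * (gauss_mass / (root4 n)\<^sup>2) = gauss_mass / (root4 n)\<^sup>2 / (tol n)\<^sup>2"
        "1 / K\<^sup>2 * (6 * gauss_mass) = 6 * gauss_mass / K\<^sup>2" by simp_all
      then show ?thesis unfolding b_def K2(2) by linarith
    qed
    finally have fin: "(\<integral>\<^sup>+ p. ennreal \<bar>D n p\<bar> \<partial>Q n) \<le> ennreal (\<eta> * gauss_mass + b n + \<epsilon> / 4)" .
    have b0: "b n \<ge> 0" using V0 gauss_mass_pos by (simp add: b_def)
    have "norm (\<integral>p. D n p \<partial>Q n) \<le> (\<integral>p. norm (D n p) \<partial>Q n)" by (rule integral_norm_bound)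
    also have "\<dots> = enn2real (\<integral>\<^sup>+ p. ennreal \<bar>D n p\<bar> \<partial>Q n)"
      by (subst integral_eq_nn_integral) auto
    also have "\<dots> \<le> \<eta> * gauss_mass + b n + \<epsilon> / 4"
      using fin eta gauss_mass_pos b0 eps by (intro enn2real_leI) auto
    also have "\<dots> < \<epsilon>"
    proof -
      have "\<eta> * gauss_mass \<le> \<epsilon> / 4" using eps gauss_mass_pos by (simp add: \<eta>_def field_simps)
      then show ?thesis using N'[of n] n' eps by simp
    qed
    finally show "norm ((\<integral>p. tilted_test g a \<phi> n (fst p) - limit_test \<kappa> a \<phi> (snd p) \<partial>Q n) - 0) < \<epsilon>"
      by (simp add: D_def)
  qed
qed

lemma integral_tilted_test_tendsto:
  "(\<lambda>n. \<integral>p. tilted_test g a \<phi> n (fst p) \<partial>Q n) \<longlonglongrightarrow> (\<integral>t. limit_test \<kappa> a \<phi> t * limit_density t \<partial>lborel)"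
proof -
  note phi_meas[measurable]
  have "(\<lambda>n. (\<integral>p. tilted_test g a \<phi> n (fst p) - limit_test \<kappa> a \<phi> (snd p) \<partial>Q n) + (\<integral>p. limit_test \<kappa> a \<phi> (snd p) \<partial>Q n))
      \<longlonglongrightarrow> 0 + (\<integral>t. limit_test \<kappa> a \<phi> t * limit_density t \<partial>lborel)"
    by (intro tendsto_add integral_difference_tendsto integral_Q_tendsto limit_test_bounds) measurable
  moreover have "\<forall>\<^sub>F n in sequentially. (\<integral>p. tilted_test g a \<phi> n (fst p) - limit_test \<kappa> a \<phi> (snd p) \<partial>Q n) + (\<integral>p. limit_test \<kappa> a \<phi> (snd p) \<partial>Q n)
      = (\<integral>p. tilted_test g a \<phi> n (fst p) \<partial>Q n)"
    using eventually_gt_at_top[of 0]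
  proof eventually_elim
    case (elim n)
    interpret Qn: finite_measure "Q n" using elim by (rule finite_measure_Q)
    have "integrable (Q n) (\<lambda>p. tilted_test g a \<phi> n (fst p))" "integrable (Q n) (\<lambda>p. limit_test \<kappa> a \<phi> (snd p))"
      using tilted_test_bounds limit_test_bounds by (auto intro!: Qn.integrable_const_bound[of _ 1])
    then show ?case by simp
  qed
  ultimately show ?thesis by (auto elim: Lim_transform_eventually)
qed

text \<open>With \<phi> constantly 1 this is also the formula for the normalizing constant, so the
  factor n^(1/4) cancels in expectations under \<open>mu_tilde\<close>.\<close>

lemma integral_cw_weight_eq:
  assumes n: "n > 0"
  shows "(\<integral>x. \<phi> (a * Ssum n x / root4 n ^ 3) * cw_weight g n x \<partial>P n) = root4 n * (\<integral>p. tilted_test g a \<phi> n (fst p) \<partial>Q n)"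
proof -
  note phi_meas[measurable]
  have "(\<integral>\<^sup>+ x. ennreal (tilted_test g a \<phi> n x) * ennreal (tilt n x) \<partial>P n)
      = ennreal (root4 n) * (\<integral>\<^sup>+ p. ennreal (tilted_test g a \<phi> n (fst p)) \<partial>Q n)"
    by (rule nn_integral_tilt_eq[OF n]) measurable
  moreover have "ennreal (tilted_test g a \<phi> n x) * ennreal (tilt n x) = ennreal (\<phi> (a * Ssum n x / root4 n ^ 3) * cw_weight g n x)" for x
    by (simp add: tilted_test_tilt[OF n, symmetric] ennreal_mult'[OF tilted_test_bounds(1)])
  ultimately have "(\<integral>\<^sup>+ x. ennreal (\<phi> (a * Ssum n x / root4 n ^ 3) * cw_weight g n x) \<partial>P n)
      = ennreal (root4 n) * (\<integral>\<^sup>+ p. ennreal (tilted_test g a \<phi> n (fst p)) \<partial>Q n)" by simp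
  then show ?thesis
    using root4_pos[OF n] phi_bound tilted_test_bounds
    by (subst (1 2) integral_eq_nn_integral) (auto simp: cw_weight_nonneg enn2real_mult)
qed

end

end

section \<open>The limit law and the criterion for weak convergence\<close>

definition quartic_law :: "real measure" where
  "quartic_law = density lborel (\<lambda>s. ennreal ((4/3) powr (1/4) / Gamma (1/4) * exp (- (s ^ 4) / 12)))"

lemma quartic_const_pos: "(4/3) powr (1/4) / Gamma (1/4 :: real) > 0"
  by (simp add: Gamma_real_pos)

lemma integrable_quartic: "integrable lborel (\<lambda>s::real. exp (- (s ^ 4) / 12))"
  using integrable_exp_quartic[of "1 / 12"] by simp

text \<open>The Gamma constant is turned back into an integral, since the limit of the expectations
  arises as a quotient of two integrals.\<close>

lemma integral_quartic_law:
  fixes f :: "real \<Rightarrow> real"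
  assumes [measurable]: "f \<in> borel_measurable borel"
  shows "(\<integral>s. f s \<partial>quartic_law) = (\<integral>s. f s * exp (- (s ^ 4) / 12) \<partial>lborel) / (\<integral>s. exp (- (s ^ 4) / 12) \<partial>lborel)"
proof -
  have "(\<integral>s. f s \<partial>quartic_law) = (\<integral>s. ((4/3) powr (1/4) / Gamma (1/4) * exp (- (s ^ 4) / 12)) *\<^sub>R f s \<partial>lborel)"
    unfolding quartic_law_def using quartic_const_pos by (intro integral_density) (auto intro!: AE_I2)
  also have "\<dots> = (4/3) powr (1/4) / Gamma (1/4) * (\<integral>s. f s * exp (- (s ^ 4) / 12) \<partial>lborel)"
    by (subst integral_mult_right_zero[symmetric]) (simp add: ac_simps)
  finally show ?thesis unfolding integral_exp_quartic by simp
qed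

lemma real_distribution_quartic_law: "real_distribution quartic_law"
proof -
  have "emeasure quartic_law (space quartic_law) = (\<integral>\<^sup>+ s. ennreal ((4/3) powr (1/4) / Gamma (1/4) * exp (- (s ^ 4) / 12)) \<partial>lborel)"
    unfolding quartic_law_def by (subst emeasure_density) auto
  also have "\<dots> = ennreal (\<integral>s. (4/3) powr (1/4) / Gamma (1/4) * exp (- (s ^ 4) / 12) \<partial>lborel)"
    using quartic_const_pos by (intro nn_integral_eq_integral integrable_mult_right integrable_quartic) auto
  also have "(\<integral>s. (4/3) powr (1/4) / Gamma (1/4) * exp (- ((s::real) ^ 4) / 12) \<partial>lborel) = 1"
    using quartic_const_pos unfolding integral_mult_right_zero integral_exp_quartic by (simp add: Gamma_real_pos less_imp_neq[symmetric])
  finally have "prob_space quartic_law" by (intro prob_spaceI) simp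
  then show ?thesis by (intro real_distribution.intro real_distribution_axioms.intro) (simp_all add: quartic_law_def)
qed

lemma cts_step_bounds: "a < b \<Longrightarrow> 0 \<le> cts_step a b x" "a < b \<Longrightarrow> cts_step a b x \<le> 1"
  by (auto simp: cts_step_def)

text \<open>
  The library criterion asks for probability measures at every index, which fails at n = 0:
  there all weights are 0.
\<close>

lemma weak_conv_m_eventually:
  assumes "\<forall>\<^sub>F n in sequentially. real_distribution (M n)" "real_distribution L"
    and "\<And>x y. x < y \<Longrightarrow> (\<lambda>n. integral\<^sup>L (M n) (cts_step x y)) \<longlonglongrightarrow> integral\<^sup>L L (cts_step x y)"
  shows "weak_conv_m M L"
proof -
  define M' where "M' = (\<lambda>n. if real_distribution (M n) then M n else L)"
  have ev: "\<forall>\<^sub>F n in sequentially. M' n = M n"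
    using assms(1) by eventually_elim (simp add: M'_def)
  have "weak_conv_m M' L"
  proof (rule integral_cts_step_conv_imp_weak_conv)
    show "real_distribution (M' n)" for n using assms(2) by (simp add: M'_def)
    fix x y :: real assume "x < y"
    have "\<forall>\<^sub>F n in sequentially. integral\<^sup>L (M n) (cts_step x y) = integral\<^sup>L (M' n) (cts_step x y)"
      using ev by eventually_elim simp
    with assms(3)[OF \<open>x < y\<close>] show "(\<lambda>n. integral\<^sup>L (M' n) (cts_step x y)) \<longlonglongrightarrow> integral\<^sup>L L (cts_step x y)"
      by (rule Lim_transform_eventually)
  qed fact
  moreover have "(\<lambda>n. cdf (M n) x) \<longlonglongrightarrow> cdf L x" if "(\<lambda>n. cdf (M' n) x) \<longlonglongrightarrow> cdf L x" for x
    using that by (rule Lim_transform_eventually) (use ev in eventually_elim, simp)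
  ultimately show ?thesis unfolding weak_conv_m_def weak_conv_def by blast
qed

section \<open>Convergence in law of the rescaled sum\<close>

context cw_law
begin

lemma sets_mu_tilde[measurable_cong, simp]: "sets (mu_tilde \<rho> g n) = sets (P n)"
  by (simp add: mu_tilde_def)

context
  fixes g :: "real \<Rightarrow> real" and z :: real and n :: nat
  assumes g_meas[measurable]: "g \<in> borel_measurable borel"
    and Z: "cw_Z \<rho> g n = ennreal z" "z > 0"
begin

lemma mu_tilde_eq: "mu_tilde \<rho> g n = density (P n) (\<lambda>x. ennreal (cw_weight g n x / z))"
  unfolding mu_tilde_def using Z by (simp add: divide_ennreal cw_weight_nonneg)

lemma prob_space_mu_tilde: "prob_space (mu_tilde \<rho> g n)"
proof (rule prob_spaceI)
  have "emeasure (mu_tilde \<rho> g n) (space (mu_tilde \<rho> g n))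
      = (\<integral>\<^sup>+ x. ennreal (cw_weight g n x) / cw_Z \<rho> g n * indicator (space (P n)) x \<partial>P n)"
    unfolding mu_tilde_def space_density by (rule emeasure_density) measurable
  also have "\<dots> = (\<integral>\<^sup>+ x. ennreal (cw_weight g n x) / cw_Z \<rho> g n \<partial>P n)"
    by (rule nn_integral_cong) simp
  also have "\<dots> = (\<integral>\<^sup>+ x. ennreal (cw_weight g n x) \<partial>P n) / cw_Z \<rho> g n"
    by (rule nn_integral_divide) measurable
  also have "\<dots> = ennreal z / ennreal z" by (simp only: cw_Z_def[symmetric] Z(1))
  also have "\<dots> = 1" using Z(2) by (simp add: divide_ennreal)
  finally show "emeasure (mu_tilde \<rho> g n) (space (mu_tilde \<rho> g n)) = 1" .
qed

lemma integral_mu_tilde: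
  fixes f :: "(nat \<Rightarrow> real) \<Rightarrow> real"
  assumes [measurable]: "f \<in> borel_measurable (P n)"
  shows "(\<integral>x. f x \<partial>mu_tilde \<rho> g n) = (\<integral>x. f x * cw_weight g n x \<partial>P n) / z"
proof -
  have "(\<integral>x. f x \<partial>mu_tilde \<rho> g n) = (\<integral>x. (cw_weight g n x / z) *\<^sub>R f x \<partial>P n)"
    unfolding mu_tilde_eq
    by (rule integral_density) (measurable, use Z(2) in \<open>simp add: cw_weight_nonneg\<close>)
  also have "\<dots> = (\<integral>x. f x * cw_weight g n x / z \<partial>P n)"
    by (rule Bochner_Integration.integral_cong) simp_all
  finally show ?thesis by simp
qed

end

text \<open>This is where the normalization of the theorem comes from: l = a sqrt
  \<open>\<sigma>2\<close> satisfies l^4 = (\<mu>4 + m \<sigma>^4) / \<sigma>^4, so the quartic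
  exponents from \<open>g\<close> and from the law merge into (l t)^4 / 12, and s = l t
  finishes.\<close>

lemma integral_limit_test:
  fixes \<phi> :: "real \<Rightarrow> real"
  assumes m: "m \<ge> 0" and [measurable]: "\<phi> \<in> borel_measurable borel"
  defines "a \<equiv> (\<mu>4 + m * \<sigma>2\<^sup>2) powr (1/4) / \<sigma>2"
  shows "(\<integral>t. limit_test (m / 12) a \<phi> t * limit_density t \<partial>lborel)
    = (\<integral>s. \<phi> s * exp (- (s ^ 4) / 12) \<partial>lborel) / (sqrt (2 * pi) * (a * sqrt \<sigma>2))"
proof -
  have pos: "\<mu>4 + m * \<sigma>2\<^sup>2 > 0"
    using \<mu>4_ge m \<sigma>2_pos by (smt (verit) mult_nonneg_nonneg zero_less_power zero_le_power2)
  define l where "l = a * sqrt \<sigma>2"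
  have l: "l > 0" using pos \<sigma>2_pos by (simp add: l_def a_def)
  have "((\<mu>4 + m * \<sigma>2\<^sup>2) powr (1/4)) ^ 4 = \<mu>4 + m * \<sigma>2\<^sup>2"
  proof -
    have "((\<mu>4 + m * \<sigma>2\<^sup>2) powr (1/4)) ^ 4 = ((\<mu>4 + m * \<sigma>2\<^sup>2) powr (1/4)) powr 4"
      using pos by (simp add: powr_numeral)
    then show ?thesis using pos by (simp add: powr_powr)
  qed
  moreover have "sqrt \<sigma>2 ^ 4 = \<sigma>2\<^sup>2" using \<sigma>2_pos power_mult[of "sqrt \<sigma>2" 2 2] by simp
  ultimately have "l ^ 4 = (\<mu>4 + m * \<sigma>2\<^sup>2) / \<sigma>2 ^ 4 * \<sigma>2\<^sup>2"
    by (simp only: l_def a_def power_mult_distrib power_divide)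
  then have l4: "l ^ 4 = (\<mu>4 + m * \<sigma>2\<^sup>2) / \<sigma>2\<^sup>2"
    using \<sigma>2_pos by (simp add: power_numeral_reduce)
  have eq: "limit_test (m / 12) a \<phi> t * limit_density t = \<phi> (l * t) * exp (- ((l * t) ^ 4) / 12) / sqrt (2 * pi)" for t
  proof -
    have "- (m / 12 * t ^ 4) + - (t ^ 4) * \<mu>4 / \<sigma>2\<^sup>2 / 12 = - ((l * t) ^ 4) / 12"
      using \<sigma>2_pos unfolding power_mult_distrib l4 by (simp add: field_simps)
    then have "exp (- (m / 12 * t ^ 4)) * exp (- (t ^ 4) * \<mu>4 / \<sigma>2\<^sup>2 / 12) = exp (- ((l * t) ^ 4) / 12)"
      unfolding exp_add[symmetric] by simp
    then show ?thesis by (simp add: limit_test_def limit_density_def l_def[symmetric])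
  qed
  have "(\<integral>s. \<phi> s * exp (- (s ^ 4) / 12) \<partial>lborel) = l * (\<integral>t. \<phi> (l * t) * exp (- ((l * t) ^ 4) / 12) \<partial>lborel)"
    using lborel_integral_real_affine[of l "\<lambda>s. \<phi> s * exp (- (s ^ 4) / 12)" 0] l by simp
  then show ?thesis unfolding eq using l by (simp add: l_def[symmetric])
qed

text \<open>An expectation under \<open>mu_tilde\<close> is a quotient of two integrals against
  \<open>Q n\<close>, with the test function above and the constant 1 below. Both converge by
  \<open>integral_tilted_test_tendsto\<close>, and the continuous step functions
  \<open>cts_step\<close> suffice as test functions.\<close>

lemma fluctuations:
  fixes g :: "real \<Rightarrow> real" and m :: real
  assumes g_meas[measurable]: "g \<in> borel_measurable borel"
    and g_le: "\<And>u. g u \<le> u\<^sup>2 / 2"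
    and g0: "g 0 = 0" "\<forall>\<^sub>F u in at 0. g u \<ge> 0"
    and g4: "((\<lambda>u. (g u - u\<^sup>2 / 2) / u ^ 4) \<longlongrightarrow> - (m / 12)) (at 0)"
    and m: "m \<ge> 0"
  shows "weak_conv_m
    (\<lambda>n. distr (mu_tilde \<rho> g n) borel (\<lambda>x. (\<mu>4 + m * \<sigma>2\<^sup>2) powr (1/4) * Ssum n x / (\<sigma>2 * real n powr (3/4))))
    quartic_law"
proof -
  define a where "a = (\<mu>4 + m * \<sigma>2\<^sup>2) powr (1/4) / \<sigma>2"
  define X where "X = (\<lambda>n x. (\<mu>4 + m * \<sigma>2\<^sup>2) powr (1/4) * Ssum n x / (\<sigma>2 * real n powr (3/4)))"
  have X: "X n x = a * Ssum n x / root4 n ^ 3" if "n > 0" for n x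
  proof -
    have "root4 n ^ 3 = (real n powr (1 / 4)) powr 3" using that by (simp add: root4_def powr_numeral)
    then show ?thesis by (simp add: X_def a_def powr_powr)
  qed
  have X_meas: "X n \<in> borel_measurable (P n)" for n
    unfolding X_def by (intro borel_measurable_divide borel_measurable_times borel_measurable_const measurable_Ssum)
  have X_meas_mu: "X n \<in> borel_measurable (mu_tilde \<rho> g n)" for n
    unfolding measurable_cong_sets[OF sets_mu_tilde refl] by (rule X_meas)
  define I where "I = (\<lambda>\<phi> n. \<integral>p. tilted_test g a \<phi> n (fst p) \<partial>Q n)"
  obtain c where c: "c > 0" "\<forall>\<^sub>F n in sequentially. cw_Z \<rho> g n \<ge> ennreal c"
    using cw_Z_lower_bound[OF g_meas g0(2)] by blast
  define z where "z = (\<lambda>n. enn2real (cw_Z \<rho> g n))"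
  have Z: "\<forall>\<^sub>F n in sequentially. n > 0 \<and> cw_Z \<rho> g n = ennreal (z n) \<and> z n > 0"
    using c(2) eventually_gt_at_top[of 0]
  proof eventually_elim
    case (elim n)
    have "cw_Z \<rho> g n < top"
      using cw_Z_le[of g n] g_le elim by (auto simp: less_top[symmetric] top_unique)
    then have zn: "cw_Z \<rho> g n = ennreal (z n)" by (simp add: z_def)
    with elim have "ennreal c \<le> ennreal (z n)" by (simp only:)
    then have "c \<le> z n" by (subst (asm) ennreal_le_iff) (simp_all add: z_def)
    with c(1) have "z n > 0" by linarith
    with elim zn show ?case by (intro conjI) (simp_all only:)
  qed
  have z_eq: "z n = root4 n * I (\<lambda>_. 1) n" if n: "n > 0" for n
  proof -
    have "z n = (\<integral>x. cw_weight g n x \<partial>P n)"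
      unfolding z_def cw_Z_def
      by (rule integral_eq_nn_integral[symmetric]) (simp_all add: cw_weight_nonneg measurable_cw_weight g_meas)
    moreover have "(\<integral>x. 1 * cw_weight g n x \<partial>P n) = root4 n * I (\<lambda>_. 1) n"
      unfolding I_def
      by (rule integral_cw_weight_eq[where g = g and \<kappa> = "m / 12" and \<phi> = "\<lambda>_. 1" and a = a and n = n, OF g_meas g_le g0(1) g4 _ _ _ _ n])
         (simp_all add: m uniformly_continuous_on_const)
    ultimately show ?thesis by simp
  qed
  have I_lim: "I \<phi> \<longlonglongrightarrow> (\<integral>s. \<phi> s * exp (- (s ^ 4) / 12) \<partial>lborel) / (sqrt (2 * pi) * (a * sqrt \<sigma>2))"
    if "uniformly_continuous_on UNIV \<phi>" "\<And>y. 0 \<le> \<phi> y" "\<And>y. \<phi> y \<le> 1" for \<phi> :: "real \<Rightarrow> real"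
  proof -
    have [measurable]: "\<phi> \<in> borel_measurable borel"
      by (intro borel_measurable_continuous_onI uniformly_continuous_imp_continuous that)
    have "I \<phi> \<longlonglongrightarrow> (\<integral>t. limit_test (m / 12) a \<phi> t * limit_density t \<partial>lborel)"
      unfolding I_def
      by (rule integral_tilted_test_tendsto[where g = g and \<kappa> = "m / 12" and \<phi> = \<phi> and a = a,
            OF g_meas g_le g0(1) g4 _ that]) (simp add: m)
    then show ?thesis
      by (simp only: integral_limit_test[OF m \<open>\<phi> \<in> borel_measurable borel\<close>, folded a_def])
  qed
  have J: "(\<integral>s. exp (- ((s::real) ^ 4) / 12) \<partial>lborel) > 0"
    unfolding integral_exp_quartic by (simp add: Gamma_real_pos)
  have a: "sqrt (2 * pi) * (a * sqrt \<sigma>2) \<noteq> 0"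
  proof -
    have "0 < \<sigma>2\<^sup>2" "0 \<le> m * \<sigma>2\<^sup>2" using \<sigma>2_pos m by simp_all
    then have "\<mu>4 + m * \<sigma>2\<^sup>2 \<noteq> 0" using \<mu>4_ge by linarith
    then show ?thesis using \<sigma>2_pos by (simp add: a_def)
  qed
  have "weak_conv_m (\<lambda>n. distr (mu_tilde \<rho> g n) borel (X n)) quartic_law"
  proof (rule weak_conv_m_eventually[OF _ real_distribution_quartic_law])
    show "\<forall>\<^sub>F n in sequentially. real_distribution (distr (mu_tilde \<rho> g n) borel (X n))"
      using Z
    proof eventually_elim
      case (elim n)
      have "prob_space (mu_tilde \<rho> g n)"
        by (rule prob_space_mu_tilde[where z = "z n", OF g_meas]) (use elim in blast)+
      moreover note X_meas_mu
      ultimately show ?case by (rule prob_space.real_distribution_distr)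
    qed
    fix x y :: real assume xy: "x < y"
    let ?\<phi> = "cts_step x y"
    have phi: "uniformly_continuous_on UNIV ?\<phi>" "\<And>s. 0 \<le> ?\<phi> s" "\<And>s. ?\<phi> s \<le> 1"
      using cts_step_uniformly_continuous[OF xy] cts_step_bounds[OF xy] by auto
    have phi_meas: "?\<phi> \<in> borel_measurable borel"
      by (intro borel_measurable_continuous_onI uniformly_continuous_imp_continuous phi)
    have cancel: "(A / k) / (B / k) = A / B" if "k \<noteq> 0" for A B k :: real
      using that by simp
    \<comment> \<open>The unnormalized limits share the factor sqrt (2 * pi) * (a * sqrt
      \<open>\<sigma>2\<close>), removed by \<open>cancel\<close>.\<close>
    have "(\<lambda>n. I ?\<phi> n / I (\<lambda>_. 1) n) \<longlonglongrightarrow>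
       ((\<integral>s. ?\<phi> s * exp (- (s ^ 4) / 12) \<partial>lborel) / (sqrt (2 * pi) * (a * sqrt \<sigma>2))) /
       ((\<integral>s. 1 * exp (- (s ^ 4) / 12) \<partial>lborel) / (sqrt (2 * pi) * (a * sqrt \<sigma>2)))"
    proof (intro tendsto_divide I_lim phi)
      show "(\<integral>s. 1 * exp (- ((s::real) ^ 4) / 12) \<partial>lborel) / (sqrt (2 * pi) * (a * sqrt \<sigma>2)) \<noteq> 0"
        unfolding mult_1_left using a J by (metis divide_eq_0_iff less_irrefl)
    qed (simp_all only: uniformly_continuous_on_const zero_le_one order_refl)
    then have lim: "(\<lambda>n. I ?\<phi> n / I (\<lambda>_. 1) n) \<longlonglongrightarrow> integral\<^sup>L quartic_law ?\<phi>"
      unfolding cancel[OF a] mult_1_left integral_quartic_law[OF phi_meas] .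
    show "(\<lambda>n. integral\<^sup>L (distr (mu_tilde \<rho> g n) borel (X n)) ?\<phi>) \<longlonglongrightarrow> integral\<^sup>L quartic_law ?\<phi>"
    proof (rule Lim_transform_eventually[OF lim])
      show "\<forall>\<^sub>F n in sequentially. I ?\<phi> n / I (\<lambda>_. 1) n = integral\<^sup>L (distr (mu_tilde \<rho> g n) borel (X n)) ?\<phi>"
        using Z
      proof eventually_elim
        case (elim n)
        then have n: "n > 0" by simp
        have "integral\<^sup>L (distr (mu_tilde \<rho> g n) borel (X n)) ?\<phi> = (\<integral>x. ?\<phi> (X n x) \<partial>mu_tilde \<rho> g n)"
          by (rule integral_distr[OF X_meas_mu phi_meas])
        also have "\<dots> = (\<integral>x. ?\<phi> (X n x) * cw_weight g n x \<partial>P n) / z n"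
          by (rule integral_mu_tilde[where z = "z n", OF g_meas])
             (use elim in blast, use elim in blast, rule measurable_compose[OF X_meas phi_meas])
        also have "\<dots> = (\<integral>x. ?\<phi> (a * Ssum n x / root4 n ^ 3) * cw_weight g n x \<partial>P n) / z n"
          by (simp only: X[OF n])
        also have "(\<integral>x. ?\<phi> (a * Ssum n x / root4 n ^ 3) * cw_weight g n x \<partial>P n) = root4 n * I ?\<phi> n"
          unfolding I_def
          by (rule integral_cw_weight_eq[where g = g and \<kappa> = "m / 12" and \<phi> = "?\<phi>" and a = a,
                OF g_meas g_le g0(1) g4 _ phi n]) (use m in linarith)
        also have "root4 n * I ?\<phi> n / z n = I ?\<phi> n / I (\<lambda>_. 1) n"
          unfolding z_eq[OF n]
          by (rule mult_divide_mult_cancel_left) (use root4_pos[OF n] in linarith)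
        finally show ?case by (rule sym)
      qed
    qed
  qed
  then show ?thesis unfolding X_def .
qed

end

theorem theorem1:
  fixes g :: "real \<Rightarrow> real" and \<rho> :: "real measure"
  assumes g_meas: "g \<in> borel_measurable borel"
    and g_equiv: "g \<sim>[at 0] (\<lambda>u. u\<^sup>2 / 2)"
    and g_le: "\<And>u. g u \<le> u\<^sup>2 / 2"
    and rho_prob: "prob_space \<rho>"
    and rho_sets: "sets \<rho> = sets borel"
    and rho_sym: "distr \<rho> borel uminus = \<rho>"
    and rho_var: "prob_space.variance \<rho> (\<lambda>z. z) > 0"
    and rho_exp: "\<exists>v0>0. integrable \<rho> (\<lambda>z. exp (v0 * z\<^sup>2))"
  shows
    "(\<forall>\<epsilon>>0. (\<lambda>n. measure (mu_tilde \<rho> g n)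
          {x \<in> space (mu_tilde \<rho> g n).
             dist (Ssum n x / real n, Tsum n x / real n) (0, prob_space.variance \<rho> (\<lambda>z. z)) > \<epsilon>})
        \<longlonglongrightarrow> 0)
     \<and>
     ((\<exists>e>0. \<forall>k<3. \<forall>x\<in>ball 0 e.
          ((deriv ^^ k) g has_real_derivative (deriv ^^ Suc k) g x) (at x))
      \<and> (deriv ^^ 3) g differentiable (at 0)
      \<and> (\<forall>\<alpha>>0. (SUP p\<in>{p :: real \<times> real. norm p \<ge> \<alpha>}.
             cmod (integral\<^sup>L \<rho> (\<lambda>z. cis (fst p * z + snd p * z\<^sup>2)))) < 1)
      \<longrightarrow>
      (let \<sigma>2 = prob_space.variance \<rho> (\<lambda>z. z);
           \<mu>4 = integral\<^sup>L \<rho> (\<lambda>z. z ^ 4);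
           m4 = - (deriv ^^ 4) g 0 / 2
       in m4 \<ge> 0 \<and>
          weak_conv_m
            (\<lambda>n. distr (mu_tilde \<rho> g n) borel
                   (\<lambda>x. (\<mu>4 + m4 * \<sigma>2\<^sup>2) powr (1/4) * Ssum n x / (\<sigma>2 * real n powr (3/4))))
            (density lborel (\<lambda>s. ennreal ((4/3) powr (1/4) / Gamma (1/4) * exp (- (s ^ 4) / 12))))))"
proof -
  interpret cw_law \<rho>
    by (intro cw_law.intro symmetric_law.intro symmetric_law_axioms.intro cw_law_axioms.intro assms)
  \<comment> \<open>Asymptotic equivalence assigns the quotient the value 1 where both functions
    vanish; off u = 0 this case does not occur.\<close>
  have "((\<lambda>u. if g u = 0 \<and> u\<^sup>2 / 2 = 0 then 1 else g u / (u\<^sup>2 / 2)) \<longlongrightarrow> 1) (at 0)"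
    using g_equiv by (simp add: asymp_equiv_def)
  then have "((\<lambda>u. (if g u = 0 \<and> u\<^sup>2 / 2 = 0 then 1 else g u / (u\<^sup>2 / 2)) / 2) \<longlongrightarrow> 1 / 2) (at 0)"
    by (intro tendsto_intros) auto
  then have g2: "((\<lambda>u. g u / u\<^sup>2) \<longlongrightarrow> 1 / 2) (at 0)"
    by (rule Lim_transform_eventually) (auto simp: eventually_at_filter)
  have "\<forall>\<^sub>F u in at 0. g u / u\<^sup>2 > 0"
    using g2 by (rule order_tendstoD) simp
  then have g_nonneg: "\<forall>\<^sub>F u in at 0. g u \<ge> 0"
    by eventually_elim (auto simp: zero_less_divide_iff)
  show ?thesis
    unfolding Let_def variance_id
  proof (intro conjI allI impI; (elim conjE)?)
    show "(\<lambda>n. measure (mu_tilde \<rho> g n) {x \<in> space (mu_tilde \<rho> g n).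
        dist (Ssum n x / real n, Tsum n x / real n) (0, \<sigma>2) > \<epsilon>}) \<longlonglongrightarrow> 0" if "\<epsilon> > 0" for \<epsilon>
      using law_of_large_numbers[OF g_meas g_nonneg g_le that] .
  next
    assume "\<exists>e>0. \<forall>k<3. \<forall>x\<in>ball 0 e. ((deriv ^^ k) g has_real_derivative (deriv ^^ Suc k) g x) (at x)"
      and d3: "(deriv ^^ 3) g differentiable (at 0)"
    then obtain e where e: "e > 0" "\<forall>k<3. \<forall>x\<in>ball 0 e. ((deriv ^^ k) g has_real_derivative (deriv ^^ Suc k) g x) (at x)"
      by blast
    note coeffs = quartic_coefficients[OF g2 g_le taylor_peano_4[OF e d3]]
    show m: "- (deriv ^^ 4) g 0 / 2 \<ge> 0" using coeffs(1) by simp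
    \<comment> \<open>The Taylor coefficient g''''(0) / 24 equals - m4 / 12 for m4 = - g''''(0) /
      2.\<close>
    have g4: "((\<lambda>u. (g u - u\<^sup>2 / 2) / u ^ 4) \<longlongrightarrow> - (- (deriv ^^ 4) g 0 / 2 / 12)) (at 0)"
      using coeffs(2) by simp
    have "g 0 = 0" using coeffs(3) by simp
    from fluctuations[OF g_meas g_le this g_nonneg g4 m]
    show "weak_conv_m
            (\<lambda>n. distr (mu_tilde \<rho> g n) borel
                   (\<lambda>x. (integral\<^sup>L \<rho> (\<lambda>z. z ^ 4) + - (deriv ^^ 4) g 0 / 2 * \<sigma>2\<^sup>2) powr (1/4) * Ssum n x / (\<sigma>2 * real n powr (3/4))))
            (density lborel (\<lambda>s. ennreal ((4/3) powr (1/4) / Gamma (1/4) * exp (- (s ^ 4) / 12))))"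
      unfolding quartic_law_def \<mu>4_def .
  qed
qed

end
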